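(* A configuration of $k$ real flags $(F_1,\dots,F_k)$ in $\mathbb{RP}^m$ (that is, for the group $PGL_{m+1}$) is positive if and only if there exists a (not necessarily unique) smooth convex curve $C$ in $\mathbb{RP}^m$ such that each flag $F_i$ is the osculating flag to $C$ at a point $x_i\in C$, and the order of the points $x_1,\dots,x_k$ is compatible with an orientation of $C$.
   Context: A flag in $\mathbb{RP}^m$ is a complete flag of projective subspaces (equivalently, a complete flag of linear subspaces of $\mathbb R^{m+1}$, or a Borel subgroup of $PGL_{m+1}(\mathbb R)$). A configuration of $k$ flags is a $PGL_{m+1}(\mathbb R)$-orbit of $k$-tuples of flags. A curve $C\subset\mathbb{RP}^m$ is convex if any hyperplane intersects it in no more than $m$ points. The osculating flag at a point of a smooth curve is the flag of its osculating subspaces of dimensions $0,1,\dots,m-1$. Positivity: let $B^+,B^-$ be the subgroups of upper and lower triangular matrices in $PGL_{m+1}$ and let $U^+(\mathbb R_{>0})$ be the set of totally positive upper triangular unipotent matrices (all minors that do not vanish identically on upper triangular unipotent matrices are positive). Write $u\cdot B=uBu^{-1}$. A configuration of $k$ real flags is positive if it can be written as $$\bigl(B^+,\,B^-,\,u_1\cdot B^-,\,u_1u_2\cdot B^-,\dots,(u_1\cdots u_{k-2})\cdot B^-\bigr),\qquad u_i\in U^+(\mathbb R_{>0}).$$ *)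

theory Defs
  imports "Jordan_Normal_Form.Determinant" "HOL-Analysis.Analysis"
begin

no_notation Matrix.vec_index (infixl "$" 100)

(* Throughout, RP^m is the set of lines in the space real^'n with CARD('n) = m + 1; the
   coordinates are ordered by the well-order (for finite types: linear order) on 'n.
   Projective subspaces of dimension j are linear subspaces of dimension j + 1. *)

definition rp_point :: "real^'n \<Rightarrow> (real^'n) set" where
  "rp_point v = span {v}"

(* Entry j of the list is the projective subspace of dimension j, for 0 \<le> j \<le> m - 1. *)
type_synonym 'n flag = "(real^'n) set list"

definition is_flag :: "'n::finite flag \<Rightarrow> bool" where
  "is_flag F \<longleftrightarrow> length F = CARD('n) - 1 \<and>
     (\<forall>j<length F. subspace (F ! j) \<and> dim (F ! j) = Suc j) \<and> sorted_wrt (\<subseteq>) F"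

type_synonym 'n sqmat = "real^'n^'n"

definition flag_act :: "'n sqmat \<Rightarrow> 'n::finite flag \<Rightarrow> 'n flag" where
  "flag_act g F = map (\<lambda>V. (\<lambda>v. g *v v) ` V) F"

(* Scalar matrices fix every flag, so orbits under GL are the orbits under PGL. *)
definition configuration :: "'n::finite flag list \<Rightarrow> 'n flag list set" where
  "configuration Fs = {map (flag_act g) Fs | g. invertible g}"

(* A Borel subgroup is represented by the unique flag it stabilises, conjugation of Borel
   subgroups becoming the action on flags.  flag_plus and flag_minus are the flags stabilised by
   the upper and by the lower triangular matrices: their j-th entries are spanned by the first,
   respectively the last, j + 1 standard basis vectors. *)
definition flag_plus :: "'n::{finite,wellorder} flag" where
  "flag_plus = map (\<lambda>j. span {axis i 1 | i. card {i'. i' < i} \<le> j}) [0..<CARD('n) - 1]"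

definition flag_minus :: "'n::{finite,wellorder} flag" where
  "flag_minus = map (\<lambda>j. span {axis i 1 | i. card {i'. i < i'} \<le> j}) [0..<CARD('n) - 1]"

definition upper_unipotent :: "'n::{finite,wellorder} sqmat \<Rightarrow> bool" where
  "upper_unipotent A \<longleftrightarrow> (\<forall>i. A $ i $ i = 1) \<and> (\<forall>i j. j < i \<longrightarrow> A $ i $ j = 0)"

(* The minor with row set I and column set J (used for card I = card J). *)
definition minor :: "'n::{finite,wellorder} sqmat \<Rightarrow> 'n set \<Rightarrow> 'n set \<Rightarrow> real" where
  "minor A I J = Determinant.det (Matrix.mat (card I) (card J)
     (\<lambda>(a, b). A $ (sorted_list_of_set I ! a) $ (sorted_list_of_set J ! b)))"

definition totally_positive_unipotent :: "'n::{finite,wellorder} sqmat \<Rightarrow> bool" where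
  "totally_positive_unipotent u \<longleftrightarrow> upper_unipotent u \<and>
     (\<forall>I J. card I = card J \<and> (\<exists>v. upper_unipotent v \<and> minor v I J \<noteq> 0) \<longrightarrow> minor u I J > 0)"

definition matrix_prod_list :: "'n sqmat list \<Rightarrow> 'n::finite sqmat" where
  "matrix_prod_list us = foldr (**) us (Finite_Cartesian_Product.mat 1)"

(* (B+, B-, u_1 B-, u_1 u_2 B-, ..., (u_1 ... u_{k-2}) B-); the entry i = 0 of the mapped list
   is B- itself. *)
definition standard_tuple :: "'n sqmat list \<Rightarrow> 'n::{finite,wellorder} flag list" where
  "standard_tuple us =
     flag_plus # map (\<lambda>i. flag_act (matrix_prod_list (take i us)) flag_minus) [0..<Suc (length us)]"

definition positive_configuration :: "nat \<Rightarrow> 'n::{finite,wellorder} flag list set \<Rightarrow> bool" where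
  "positive_configuration k K \<longleftrightarrow>
     (\<exists>us. length us + 2 = k \<and> (\<forall>u\<in>set us. totally_positive_unipotent u) \<and>
           K = configuration (standard_tuple us))"

definition nth_vector_derivative :: "nat \<Rightarrow> (real \<Rightarrow> 'a::real_normed_vector) \<Rightarrow> real \<Rightarrow> 'a" where
  "nth_vector_derivative j f = ((\<lambda>g t. vector_derivative g (at t)) ^^ j) f"

definition smooth :: "(real \<Rightarrow> 'a::real_normed_vector) \<Rightarrow> bool" where
  "smooth f \<longleftrightarrow> (\<forall>j t. nth_vector_derivative j f differentiable at t)"

(* A smooth curve is a connected one-dimensional manifold without boundary, injectively immersed
   in RP^m.  It is parametrised either by the real line (arc) or by the circle, regarded as the
   reals modulo 1 (loop).  Such a parametrisation, pulled back to the real line, always has a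
   smooth lift \<gamma> to nonzero vectors, and curves are given by these lifts.  The lift of a
   loop is periodic only up to scalars.  The condition dim = 2 says that the projected curve is an
   immersion. *)
definition simple_arc :: "(real \<Rightarrow> real^'n) \<Rightarrow> bool" where
  "simple_arc \<gamma> \<longleftrightarrow> inj (\<lambda>t. rp_point (\<gamma> t))"

definition simple_loop :: "(real \<Rightarrow> real^'n) \<Rightarrow> bool" where
  "simple_loop \<gamma> \<longleftrightarrow> (\<forall>t. rp_point (\<gamma> (t + 1)) = rp_point (\<gamma> t)) \<and>
     inj_on (\<lambda>t. rp_point (\<gamma> t)) {0..<1}"

definition smooth_curve :: "(real \<Rightarrow> real^'n) \<Rightarrow> bool" where
  "smooth_curve \<gamma> \<longleftrightarrow> smooth \<gamma> \<and>
     (\<forall>t. dim {\<gamma> t, vector_derivative \<gamma> (at t)} = 2) \<and>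
     (simple_arc \<gamma> \<or> simple_loop \<gamma>)"

definition curve_points :: "(real \<Rightarrow> real^'n) \<Rightarrow> (real^'n) set set" where
  "curve_points \<gamma> = range (\<lambda>t. rp_point (\<gamma> t))"

definition convex_curve :: "(real^'n::finite) set set \<Rightarrow> bool" where
  "convex_curve C \<longleftrightarrow>
     (\<forall>H. subspace H \<and> dim H = CARD('n) - 1 \<longrightarrow>
        finite {p \<in> C. p \<subseteq> H} \<and> card {p \<in> C. p \<subseteq> H} \<le> CARD('n) - 1)"

(* The span of the derivatives of order at most j of a lift depends neither on the lift nor on the
   parametrisation.  Being equal to a flag forces the derivatives of order < m to be
   linearly independent at the point. *)
definition osculating_flag :: "(real \<Rightarrow> real^'n) \<Rightarrow> real \<Rightarrow> 'n::finite flag" where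
  "osculating_flag \<gamma> t =
     map (\<lambda>j. span ((\<lambda>i. nth_vector_derivative i \<gamma> t) ` {..j})) [0..<CARD('n) - 1]"

(* The points with parameters ts are distinct and occur in the order given by the orientation of
   the parametrisation: linear order on an arc, cyclic order on a loop. *)
definition oriented_points :: "(real \<Rightarrow> real^'n) \<Rightarrow> real list \<Rightarrow> bool" where
  "oriented_points \<gamma> ts \<longleftrightarrow> sorted_wrt (<) ts \<and>
     (simple_loop \<gamma> \<longrightarrow> (\<forall>s\<in>set ts. \<forall>t\<in>set ts. t < s + 1))"

end

theory Submission
  imports Defs
begin

text \<open>
  Let \<open>n = m + 1\<close>.  Both sides of the equivalence are compared through the signs of determinants
  whose rows are initial segments of bases adapted to two or three of the flags.

  From curves to positivity.  Convexity says that a lift \<open>\<gamma>\<close> of the curve is a Chebyshev system: a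
  nonzero functional has at most \<open>n - 1\<close> zeros on it.  The determinant of \<open>\<gamma>\<close> at \<open>n\<close> increasing
  parameters therefore has no zero, and a constant sign.  When parameters collide, values turn into
  derivatives, and in the limit the sign survives only weakly.  It survives strictly because the
  osculating spaces at the marked points have the right dimension: if a confluent determinant were
  zero, a small perturbation of a functional with a multiple zero would have too many zeros
  (\<open>chebyshev_keep_point\<close>, \<open>chebyshev_confluent_independent\<close>, \<open>chebyshev_confluent_sign\<close>).  Such a family of
  signs forces positivity (\<open>determinant_signs_imp_standard\<close>): in coordinates where the first flag is
  the upper one, the other flags are \<open>v\<close> applied to the lower flag with \<open>v\<close> unipotent, and the signs
  concern the minors of the quotients of consecutive \<open>v\<close> with consecutive rows and the last columns.

  Few minors suffice.  Positivity of these minors implies total positivity, and this is proved by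
  means of paths.  Let \<open>N(t)\<close> have positive entries above the diagonal and zeros elsewhere.  The
  minors of the solution of \<open>u' = u N\<close> obey a linear system with nonnegative coefficients, so that
  they become positive at once (\<open>flow_minor_pos\<close>).  A unipotent matrix with the few positive minors is
  a product of elementary matrices with positive parameters (\<open>factorisation\<close>), that is, the endpoint
  of a path along which one entry of \<open>N\<close> is active at a time.  Making all entries slightly positive
  moves the endpoint only a little, and Brouwer's theorem corrects the error
  (\<open>corner_positive_reachable\<close>).

  From positivity to curves.  The last column of such a path is a curve whose osculating flags are
  \<open>u(t)\<close> applied to the lower flag; by Rolle's theorem it is convex (\<open>flow_curve\<close>).  A positive tuple
  whose flags are all in general position to one auxiliary flag, and positive together with it, can
  thus be threaded by one curve.  The upper flag, the first of the given tuple, is not of this kind;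
  but when all flags are moved by a lower triangular matrix near the identity, the old upper flag can
  serve as the auxiliary flag, since strict signs of determinants are stable (\<open>positive_imp_curve\<close>).
\<close>

section \<open>Determinants as functions of their entries\<close>

no_notation Matrix.scalar_prod (infix "\<bullet>" 70)

text \<open>Entries are given by a function on pairs of naturals, so that passing to a submatrix is composition
  with maps of indices.\<close>

definition mdet :: "nat \<Rightarrow> (nat \<Rightarrow> nat \<Rightarrow> real) \<Rightarrow> real" where
  "mdet p f = Determinant.det (Matrix.mat p p (\<lambda>(i, j). f i j))"

lemma mdet_cong:
  "(\<And>i j. i < p \<Longrightarrow> j < p \<Longrightarrow> f i j = g i j) \<Longrightarrow> mdet p f = mdet p g"
  unfolding mdet_def by (rule arg_cong[where f = Determinant.det]) (auto intro!: eq_matI)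

lemma mdet_leibniz:
  "mdet p f = (\<Sum>\<pi> | \<pi> permutes {0..<p}. signof \<pi> * (\<Prod>i = 0..<p. f i (\<pi> i)))"
proof -
  have "(\<Prod>i = 0..<p. Matrix.mat p p (\<lambda>(i, j). f i j) $$ (i, \<pi> i)) = (\<Prod>i = 0..<p. f i (\<pi> i))"
    if "\<pi> permutes {0..<p}" for \<pi>
    by (rule prod.cong[OF refl]) (use permutes_in_image[OF that] in simp)
  then show ?thesis
    unfolding mdet_def det_def'[OF mat_carrier] by (intro sum.cong[OF refl]) simp
qed

lemma mdet_transpose: "mdet p (\<lambda>i j. f j i) = mdet p f"
proof -
  have "Matrix.mat p p (\<lambda>(i, j). f j i) = transpose_mat (Matrix.mat p p (\<lambda>(i, j). f i j))"
    by (auto intro!: eq_matI)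
  then show ?thesis unfolding mdet_def by (simp add: Determinant.det_transpose[OF mat_carrier])
qed

lemma mdet_0 [simp]: "mdet 0 f = 1"
  unfolding mdet_def by simp

lemma mdet_1 [simp]: "mdet (Suc 0) f = f 0 0"
  unfolding mdet_def by (subst det_single) auto

text \<open>A relation between three entry functions applies to rows that come from lists of vectors, where a
  function update would have to be exhibited first.\<close>

lemma mdet_row_linear:
  assumes k: "k < p"
    and row: "\<And>j. j < p \<Longrightarrow> f k j = a * g k j + b * h k j"
    and other: "\<And>i j. i < p \<Longrightarrow> j < p \<Longrightarrow> i \<noteq> k \<Longrightarrow> f i j = g i j \<and> f i j = h i j"
  shows "mdet p f = a * mdet p g + b * mdet p h"
proof -
  have "(\<Prod>i = 0..<p. f i (\<pi> i)) = a * (\<Prod>i = 0..<p. g i (\<pi> i)) + b * (\<Prod>i = 0..<p. h i (\<pi> i))"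
    if "\<pi> permutes {0..<p}" for \<pi>
  proof -
    have \<pi>: "\<pi> i < p" if "i < p" for i
      using permutes_in_image[OF \<open>\<pi> permutes {0..<p}\<close>, of i] that by simp
    have split: "(\<Prod>i = 0..<p. r i (\<pi> i)) = r k (\<pi> k) * (\<Prod>i\<in>{0..<p} - {k}. r i (\<pi> i))"
      for r :: "nat \<Rightarrow> nat \<Rightarrow> real"
      using k by (intro prod.remove) auto
    have "(\<Prod>i\<in>{0..<p} - {k}. f i (\<pi> i)) = (\<Prod>i\<in>{0..<p} - {k}. g i (\<pi> i))"
      "(\<Prod>i\<in>{0..<p} - {k}. f i (\<pi> i)) = (\<Prod>i\<in>{0..<p} - {k}. h i (\<pi> i))"
      by (rule prod.cong; use other \<pi> in force)+
    then show ?thesis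
      unfolding split[of f] split[of g] split[of h] using row[OF \<pi>[OF k]]
      by (simp add: distrib_right)
  qed
  then have "mdet p f = (\<Sum>\<pi> | \<pi> permutes {0..<p}. a * (signof \<pi> * (\<Prod>i = 0..<p. g i (\<pi> i)))
      + b * (signof \<pi> * (\<Prod>i = 0..<p. h i (\<pi> i))))"
    unfolding mdet_leibniz by (intro sum.cong[OF refl]) (simp add: distrib_left)
  then show ?thesis
    unfolding mdet_leibniz by (simp only: sum.distrib sum_distrib_left)
qed

lemma mdet_identical_rows:
  assumes "i < p" "k < p" "i \<noteq> k" "\<And>j. j < p \<Longrightarrow> f i j = f k j"
  shows "mdet p f = 0"
  unfolding mdet_def
  by (rule Determinant.det_identical_rows[of _ p i k]) (use assms in \<open>auto intro!: eq_vecI\<close>)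

lemma mdet_swap_rows:
  assumes "i < p" "k < p" "i \<noteq> k"
  shows "mdet p (\<lambda>l. if l = i then f k else if l = k then f i else f l) = - mdet p f"
proof -
  have "Matrix.mat p p (\<lambda>(l, j). (if l = i then f k else if l = k then f i else f l) j)
      = swaprows i k (Matrix.mat p p (\<lambda>(l, j). f l j))"
    using assms by (auto intro!: eq_matI)
  then show ?thesis
    unfolding mdet_def using det_swaprows[OF assms(1,2,3) mat_carrier[of p p "\<lambda>(l, j). f l j"]]
    by (simp add: case_prod_unfold)
qed

lemma mdet_mult:
  "mdet p (\<lambda>i j. \<Sum>l<p. f i l * g l j) = mdet p f * mdet p g"
proof -
  have "Matrix.mat p p (\<lambda>(i, j). \<Sum>l<p. f i l * g l j)
      = Matrix.mat p p (\<lambda>(i, j). f i j) * Matrix.mat p p (\<lambda>(i, j). g i j)"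
    by (auto intro!: eq_matI simp: scalar_prod_def lessThan_atLeast0)
  then show ?thesis unfolding mdet_def by (simp add: det_mult[of _ p])
qed

lemma mdet_upper_triangular:
  assumes "\<And>i j. j < i \<Longrightarrow> i < p \<Longrightarrow> f i j = 0"
  shows "mdet p f = (\<Prod>i<p. f i i)"
proof -
  have "mdet p f = prod_list (diag_mat (Matrix.mat p p (\<lambda>(i, j). f i j)))"
    unfolding mdet_def
    by (rule det_upper_triangular[of _ p]) (use assms in auto)
  also have "\<dots> = (\<Prod>i<p. f i i)"
    unfolding prod_list_diag_prod by (auto simp: lessThan_atLeast0)
  finally show ?thesis .
qed

lemma mdet_block_lower:
  assumes "\<And>i j. i < a \<Longrightarrow> a \<le> j \<Longrightarrow> j < a + b \<Longrightarrow> f i j = 0"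
  shows "mdet (a + b) f = mdet a f * mdet b (\<lambda>i j. f (a + i) (a + j))"
proof -
  let ?A = "Matrix.mat a a (\<lambda>(i, j). f i j)" and ?B = "0\<^sub>m a b"
  let ?C = "Matrix.mat b a (\<lambda>(i, j). f (a + i) j)"
  let ?D = "Matrix.mat b b (\<lambda>(i, j). f (a + i) (a + j))"
  have "Matrix.mat (a + b) (a + b) (\<lambda>(i, j). f i j) = four_block_mat ?A ?B ?C ?D"
    using assms by (auto intro!: eq_matI)
  then show ?thesis
    unfolding mdet_def by (simp add: det_four_block_mat_upper_right_zero[of _ a _ b])
qed

lemma mdet_block_upper:
  assumes "\<And>i j. a \<le> i \<Longrightarrow> i < a + b \<Longrightarrow> j < a \<Longrightarrow> f i j = 0"
  shows "mdet (a + b) f = mdet a f * mdet b (\<lambda>i j. f (a + i) (a + j))"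
proof -
  have "mdet (a + b) f = mdet (a + b) (\<lambda>i j. f j i)" by (rule mdet_transpose[symmetric])
  also have "\<dots> = mdet a (\<lambda>i j. f j i) * mdet b (\<lambda>i j. f (a + j) (a + i))"
    by (rule mdet_block_lower) (use assms in auto)
  also have "\<dots> = mdet a f * mdet b (\<lambda>i j. f (a + i) (a + j))"
    using mdet_transpose[of a f] mdet_transpose[of b "\<lambda>i j. f (a + i) (a + j)"] by simp
  finally show ?thesis .
qed

lemma mdet_scale:
  "mdet p (\<lambda>i j. x i * f i j * y j) = (\<Prod>i<p. x i) * (\<Prod>i<p. y i) * mdet p f"
proof -
  have "(\<Prod>i = 0..<p. x i * f i (\<pi> i) * y (\<pi> i))
      = (\<Prod>i<p. x i) * (\<Prod>i<p. y i) * (\<Prod>i = 0..<p. f i (\<pi> i))" if "\<pi> permutes {0..<p}" for \<pi>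
  proof -
    have "(\<Prod>i = 0..<p. y (\<pi> i)) = (\<Prod>i = 0..<p. y i)"
      using prod.permute[OF that, of y] by (simp add: o_def)
    then show ?thesis by (simp add: prod.distrib lessThan_atLeast0)
  qed
  then show ?thesis
    unfolding mdet_leibniz sum_distrib_left by (intro sum.cong) (auto simp: algebra_simps)
qed

lemma mdet_tendsto:
  assumes "\<And>i j. i < p \<Longrightarrow> j < p \<Longrightarrow> ((\<lambda>x. f x i j) \<longlongrightarrow> g i j) F"
  shows "((\<lambda>x. mdet p (f x)) \<longlongrightarrow> mdet p g) F"
  unfolding mdet_leibniz
  by (intro tendsto_sum tendsto_mult tendsto_prod tendsto_const)
    (auto intro!: assms simp: permutes_in_image)

lemma mdet_continuous_on:
  assumes "\<And>i j. i < p \<Longrightarrow> j < p \<Longrightarrow> continuous_on S (\<lambda>x. f x i j)"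
  shows "continuous_on S (\<lambda>x. mdet p (f x))"
  using assms unfolding continuous_on_def by (auto intro!: mdet_tendsto)

lemma mdet_eq_0_iff:
  "mdet p f = 0 \<longleftrightarrow> (\<exists>v. (\<exists>j<p. v j \<noteq> 0) \<and> (\<forall>i<p. (\<Sum>j<p. f i j * v j) = 0))"
    (is "?L \<longleftrightarrow> ?R")
proof -
  let ?A = "Matrix.mat p p (\<lambda>(i, j). f i j)"
  have *: "?L \<longleftrightarrow> (\<exists>v. v \<in> carrier_vec p \<and> v \<noteq> 0\<^sub>v p \<and> ?A *\<^sub>v v = 0\<^sub>v p)"
    unfolding mdet_def by (rule det_0_iff_vec_prod_zero) simp
  show ?thesis
  proof
    assume ?L
    then obtain v where v: "v \<in> carrier_vec p" "v \<noteq> 0\<^sub>v p" "?A *\<^sub>v v = 0\<^sub>v p" using * by blast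
    have "\<exists>j<p. vec_index v j \<noteq> 0" using v(1,2) by (metis carrier_vecD eq_vecI index_zero_vec(1,2))
    moreover have "(\<Sum>j<p. f i j * vec_index v j) = 0" if "i < p" for i
    proof -
      have "vec_index (?A *\<^sub>v v) i = 0" using v(3) that by simp
      then show ?thesis using that v(1) by (simp add: scalar_prod_def lessThan_atLeast0)
    qed
    ultimately show ?R by blast
  next
    assume ?R
    then obtain v where v: "\<exists>j<p. v j \<noteq> 0" "\<forall>i<p. (\<Sum>j<p. f i j * v j) = 0" by blast
    have "Matrix.vec p v \<noteq> 0\<^sub>v p" using v(1) by (metis index_vec index_zero_vec(1))
    moreover have "?A *\<^sub>v Matrix.vec p v = 0\<^sub>v p"
      using v(2) by (auto intro!: eq_vecI simp: scalar_prod_def lessThan_atLeast0)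
    ultimately show ?L using * by (meson vec_carrier)
  qed
qed

text \<open>The rows from \<open>b\<close> on have only \<open>p - b - 1\<close> columns outside the zero block, one less than there are
  rows; so every term of the Leibniz sum contains an entry of the block.\<close>

lemma mdet_zero_block:
  assumes b: "b < p" and z: "\<And>i j. b \<le> i \<Longrightarrow> i < p \<Longrightarrow> j \<le> b \<Longrightarrow> f i j = 0"
  shows "mdet p f = 0"
proof -
  have "(\<Prod>i = 0..<p. f i (\<pi> i)) = 0" if "\<pi> permutes {0..<p}" for \<pi>
  proof -
    have "\<exists>i\<in>{b..<p}. \<pi> i \<le> b"
    proof (rule ccontr)
      assume "\<not> ?thesis"
      then have "\<pi> ` {b..<p} \<subseteq> {Suc b..<p}"
        using permutes_in_image[OF that] by (auto simp: not_le Suc_le_eq)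
      moreover have "inj_on \<pi> {b..<p}" using permutes_inj[OF that] by (meson inj_on_subset subset_UNIV)
      ultimately have "card {b..<p} \<le> card {Suc b..<p}"
        by (metis card_image card_mono finite_atLeastLessThan)
      then show False using b by simp
    qed
    then show ?thesis using z by (intro prod_zero) force+
  qed
  then show ?thesis unfolding mdet_leibniz by (intro sum.neutral) auto
qed

section \<open>Coordinates and determinants of lists of vectors\<close>

text \<open>The increasing enumeration of the index type; through it matrices and vectors are read as functions
  of naturals below \<open>CARD('n)\<close>.\<close>

definition en :: "nat \<Rightarrow> 'n::{finite,wellorder}" where
  "en i = sorted_list_of_set (UNIV :: 'n set) ! i"

lemma en_bij: "bij_betw (en :: nat \<Rightarrow> 'n::{finite,wellorder}) {..<CARD('n)} UNIV"
  unfolding en_def by (rule bij_betw_nth) auto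

lemma en_less_iff:
  assumes "i < CARD('n)" "j < CARD('n)"
  shows "(en i :: 'n::{finite,wellorder}) < en j \<longleftrightarrow> i < j"
proof -
  have s: "sorted_wrt (<) (sorted_list_of_set (UNIV :: 'n set))" by (rule strict_sorted_list_of_set)
  have *: "(en i :: 'n) < en j" if "i < j" "j < CARD('n)" for i j
    unfolding en_def by (rule sorted_wrt_nth_less[OF s]) (use that in auto)
  show ?thesis
    using *[of i j] *[of j i] assms by (metis linorder_neqE_nat order_less_asym less_irrefl)
qed

lemma en_eq_iff:
  "i < CARD('n) \<Longrightarrow> j < CARD('n) \<Longrightarrow> (en i :: 'n::{finite,wellorder}) = en j \<longleftrightarrow> i = j"
  by (metis en_less_iff less_irrefl linorder_neqE_nat)

lemma en_cases: obtains i where "i < CARD('n)" "(x :: 'n::{finite,wellorder}) = en i"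
  using en_bij[where 'n = 'n] by (metis bij_betw_iff_bijections iso_tuple_UNIV_I lessThan_iff)

lemma sum_UNIV_en: "(\<Sum>i\<in>UNIV. f (i::'n::{finite,wellorder})) = (\<Sum>i<CARD('n). f (en i))"
  by (rule sum.reindex_bij_betw[OF en_bij, symmetric])

lemma card_below_en:
  assumes i: "i < CARD('n)"
  shows "card {x. x < (en i :: 'n::{finite,wellorder})} = i"
proof -
  have "x \<in> en ` {..<i}" if x: "x < (en i :: 'n)" for x
  proof -
    obtain k where "k < CARD('n)" "x = en k" by (rule en_cases)
    then show ?thesis using x i by (simp add: en_less_iff)
  qed
  moreover have "y < en i" if "y \<in> en ` {..<i}" for y :: 'n
    using that i by (auto simp: en_less_iff)
  ultimately have "{x. x < (en i :: 'n)} = en ` {..<i}" by blast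
  moreover have "inj_on (en :: nat \<Rightarrow> 'n) {..<i}" using i by (simp add: inj_on_def en_eq_iff)
  ultimately show ?thesis by (simp add: card_image)
qed

lemma card_above_en:
  assumes i: "i < CARD('n)"
  shows "card {x. (en i :: 'n::{finite,wellorder}) < x} = CARD('n) - 1 - i"
proof -
  have "x \<in> en ` {Suc i..<CARD('n)}" if x: "(en i :: 'n) < x" for x
  proof -
    obtain k where "k < CARD('n)" "x = en k" by (rule en_cases)
    then show ?thesis using x i by (simp add: en_less_iff)
  qed
  moreover have "en i < y" if "y \<in> en ` {Suc i..<CARD('n)}" for y :: 'n
    using that i by (auto simp: en_less_iff)
  ultimately have "{x. (en i :: 'n) < x} = en ` {Suc i..<CARD('n)}" by blast
  moreover have "inj_on (en :: nat \<Rightarrow> 'n) {Suc i..<CARD('n)}" by (simp add: inj_on_def en_eq_iff)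
  ultimately show ?thesis by (simp add: card_image)
qed

definition eb :: "nat \<Rightarrow> real^'n::{finite,wellorder}" where "eb j = axis (en j) 1"

lemma eb_nth: "i < CARD('n) \<Longrightarrow> j < CARD('n) \<Longrightarrow> (eb j :: real^'n::{finite,wellorder}) $ en i = (if i = j then 1 else 0)"
  unfolding eb_def by (simp add: axis_def en_eq_iff)

lemma vec_eq_en: "(\<And>i. i < CARD('n) \<Longrightarrow> x $ en i = y $ en i) \<Longrightarrow> x = (y :: real^'n::{finite,wellorder})"
proof -
  assume *: "\<And>i. i < CARD('n) \<Longrightarrow> x $ en i = y $ en i"
  have "x $ k = y $ k" for k by (rule en_cases[of k]) (use * in simp)
  then show ?thesis by (simp add: vec_eq_iff)
qed

definition det_list :: "(real^'n::{finite,wellorder}) list \<Rightarrow> real" where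
  "det_list vs = mdet CARD('n) (\<lambda>i j. vs ! i $ en j)"

lemma det_list_eq_0_iff:
  assumes "length vs = CARD('n)"
  shows "det_list (vs :: (real^'n::{finite,wellorder}) list) = 0 \<longleftrightarrow> (\<exists>l. l \<noteq> 0 \<and> (\<forall>v\<in>set vs. l \<bullet> v = 0))"
proof -
  have ip: "l \<bullet> v = (\<Sum>j<CARD('n). v $ en j * l $ en j)" for l v :: "real^'n::{finite,wellorder}"
    unfolding inner_vec_def sum_UNIV_en by (simp add: mult.commute)
  show ?thesis
  proof
    assume "det_list vs = 0"
    then obtain v where v: "\<exists>j<CARD('n). v j \<noteq> 0"
        "\<forall>i<CARD('n). (\<Sum>j<CARD('n). vs ! i $ en j * v j) = 0"
      unfolding det_list_def mdet_eq_0_iff by blast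
    define l :: "(real, 'n) vec" where "l = (\<chi> x. v (card {y. y < x}))"
    have l: "l $ en j = v j" if "j < CARD('n)" for j using that by (simp add: l_def card_below_en)
    obtain j where "j < CARD('n)" "v j \<noteq> 0" using v(1) by blast
    then have "l $ en j \<noteq> 0" using l by simp
    then have "l \<noteq> 0" by auto
    moreover have "l \<bullet> v = 0" if v_in: "v \<in> set vs" for v
    proof -
      obtain i where "i < length vs" "vs ! i = v" using v_in unfolding in_set_conv_nth by blast
      then have "i < CARD('n)" "v = vs ! i" using assms by auto
      then have "(\<Sum>j<CARD('n). v $ en j * l $ en j) = 0" using v(2) by (simp add: l)
      then show ?thesis unfolding ip .
    qed
    ultimately show "\<exists>l. l \<noteq> 0 \<and> (\<forall>v\<in>set vs. l \<bullet> v = 0)" by blast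
  next
    assume "\<exists>l. l \<noteq> 0 \<and> (\<forall>v\<in>set vs. l \<bullet> v = 0)"
    then obtain l where l: "l \<noteq> 0" "\<forall>v\<in>set vs. l \<bullet> v = 0" by blast
    define w where "w j = l $ (en j :: 'n)" for j
    have "\<exists>j<CARD('n). w j \<noteq> 0"
    proof (rule ccontr)
      assume "\<not> ?thesis"
      then have "l = 0" by (intro vec_eq_en) (simp add: w_def)
      then show False using l(1) by simp
    qed
    moreover have "\<forall>i<CARD('n). (\<Sum>j<CARD('n). vs ! i $ en j * w j) = 0"
    proof (intro allI impI)
      fix i assume "i < CARD('n)"
      then have "vs ! i \<in> set vs" using assms by simp
      then have "l \<bullet> (vs ! i) = 0" using l(2) by blast
      then show "(\<Sum>j<CARD('n). vs ! i $ en j * w j) = 0" unfolding ip w_def .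
    qed
    ultimately have "mdet CARD('n) (\<lambda>i j. vs ! i $ en j) = 0"
      unfolding mdet_eq_0_iff by blast
    then show "det_list vs = 0" unfolding det_list_def .
  qed
qed

lemma det_list_linear:
  fixes xs ys :: "(real^'n::{finite,wellorder}) list"
  assumes "length xs + length ys + 1 = CARD('n)"
  shows "det_list (xs @ (a *\<^sub>R v + b *\<^sub>R w) # ys) = a * det_list (xs @ v # ys) + b * det_list (xs @ w # ys)"
  unfolding det_list_def
proof (rule mdet_row_linear[where k = "length xs"])
  show "length xs < CARD('n)" using assms by linarith
qed (auto simp: nth_append nth_Cons')

lemma det_list_repeated:
  fixes xs ys :: "(real^'n::{finite,wellorder}) list"
  assumes "length xs + length ys + 1 = CARD('n)" and "v \<in> set xs \<union> set ys"
  shows "det_list (xs @ v # ys) = 0"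
proof -
  let ?vs = "xs @ v # ys"
  obtain i where i: "i < CARD('n)" "i \<noteq> length xs" "?vs ! i = v"
  proof (cases "v \<in> set xs")
    case True
    then obtain i where "i < length xs" "xs ! i = v" by (metis in_set_conv_nth)
    then show ?thesis using assms by (intro that[of i]) (auto simp: nth_append)
  next
    case False
    then obtain i where "i < length ys" "ys ! i = v" using assms by (metis UnE in_set_conv_nth)
    then show ?thesis using assms by (intro that[of "length xs + 1 + i"]) (auto simp: nth_append)
  qed
  then show ?thesis unfolding det_list_def
    using assms by (intro mdet_identical_rows[of i _ "length xs"]) auto
qed

lemma det_list_span_eq_0:
  fixes xs ys :: "(real^'n::{finite,wellorder}) list"
  assumes l: "length xs + length ys + 1 = CARD('n)" and d: "d \<in> span (set xs \<union> set ys)"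
  shows "det_list (xs @ d # ys) = 0"
  using d
proof (induction rule: span_induct_alt)
  case base
  then show ?case using det_list_linear[OF l, of 0 0 0 0] by simp
next
  case (step c x y)
  then show ?case using det_list_linear[OF l, of c x 1 y] det_list_repeated[OF l, of x] by simp
qed

lemma det_list_replace:
  fixes xs ys :: "(real^'n::{finite,wellorder}) list"
  assumes l: "length xs + length ys + 1 = CARD('n)"
    and d: "v - k *\<^sub>R w \<in> span (set xs \<union> set ys)"
  shows "det_list (xs @ v # ys) = k * det_list (xs @ w # ys)"
  using det_list_linear[OF l, of k w 1 "v - k *\<^sub>R w"] det_list_span_eq_0[OF l d] by simp

text \<open>Two blocks of vectors that span the same flag modulo the vectors before them give determinants that
  differ by the product of the leading coefficients.  All passages between bases adapted to the same
  flag, and between derivatives and divided differences, are instances.\<close>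

lemma det_list_triangular:
  fixes X Y :: "(real^'n::{finite,wellorder}) list"
  assumes "length X + q + length Y = CARD('n)"
    and "\<And>j. j < q \<Longrightarrow> v j - k j *\<^sub>R w j \<in> span (set X \<union> w ` {..<j})"
  shows "det_list (X @ map v [0..<q] @ Y) = (\<Prod>j<q. k j) * det_list (X @ map w [0..<q] @ Y)"
  using assms
proof (induction q arbitrary: Y)
  case 0
  then show ?case by simp
next
  case (Suc q)
  have "det_list (X @ map v [0..<Suc q] @ Y) = det_list (X @ map v [0..<q] @ v q # Y)" by simp
  also have "\<dots> = (\<Prod>j<q. k j) * det_list (X @ map w [0..<q] @ v q # Y)"
    using Suc.prems by (intro Suc.IH) auto
  also have "det_list (X @ map w [0..<q] @ v q # Y) = det_list ((X @ map w [0..<q]) @ v q # Y)" by simp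
  also have "\<dots> = k q * det_list ((X @ map w [0..<q]) @ w q # Y)"
  proof (rule det_list_replace)
    have "set X \<union> w ` {..<q} \<subseteq> set (X @ map w [0..<q]) \<union> set Y" by auto
    from subsetD[OF span_mono[OF this] Suc.prems(2)[of q]]
    show "v q - k q *\<^sub>R w q \<in> span (set (X @ map w [0..<q]) \<union> set Y)" by simp
  qed (use Suc.prems in auto)
  finally show ?case by simp
qed

lemma det_list_swap:
  fixes X Y :: "(real^'n::{finite,wellorder}) list"
  assumes "length X + 2 + length Y = CARD('n)"
  shows "det_list (X @ b # a # Y) = - det_list (X @ a # b # Y)"
proof -
  let ?k = "length X"
  have "det_list (X @ b # a # Y) = mdet CARD('n) (\<lambda>l. if l = ?k then (\<lambda>j. (X @ a # b # Y) ! Suc ?k $ en j) else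
      if l = Suc ?k then (\<lambda>j. (X @ a # b # Y) ! ?k $ en j) else (\<lambda>j. (X @ a # b # Y) ! l $ en j))"
    unfolding det_list_def
    by (rule mdet_cong) (auto simp: nth_append nth_Cons' intro!: arg_cong[where f = "\<lambda>v. v $ _"])
  also have "\<dots> = - det_list (X @ a # b # Y)"
    unfolding det_list_def by (rule mdet_swap_rows) (use assms in auto)
  finally show ?thesis .
qed

lemma det_list_move:
  fixes X Y Z :: "(real^'n::{finite,wellorder}) list"
  assumes "length X + length Y + 1 + length Z = CARD('n)"
  shows "det_list (X @ Y @ v # Z) = (-1) ^ length Y * det_list (X @ v # Y @ Z)"
  using assms
proof (induction Y arbitrary: X)
  case (Cons y Y)
  have "det_list (X @ (y # Y) @ v # Z) = det_list ((X @ [y]) @ Y @ v # Z)" by simp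
  also have "\<dots> = (-1) ^ length Y * det_list ((X @ [y]) @ v # Y @ Z)" by (rule Cons.IH) (use Cons.prems in auto)
  also have "det_list ((X @ [y]) @ v # Y @ Z) = - det_list (X @ v # y # Y @ Z)"
    using det_list_swap[of X "Y @ Z" y v] Cons.prems by simp
  finally show ?case by simp
qed simp

text \<open>The sign of the permutation that reverses the order of \<open>k\<close> objects.\<close>

definition rev_sign :: "nat \<Rightarrow> real" where "rev_sign k = (\<Prod>j<k. (-1) ^ j)"

lemma rev_sign_Suc: "rev_sign (Suc k) = rev_sign k * (-1) ^ k" by (simp add: rev_sign_def)

lemma rev_sign_0 [simp]: "rev_sign 0 = 1" by (simp add: rev_sign_def)

lemma rev_sign_square [simp]: "rev_sign k * rev_sign k = 1"
proof (induction k)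
  case (Suc k)
  have "rev_sign (Suc k) * rev_sign (Suc k) = (rev_sign k * rev_sign k) * ((-1) ^ k * (-1) ^ k)"
    by (simp add: rev_sign_Suc)
  also have "(-1 :: real) ^ k * (-1) ^ k = 1" by (simp flip: power_mult_distrib)
  finally show ?case using Suc by simp
qed simp

lemma rev_sign_nonzero [simp]: "rev_sign k \<noteq> 0" by (metis rev_sign_square mult_zero_left zero_neq_one)

lemma rev_sign_add: "rev_sign (p + q) = rev_sign p * rev_sign q * (-1) ^ (p * q)"
proof (induction q)
  case (Suc q)
  then show ?case by (simp add: rev_sign_Suc power_add)
qed simp

lemma det_list_rev:
  fixes X Y Z :: "(real^'n::{finite,wellorder}) list"
  assumes "length X + length Y + length Z = CARD('n)"
  shows "det_list (X @ rev Y @ Z) = rev_sign (length Y) * det_list (X @ Y @ Z)"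
  using assms
proof (induction Y arbitrary: Z)
  case (Cons y Y)
  have "det_list (X @ rev (y # Y) @ Z) = det_list (X @ rev Y @ y # Z)" by simp
  also have "\<dots> = rev_sign (length Y) * det_list (X @ Y @ y # Z)" by (rule Cons.IH) (use Cons.prems in auto)
  also have "det_list (X @ Y @ y # Z) = (-1) ^ length Y * det_list (X @ y # Y @ Z)"
    by (rule det_list_move) (use Cons.prems in auto)
  finally show ?case by (simp add: rev_sign_Suc)
qed simp

text \<open>Standard basis vectors before and after the block \<open>xs\<close> leave of it the minor in the coordinates
  from \<open>a\<close> to \<open>a + length xs - 1\<close>.\<close>

lemma det_list_block:
  fixes xs :: "(real^'n::{finite,wellorder}) list"
  assumes n: "a + length xs + q = CARD('n)"
  shows "det_list (map eb [0..<a] @ xs @ map eb [a + length xs..<CARD('n)])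
    = mdet (length xs) (\<lambda>i j. xs ! i $ en (a + j))"
proof -
  let ?p = "length xs"
  let ?f = "\<lambda>i j. (map eb [0..<a] @ xs @ map eb [a + ?p..<CARD('n)]) ! i $ (en j :: 'n)"
  have n': "CARD('n) = a + (?p + q)" using n by simp
  have "det_list (map eb [0..<a] @ xs @ map eb [a + ?p..<CARD('n)])
      = mdet (a + (?p + q)) ?f"
    unfolding det_list_def by (subst n'[symmetric]) simp
  also have "\<dots> = mdet a ?f * mdet (?p + q) (\<lambda>i j. ?f (a + i) (a + j))"
    by (rule mdet_block_lower) (use n in \<open>auto simp: nth_append eb_nth\<close>)
  also have "mdet a ?f = 1"
    by (subst mdet_upper_triangular) (use n in \<open>auto simp: nth_append eb_nth\<close>)
  also have "mdet (?p + q) (\<lambda>i j. ?f (a + i) (a + j))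
      = mdet ?p (\<lambda>i j. ?f (a + i) (a + j)) * mdet q (\<lambda>i j. ?f (a + (?p + i)) (a + (?p + j)))"
    by (rule mdet_block_upper) (use n in \<open>auto simp: nth_append eb_nth\<close>)
  also have "mdet q (\<lambda>i j. ?f (a + (?p + i)) (a + (?p + j))) = 1"
    by (subst mdet_upper_triangular) (use n in \<open>auto simp: nth_append eb_nth\<close>)
  also have "mdet ?p (\<lambda>i j. ?f (a + i) (a + j)) = mdet ?p (\<lambda>i j. xs ! i $ en (a + j))"
    by (rule mdet_cong) (auto simp: nth_append)
  finally show ?thesis by simp
qed

lemma matrix_vector_nth_en:
  "((A :: real^'n::{finite,wellorder}^'m) *v x) $ i = (\<Sum>j<CARD('n). A $ i $ en j * x $ en j)"
  by (simp add: matrix_vector_mult_def sum_UNIV_en)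

definition det_sqmat :: "'n::{finite,wellorder} sqmat \<Rightarrow> real" where
  "det_sqmat A = mdet CARD('n) (\<lambda>i j. A $ en i $ en j)"

lemma det_list_matrix:
  fixes A :: "'n::{finite,wellorder} sqmat"
  assumes "length vs = CARD('n)"
  shows "det_list (map ((*v) A) vs) = det_sqmat A * det_list vs"
proof -
  have "det_list (map ((*v) A) vs) = mdet CARD('n) (\<lambda>i j. \<Sum>l<CARD('n). vs ! i $ en l * A $ en j $ en l)"
    unfolding det_list_def using assms
    by (intro mdet_cong) (auto simp: matrix_vector_nth_en mult.commute)
  also have "\<dots> = det_list vs * mdet CARD('n) (\<lambda>l j. A $ en j $ en l)"
    unfolding det_list_def by (rule mdet_mult)
  also have "mdet CARD('n) (\<lambda>l j. A $ en j $ en l) = det_sqmat A"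
    unfolding det_sqmat_def by (rule mdet_transpose)
  finally show ?thesis by simp
qed

lemma det_list_tendsto:
  fixes vs :: "'a \<Rightarrow> (real^'n::{finite,wellorder}) list"
  assumes "\<And>i. i < CARD('n) \<Longrightarrow> ((\<lambda>x. vs x ! i) \<longlongrightarrow> ws ! i) F"
  shows "((\<lambda>x. det_list (vs x)) \<longlongrightarrow> det_list ws) F"
  unfolding det_list_def by (rule mdet_tendsto, rule tendsto_vec_nth, rule assms)

section \<open>Smooth functions of a real variable\<close>

text \<open>Differentiability of order \<open>k\<close>, by recursion on \<open>k\<close>: the closure properties below then are direct
  inductions, which they are not for the iterated vector derivative.\<close>

primrec diffn :: "nat \<Rightarrow> (real \<Rightarrow> 'a::real_normed_vector) \<Rightarrow> bool" where
  "diffn 0 f = True"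
| "diffn (Suc k) f = (\<exists>f'. (\<forall>t. (f has_vector_derivative f' t) (at t)) \<and> diffn k f')"

definition smooth_fun :: "(real \<Rightarrow> 'a::real_normed_vector) \<Rightarrow> bool" where
  "smooth_fun f \<longleftrightarrow> (\<forall>k. diffn k f)"

abbreviation vder :: "(real \<Rightarrow> 'a::real_normed_vector) \<Rightarrow> real \<Rightarrow> 'a" where
  "vder f \<equiv> (\<lambda>t. vector_derivative f (at t))"

lemma diffn_SucD: "diffn (Suc k) f \<Longrightarrow> diffn k f"
  by (induction k arbitrary: f) auto

lemma smooth_fun_vder:
  assumes "smooth_fun f"
  shows "(f has_vector_derivative vder f t) (at t)" "smooth_fun (vder f)"
proof -
  have *: "\<exists>f'. (\<forall>t. (f has_vector_derivative f' t) (at t)) \<and> diffn k f'" for k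
    using assms unfolding smooth_fun_def by (metis diffn.simps(2))
  have u: "f' = vder f" if "\<forall>t. (f has_vector_derivative f' t) (at t)" for f'
    by (rule ext, rule vector_derivative_at[symmetric]) (use that in blast)
  show "(f has_vector_derivative vder f t) (at t)" using *[of 0] u by metis
  show "smooth_fun (vder f)" unfolding smooth_fun_def using * u by metis
qed

lemma csmoothI:
  assumes "\<And>t. (f has_vector_derivative f' t) (at t)" "smooth_fun f'"
  shows "smooth_fun f"
  unfolding smooth_fun_def
proof
  fix k show "diffn k f" using assms unfolding smooth_fun_def by (cases k) auto
qed

lemma smooth_fun_continuous: "smooth_fun f \<Longrightarrow> continuous_on S f"
  by (meson continuous_at_imp_continuous_on smooth_fun_vder(1) has_vector_derivative_continuous)

lemma smooth_fun_isCont: "smooth_fun f \<Longrightarrow> isCont f t"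
  by (meson smooth_fun_vder(1) has_vector_derivative_continuous)

lemma nth_vder_0 [simp]: "nth_vector_derivative 0 f = f"
  by (simp add: nth_vector_derivative_def)

lemma nth_vder_Suc: "nth_vector_derivative (Suc j) f = vder (nth_vector_derivative j f)"
  by (simp add: nth_vector_derivative_def)

lemma nth_vder_Suc': "nth_vector_derivative (Suc j) f = nth_vector_derivative j (vder f)"
  unfolding nth_vector_derivative_def by (simp add: funpow_Suc_right del: funpow.simps)

lemma smooth_fun_nth: "smooth_fun f \<Longrightarrow> smooth_fun (nth_vector_derivative j f)"
  by (induction j) (auto simp: nth_vder_Suc smooth_fun_vder)

lemma smooth_iff_smooth_fun: "smooth f \<longleftrightarrow> smooth_fun f"
proof
  assume s: "smooth f"
  have "diffn k (nth_vector_derivative j f)" for k j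
  proof (induction k arbitrary: j)
    case (Suc k)
    have "(nth_vector_derivative j f has_vector_derivative nth_vector_derivative (Suc j) f t) (at t)" for t
      using s unfolding smooth_def nth_vder_Suc by (simp add: vector_derivative_works)
    then show ?case using Suc by auto
  qed simp
  from this[of _ 0] show "smooth_fun f" by (simp add: smooth_fun_def)
next
  assume "smooth_fun f"
  then show "smooth f"
    unfolding smooth_def by (metis smooth_fun_nth smooth_fun_vder(1) differentiableI_vector)
qed

lemma diffn_const: "diffn k (\<lambda>t. c)"
proof (induction k arbitrary: c)
  case (Suc k)
  then show ?case by (auto intro!: exI[of _ "\<lambda>t. 0"] derivative_eq_intros)
qed simp

lemma diffn_add: "diffn k f \<Longrightarrow> diffn k g \<Longrightarrow> diffn k (\<lambda>t. f t + g t)"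
proof (induction k arbitrary: f g)
  case (Suc k)
  then obtain f' g' where *: "\<forall>t. (f has_vector_derivative f' t) (at t)" "diffn k f'"
    "\<forall>t. (g has_vector_derivative g' t) (at t)" "diffn k g'" by auto
  then show ?case using Suc.IH[of f' g']
    by (auto intro!: exI[of _ "\<lambda>t. f' t + g' t"] has_vector_derivative_add)
qed simp

lemma diffn_scaleR: "diffn k c \<Longrightarrow> diffn k g \<Longrightarrow> diffn k (\<lambda>t. c t *\<^sub>R g t)"
proof (induction k arbitrary: c g)
  case (Suc k)
  then obtain c' g' where *: "\<forall>t. (c has_vector_derivative c' t) (at t)" "diffn k c'"
    "\<forall>t. (g has_vector_derivative g' t) (at t)" "diffn k g'" by auto
  have "diffn k (\<lambda>t. c t *\<^sub>R g' t + c' t *\<^sub>R g t)"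
    using * Suc.IH diffn_SucD[OF Suc.prems(1)] diffn_SucD[OF Suc.prems(2)] by (intro diffn_add) auto
  moreover have "((\<lambda>t. c t *\<^sub>R g t) has_vector_derivative c t *\<^sub>R g' t + c' t *\<^sub>R g t) (at t)" for t
    using * by (intro has_vector_derivative_scaleR) (auto simp: has_real_derivative_iff_has_vector_derivative)
  ultimately show ?case unfolding diffn.simps by (intro exI[of _ "\<lambda>t. c t *\<^sub>R g' t + c' t *\<^sub>R g t"] conjI allI)
qed simp

lemma diffn_linear: "bounded_linear L \<Longrightarrow> diffn k f \<Longrightarrow> diffn k (\<lambda>t. L (f t))"
proof (induction k arbitrary: f)
  case (Suc k)
  then obtain f' where "\<forall>t. (f has_vector_derivative f' t) (at t)" "diffn k f'" by auto
  then show ?case unfolding diffn.simps using Suc.IH[of f'] Suc.prems(1)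
    by (intro exI[of _ "\<lambda>t. L (f' t)"] conjI allI) (auto intro: bounded_linear.has_vector_derivative)
qed simp

lemma diffn_affine: "diffn k f \<Longrightarrow> diffn k (\<lambda>t. f (a * t + b))"
proof (induction k arbitrary: f)
  case (Suc k)
  then obtain f' where *: "\<forall>t. (f has_vector_derivative f' t) (at t)" "diffn k f'" by auto
  have "((\<lambda>t. f (a * t + b)) has_vector_derivative a *\<^sub>R f' (a * t + b)) (at t)" for t
  proof -
    have "((\<lambda>t. a * t + b) has_vector_derivative a) (at t)" by (auto intro!: derivative_eq_intros)
    from vector_diff_chain_at[OF this, of f "f' (a * t + b)"] show ?thesis using *(1) by (simp add: o_def)
  qed
  moreover have "diffn k (\<lambda>t. a *\<^sub>R f' (a * t + b))" by (intro diffn_scaleR diffn_const Suc.IH *)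
  ultimately show ?case unfolding diffn.simps by (intro exI[of _ "\<lambda>t. a *\<^sub>R f' (a * t + b)"] conjI allI)
qed simp

lemma smooth_fun_const: "smooth_fun (\<lambda>t. c)" by (simp add: smooth_fun_def diffn_const)
lemma smooth_fun_add: "smooth_fun f \<Longrightarrow> smooth_fun g \<Longrightarrow> smooth_fun (\<lambda>t. f t + g t)" by (simp add: smooth_fun_def diffn_add)
lemma smooth_fun_scaleR: "smooth_fun c \<Longrightarrow> smooth_fun g \<Longrightarrow> smooth_fun (\<lambda>t. c t *\<^sub>R g t)" by (simp add: smooth_fun_def diffn_scaleR)
lemma smooth_fun_mult: "smooth_fun c \<Longrightarrow> smooth_fun g \<Longrightarrow> smooth_fun (\<lambda>t. c t * g t :: real)" using smooth_fun_scaleR[of c g] by simp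
lemma smooth_fun_linear: "bounded_linear L \<Longrightarrow> smooth_fun f \<Longrightarrow> smooth_fun (\<lambda>t. L (f t))" by (simp add: smooth_fun_def diffn_linear)
lemma smooth_fun_affine: "smooth_fun f \<Longrightarrow> smooth_fun (\<lambda>t. f (a * t + b))" by (simp add: smooth_fun_def diffn_affine)
lemma smooth_fun_sum: "(\<And>i. i \<in> I \<Longrightarrow> smooth_fun (f i)) \<Longrightarrow> smooth_fun (\<lambda>t. \<Sum>i\<in>I. f i t)"
  by (induction I rule: infinite_finite_induct) (auto intro: smooth_fun_const smooth_fun_add)
lemma smooth_fun_ident: "smooth_fun (\<lambda>t::real. t)"
  by (rule csmoothI[of _ "\<lambda>t. 1"]) (auto intro!: derivative_eq_intros smooth_fun_const)

section \<open>Divided differences\<close>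

text \<open>The divided difference of \<open>g\<close> at \<open>t\<close> and \<open>x\<close>, as a function of \<open>x\<close> that is continuous at \<open>t\<close>.\<close>

definition divdiff :: "real \<Rightarrow> (real \<Rightarrow> 'a::real_normed_vector) \<Rightarrow> real \<Rightarrow> 'a" where
  "divdiff t g x = (if x = t then vder g t else (1 / (x - t)) *\<^sub>R (g x - g t))"

lemma divdiff_eq: "g x = g t + (x - t) *\<^sub>R divdiff t g x"
  by (simp add: divdiff_def)

text \<open>The divided difference is the mean of the derivative over the segment from \<open>t\<close> to \<open>x\<close>, and such a
  mean can be differentiated under the integral sign.  Each differentiation brings out a factor \<open>s\<close>,
  hence the weights \<open>s ^ j\<close> in the induction.\<close>

lemma smooth_fun_divdiff:
  fixes g :: "real \<Rightarrow> 'a::euclidean_space"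
  assumes g: "smooth_fun g"
  shows "smooth_fun (divdiff t g)"
proof -
  have "diffn k (\<lambda>x. integral {0..1} (\<lambda>s. s ^ j *\<^sub>R h (t + s * (x - t))))"
    if "smooth_fun h" for k j and h :: "real \<Rightarrow> 'a"
    using that
  proof (induction k arbitrary: j h)
    case (Suc k)
    have c: "continuous_on S (\<lambda>x. h (f x))" if "continuous_on S f" for S and f :: "'c::topological_space \<Rightarrow> real"
      using continuous_on_compose2[OF smooth_fun_continuous[OF Suc.prems, of UNIV] that] by auto
    have c': "continuous_on S (\<lambda>x. vder h (f x))" if "continuous_on S f" for S and f :: "'c::topological_space \<Rightarrow> real"
      using continuous_on_compose2[OF smooth_fun_continuous[OF smooth_fun_vder(2)[OF Suc.prems], of UNIV] that] by auto
    have "((\<lambda>x. integral (cbox 0 1) (\<lambda>s. s ^ j *\<^sub>R h (t + s * (x - t)))) has_vector_derivative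
        integral (cbox 0 1) (\<lambda>s. s ^ Suc j *\<^sub>R vder h (t + s * (x - t)))) (at x within UNIV)" for x
    proof (rule leibniz_rule_vector_derivative)
      fix x s :: real
      have "((\<lambda>x. t + s * (x - t)) has_vector_derivative s) (at x)"
        by (auto intro!: derivative_eq_intros)
      from vector_diff_chain_at[OF this smooth_fun_vder(1)[OF Suc.prems]]
      have "((\<lambda>x. h (t + s * (x - t))) has_vector_derivative s *\<^sub>R vder h (t + s * (x - t))) (at x)"
        by (simp add: o_def)
      then have "((\<lambda>x. s ^ j *\<^sub>R h (t + s * (x - t))) has_vector_derivative s ^ j *\<^sub>R s *\<^sub>R vder h (t + s * (x - t))) (at x)"
        by (intro bounded_linear.has_vector_derivative[OF bounded_linear_scaleR_right])
      then show "((\<lambda>x. s ^ j *\<^sub>R h (t + s * (x - t))) has_vector_derivative s ^ Suc j *\<^sub>R vder h (t + s * (x - t))) (at x within UNIV)"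
        by (simp add: mult.commute)
    next
      fix x show "(\<lambda>s. s ^ j *\<^sub>R h (t + s * (x - t))) integrable_on cbox 0 1"
        by (intro integrable_continuous continuous_intros c)
    next
      show "continuous_on (UNIV \<times> cbox 0 1) (\<lambda>(x, s). s ^ Suc j *\<^sub>R vder h (t + s * (x - t)))"
        unfolding split_def by (intro continuous_intros c')
    qed auto
    then have "\<forall>x. ((\<lambda>x. integral {0..1} (\<lambda>s. s ^ j *\<^sub>R h (t + s * (x - t)))) has_vector_derivative
        integral {0..1} (\<lambda>s. s ^ Suc j *\<^sub>R vder h (t + s * (x - t)))) (at x)" by (simp del: power_Suc)
    then show ?case unfolding diffn.simps using Suc.IH[OF smooth_fun_vder(2)[OF Suc.prems], of "Suc j"]
      by (intro exI[of _ "\<lambda>x. integral {0..1} (\<lambda>s. s ^ Suc j *\<^sub>R vder h (t + s * (x - t)))"] conjI)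
  qed simp
  then have "smooth_fun (\<lambda>x. integral {0..1} (\<lambda>s. s ^ 0 *\<^sub>R vder g (t + s * (x - t))))"
    using smooth_fun_vder(2)[OF g] unfolding smooth_fun_def[of "\<lambda>x. integral _ (_ x)"] by (intro allI)
  moreover have "integral {0..1} (\<lambda>s. s ^ 0 *\<^sub>R vder g (t + s * (x - t))) = divdiff t g x" for x
  proof (cases "x = t")
    case False
    have "((\<lambda>s. (x - t) *\<^sub>R vder g (t + s * (x - t))) has_integral g (t + 1 * (x - t)) - g (t + 0 * (x - t))) {0..1}"
    proof (rule fundamental_theorem_of_calculus)
      fix s :: real
      have "((\<lambda>s. t + s * (x - t)) has_vector_derivative (x - t)) (at s)"
        by (auto intro!: derivative_eq_intros)
      from vector_diff_chain_at[OF this smooth_fun_vder(1)[OF g]]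
      have "((\<lambda>s. g (t + s * (x - t))) has_vector_derivative (x - t) *\<^sub>R vder g (t + s * (x - t))) (at s)"
        by (simp add: o_def)
      then show "((\<lambda>s. g (t + s * (x - t))) has_vector_derivative (x - t) *\<^sub>R vder g (t + s * (x - t))) (at s within {0..1})"
        by (rule has_vector_derivative_at_within)
    qed simp
    from has_integral_cmul[OF this, of "1 / (x - t)"]
    show ?thesis using False by (simp add: divdiff_def integral_unique)
  qed (simp add: divdiff_def)
  ultimately show ?thesis by simp
qed

section \<open>A bump function\<close>

lemma poly_exp_tendsto_0: "((\<lambda>y::real. poly p y * exp (- y)) \<longlongrightarrow> 0) at_top"
proof -
  have "((\<lambda>y::real. \<Sum>i\<le>degree p. coeff p i * (y ^ i / exp y)) \<longlongrightarrow> (\<Sum>i\<le>degree p. coeff p i * 0)) at_top"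
    by (intro tendsto_sum tendsto_mult tendsto_const tendsto_power_div_exp_0)
  moreover have "(\<Sum>i\<le>degree p. coeff p i * (y ^ i / exp y)) = poly p y * exp (- y)" for y :: real
    by (simp add: poly_altdef sum_distrib_right exp_minus divide_simps)
  ultimately show ?thesis by simp
qed

text \<open>For \<open>p = 1\<close> the standard example of a smooth function that vanishes to infinite order.  The
  polynomial in \<open>1 / x\<close> makes the class closed under differentiation.\<close>

definition flat :: "real poly \<Rightarrow> real \<Rightarrow> real" where
  "flat p x = (if x > 0 then poly p (1 / x) * exp (- (1 / x)) else 0)"

lemma flat_deriv:
  "(flat p has_real_derivative flat ([:0, 0, 1:] * (p - pderiv p)) x) (at x)"
proof (cases "x > 0 \<or> x < 0")
  case True
  then consider "x > 0" | "x < 0" by blast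
  then show ?thesis
  proof cases
    case 1
    have "((\<lambda>x. poly p (1 / x) * exp (- (1 / x))) has_real_derivative
        flat ([:0, 0, 1:] * (p - pderiv p)) x) (at x)"
      using 1 by (auto intro!: derivative_eq_intros DERIV_chain2[OF poly_DERIV]
          simp: flat_def field_simps power2_eq_square)
    then show ?thesis
      by (rule has_field_derivative_transform_within_open[of _ _ _ "{0<..}"]) (use 1 in \<open>auto simp: flat_def\<close>)
  next
    case 2
    have "((\<lambda>x. 0) has_real_derivative flat ([:0, 0, 1:] * (p - pderiv p)) x) (at x)"
      using 2 by (simp add: flat_def)
    then show ?thesis
      by (rule has_field_derivative_transform_within_open[of _ _ _ "{..<0}"]) (use 2 in \<open>auto simp: flat_def\<close>)
  qed
next
  case False
  then have x: "x = 0" by simp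
  have "((\<lambda>h. flat p h / h) \<longlongrightarrow> 0) (at 0)"
  proof -
    have "((\<lambda>h. flat p h / h) \<longlongrightarrow> 0) (at_left 0)"
      by (rule tendsto_eventually) (auto simp: eventually_at_left_field flat_def intro!: exI[of _ "-1"])
    moreover have "((\<lambda>h. flat p h / h) \<longlongrightarrow> 0) (at_right 0)"
    proof -
      have "((\<lambda>h. poly ([:0, 1:] * p) (inverse h) * exp (- inverse h)) \<longlongrightarrow> 0) (at_right (0::real))"
        by (rule filterlim_compose[OF poly_exp_tendsto_0 filterlim_inverse_at_top_right])
      then show ?thesis
        by (rule Lim_transform_eventually)
          (auto simp: eventually_at_right_field flat_def divide_simps intro!: exI[of _ 1])
    qed
    ultimately show ?thesis by (simp add: filterlim_split_at)
  qed
  then show ?thesis unfolding x DERIV_def by (simp add: flat_def)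
qed

lemma smooth_fun_flat: "smooth_fun (flat p)"
proof -
  have "diffn k (flat p)" for k p
  proof (induction k arbitrary: p)
    case (Suc k)
    show ?case
      using flat_deriv Suc by (auto simp: has_real_derivative_iff_has_vector_derivative
          intro!: exI[of _ "flat ([:0, 0, 1:] * (p - pderiv p))"] simp del: mult_pCons_left)
  qed simp
  then show ?thesis by (simp add: smooth_fun_def)
qed

lemma bump_exists:
  obtains \<phi> :: "real \<Rightarrow> real" where "smooth_fun \<phi>" "\<And>t. \<phi> t \<ge> 0" "\<And>t. t \<le> 0 \<or> t \<ge> 1 \<Longrightarrow> \<phi> t = 0"
    "integral {0..1} \<phi> = 1"
proof -
  define b where "b = (\<lambda>t. flat 1 t * flat 1 ((-1) * t + 1))"
  have s: "smooth_fun b" unfolding b_def by (intro smooth_fun_mult smooth_fun_flat smooth_fun_affine)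
  have nn: "b t \<ge> 0" for t by (simp add: b_def flat_def)
  have z: "b t = 0" if "t \<le> 0 \<or> t \<ge> 1" for t using that by (auto simp: b_def flat_def)
  have i: "b integrable_on {0..1}" by (intro integrable_continuous_real smooth_fun_continuous s)
  have "integral {0..1} b \<noteq> 0"
  proof
    assume "integral {0..1} b = 0"
    then have "\<forall>t\<in>{0..1}. b t = 0"
      using integral_eq_0_iff[of 0 1 b] smooth_fun_continuous[OF s] nn by auto
    then have "b (1/2) = 0" by simp
    then show False by (simp add: b_def flat_def)
  qed
  moreover have "integral {0..1} b \<ge> 0" using nn by (intro integral_nonneg i)
  ultimately have pos: "integral {0..1} b > 0" by simp
  show ?thesis
  proof (rule that[of "\<lambda>t. (1 / integral {0..1} b) * b t"])
    show "smooth_fun (\<lambda>t. (1 / integral {0..1} b) * b t)" by (intro smooth_fun_mult smooth_fun_const s)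
    show "integral {0..1} (\<lambda>t. (1 / integral {0..1} b) * b t) = 1"
      using pos by (subst integral_mult_right) auto
  qed (use nn z pos in auto)
qed

section \<open>Antiderivatives\<close>

text \<open>One of the two intervals has no interior, so that both signs of \<open>t\<close> are covered.\<close>

definition antideriv :: "(real \<Rightarrow> real) \<Rightarrow> real \<Rightarrow> real" where
  "antideriv f t = integral {0..t} f - integral {t..0} f"

lemma antideriv_0 [simp]: "antideriv f 0 = 0" by (simp add: antideriv_def)

lemma antideriv_deriv:
  assumes c: "continuous_on UNIV f"
  shows "(antideriv f has_real_derivative f t) (at t)"
proof -
  define B where "B = \<bar>t\<bar> + 1"
  have i: "f integrable_on {a..b}" for a b
    by (intro integrable_continuous_real continuous_on_subset[OF c]) auto
  have eq: "antideriv f s = integral {-B..s} f - integral {-B..0} f" if "s \<in> {-B<..<B}" for s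
  proof (cases "s \<ge> 0")
    case True
    then have "integral {-B..0} f + integral {0..s} f = integral {-B..s} f"
      using that by (intro Henstock_Kurzweil_Integration.integral_combine i) auto
    then show ?thesis using True by (cases "s = 0") (auto simp: antideriv_def)
  next
    case False
    then have "integral {-B..s} f + integral {s..0} f = integral {-B..0} f"
      using that by (intro Henstock_Kurzweil_Integration.integral_combine i) auto
    then show ?thesis using False by (auto simp: antideriv_def)
  qed
  have "((\<lambda>s. integral {-B..s} f) has_real_derivative f t) (at t within {-B..B})"
    by (rule integral_has_real_derivative) (auto intro: continuous_on_subset[OF c] simp: B_def)
  then have "((\<lambda>s. integral {-B..s} f) has_real_derivative f t) (at t)"
    by (subst (asm) at_within_interior) (auto simp: B_def)
  then have "((\<lambda>s. integral {-B..s} f - integral {-B..0} f) has_real_derivative f t) (at t)"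
    by (auto intro!: derivative_eq_intros)
  then show ?thesis
    by (rule has_field_derivative_transform_within_open[of _ _ _ "{-B<..<B}"]) (auto simp: eq B_def)
qed

section \<open>Linear algebra\<close>

lemma separate_from_span:
  fixes x :: "'a::euclidean_space"
  assumes "x \<notin> span S"
  obtains h where "\<And>s. s \<in> S \<Longrightarrow> h \<bullet> s = 0" "h \<bullet> x \<noteq> 0"
proof -
  obtain y z where yz: "y \<in> span S" "\<And>w. w \<in> span S \<Longrightarrow> orthogonal z w" "x = y + z"
    using orthogonal_subspace_decomp_exists by blast
  have "z \<noteq> 0" using yz assms by auto
  moreover have "z \<bullet> y = 0" using yz by (auto simp: orthogonal_def)
  ultimately have "z \<bullet> x \<noteq> 0" by (simp add: yz(3) inner_add_right)
  moreover have "z \<bullet> s = 0" if "s \<in> S" for s using yz(2)[of s] that by (auto simp: orthogonal_def span_base)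
  ultimately show ?thesis using that by blast
qed

definition annihilator :: "'a::euclidean_space set \<Rightarrow> 'a set" where
  "annihilator W = {l. \<forall>w\<in>W. l \<bullet> w = 0}"

lemma dim_annihilator: "dim (annihilator W) + dim W = DIM('a)" for W :: "'a::euclidean_space set"
proof -
  have "annihilator W = {y. \<forall>x\<in>span W. orthogonal x y}"
  proof -
    have "(\<forall>w\<in>W. l \<bullet> w = 0) \<longleftrightarrow> (\<forall>x\<in>span W. orthogonal x l)" for l
    proof
      assume *: "\<forall>w\<in>W. l \<bullet> w = 0"
      have "orthogonal l x" if "x \<in> span W" for x
        by (rule orthogonal_to_span[OF that]) (use * in \<open>simp add: orthogonal_def\<close>)
      then show "\<forall>x\<in>span W. orthogonal x l" by (simp add: orthogonal_commute)
    qed (auto simp: orthogonal_def inner_commute span_base)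
    then show ?thesis by (auto simp: annihilator_def)
  qed
  moreover have "dim {y \<in> UNIV. \<forall>x\<in>span W. orthogonal x y} + dim (span W) = dim (UNIV :: 'a set)"
    by (rule dim_subspace_orthogonal_to_vectors) auto
  ultimately show ?thesis by simp
qed

lemma dim_hyperplane_section:
  fixes L :: "'a::euclidean_space set"
  assumes L: "subspace L"
  shows "dim L \<le> Suc (dim {l \<in> L. l \<bullet> v = 0})"
    and "h \<in> L \<Longrightarrow> h \<bullet> v \<noteq> 0 \<Longrightarrow> dim L = Suc (dim {l \<in> L. l \<bullet> v = 0})"
proof -
  let ?L = "{l \<in> L. l \<bullet> v = 0}"
  have s: "subspace ?L" using L by (auto simp: subspace_def inner_add_left)
  have *: "dim L = Suc (dim ?L)" if h: "h \<in> L" "h \<bullet> v \<noteq> 0" for h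
  proof -
    have "h \<notin> span ?L" using h(2) s by (metis (mono_tags, lifting) mem_Collect_eq span_eq_iff)
    then have d: "dim (insert h ?L) = Suc (dim ?L)" by (simp add: dim_insert)
    have "L \<subseteq> span (insert h ?L)"
    proof
      fix l assume l: "l \<in> L"
      define c where "c = (l \<bullet> v) / (h \<bullet> v)"
      have "l - c *\<^sub>R h \<in> ?L"
        using l h L by (auto simp: c_def inner_diff_left subspace_diff subspace_scale)
      then show "l \<in> span (insert h ?L)" by (meson span_base span_breakdown_eq)
    qed
    then have "dim L \<le> dim (insert h ?L)" by (metis dim_span dim_subset)
    moreover have "dim (insert h ?L) \<le> dim L" by (rule dim_subset) (use h in auto)
    ultimately show ?thesis using d by simp
  qed
  then show "h \<in> L \<Longrightarrow> h \<bullet> v \<noteq> 0 \<Longrightarrow> dim L = Suc (dim ?L)" .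
  show "dim L \<le> Suc (dim ?L)"
  proof (cases "\<exists>h\<in>L. h \<bullet> v \<noteq> 0")
    case False
    then have "?L = L" by auto
    then show ?thesis by simp
  qed (use * in auto)
qed

lemma annihilator_nonzero:
  fixes L :: "'a::euclidean_space set"
  assumes "finite V" "subspace L" "card V < dim L"
  obtains h where "h \<in> L" "h \<noteq> 0" "\<And>v. v \<in> V \<Longrightarrow> h \<bullet> v = 0"
  using assms
proof (induction V arbitrary: L thesis rule: finite_induct)
  case empty
  have "L \<noteq> {0}" using empty.prems by auto
  then obtain h where "h \<in> L" "h \<noteq> 0" using subspace_0[OF empty.prems(2)] by blast
  then show ?case using empty.prems(1)[of h] by simp
next
  case (insert v V)
  let ?L = "{l \<in> L. l \<bullet> v = 0}"
  have "subspace ?L" using insert.prems(2) by (auto simp: subspace_def inner_add_left)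
  moreover have "card V < dim ?L"
    using dim_hyperplane_section(1)[OF insert.prems(2), of v] insert by simp
  ultimately obtain h where "h \<in> ?L" "h \<noteq> 0" "\<And>v. v \<in> V \<Longrightarrow> h \<bullet> v = 0"
    using insert.IH[of ?L] by blast
  then show ?case using insert.prems(1)[of h] by auto
qed

lemma span_insert_cong:
  fixes v :: "'a::real_vector"
  assumes "v - k *\<^sub>R w \<in> span A" "k \<noteq> 0"
  shows "span (insert v A) = span (insert w A)"
proof
  have "v \<in> span (insert w A)" using assms(1) span_breakdown_eq by blast
  then show "span (insert v A) \<subseteq> span (insert w A)"
    by (metis insert_subset span_mono span_span subset_insertI span_superset order_trans)
  have "w - (1 / k) *\<^sub>R v = (- 1 / k) *\<^sub>R (v - k *\<^sub>R w)" using assms(2) by (simp add: algebra_simps)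
  then have "w - (1 / k) *\<^sub>R v \<in> span A" using assms(1) by (metis span_scale)
  then have "w \<in> span (insert v A)" using span_breakdown_eq by blast
  then show "span (insert w A) \<subseteq> span (insert v A)"
    by (metis insert_subset span_mono span_span subset_insertI span_superset order_trans)
qed

section \<open>Chebyshev systems and zero counting\<close>

text \<open>The functionals in \<open>L\<close> act through the inner product, and the functions \<open>\<lambda>x. l \<bullet> g x\<close> with
  \<open>l \<in> L\<close> form a Chebyshev system on \<open>X\<close>.  For \<open>L = UNIV\<close> this says that the values of \<open>g\<close> at any
  \<open>d\<close> points of \<open>X\<close> are independent; smaller \<open>L\<close> express the same for projections of the curve.\<close>

definition chebyshev :: "'a::euclidean_space set \<Rightarrow> (real \<Rightarrow> 'a) \<Rightarrow> real set \<Rightarrow> nat \<Rightarrow> bool" where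
  "chebyshev L g X d \<longleftrightarrow> subspace L \<and> dim L = d \<and>
     (\<forall>l\<in>L. l \<noteq> 0 \<longrightarrow> finite {x \<in> X. l \<bullet> g x = 0} \<and> card {x \<in> X. l \<bullet> g x = 0} < d)"

lemma chebyshev_zeros:
  assumes "chebyshev L g X d" "l \<in> L" "l \<noteq> 0" "Z \<subseteq> X" "\<And>x. x \<in> Z \<Longrightarrow> l \<bullet> g x = 0"
  shows "finite Z" "card Z < d"
proof -
  have f: "finite {x \<in> X. l \<bullet> g x = 0}" "card {x \<in> X. l \<bullet> g x = 0} < d"
    using assms unfolding chebyshev_def by auto
  have s: "Z \<subseteq> {x \<in> X. l \<bullet> g x = 0}" using assms by auto
  show "finite Z" by (rule finite_subset[OF s f(1)])
  show "card Z < d" using card_mono[OF f(1) s] f(2) by simp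
qed

lemma chebyshev_interpolate:
  assumes T: "chebyshev L g X d" and X: "infinite X" and Z: "finite Z" "Z \<subseteq> X" "card Z < d"
    and z: "z \<in> X" "z \<notin> Z"
  obtains h where "h \<in> L" "\<And>x. x \<in> Z \<Longrightarrow> h \<bullet> g x = 0" "h \<bullet> g z = 1"
proof -
  have L: "subspace L" "dim L = d" using T by (auto simp: chebyshev_def)
  have "infinite (X - insert z Z)" using X Z by (simp add: finite.insertI)
  then obtain Y where Y: "Y \<subseteq> X - insert z Z" "finite Y" "card Y = d - 1 - card Z"
    using infinite_arbitrarily_large by metis
  have cZY: "card (Z \<union> Y) = d - 1" using Y Z by (subst card_Un_disjoint) auto
  have "card (g ` (Z \<union> Y)) \<le> d - 1" using card_image_le[of "Z \<union> Y" g] cZY Z Y by simp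
  then have "card (g ` (Z \<union> Y)) < dim L" using L Z(3) by simp
  then obtain h where h: "h \<in> L" "h \<noteq> 0" "\<And>v. v \<in> g ` (Z \<union> Y) \<Longrightarrow> h \<bullet> v = 0"
    using annihilator_nonzero[of "g ` (Z \<union> Y)" L] L Z Y by auto
  have "h \<bullet> g z \<noteq> 0"
  proof
    assume 0: "h \<bullet> g z = 0"
    have "card (insert z (Z \<union> Y)) < d"
      by (rule chebyshev_zeros[OF T h(1,2)]) (use h(3) 0 Z Y z in auto)
    moreover have "card (insert z (Z \<union> Y)) = Suc (d - 1)" using cZY z Y Z by (subst card_insert_disjoint) auto
    ultimately show False by simp
  qed
  then show ?thesis
    using h by (intro that[of "(1 / (h \<bullet> g z)) *\<^sub>R h"]) (auto simp: subspace_scale[OF L(1)])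
qed

text \<open>Projection of the curve from its point \<open>g t\<close>.  A functional that vanishes at \<open>t\<close> loses this zero on
  division by \<open>x - t\<close>, unless the zero is multiple; hence \<open>t\<close> is taken out of the domain.\<close>

lemma chebyshev_drop_point:
  assumes T: "chebyshev L g X d" and X: "infinite X" and t: "t \<in> X" and d: "d \<ge> 1"
  shows "chebyshev {l \<in> L. l \<bullet> g t = 0} (divdiff t g) (X - {t}) (d - 1)"
proof -
  let ?L = "{l \<in> L. l \<bullet> g t = 0}"
  have L: "subspace L" "dim L = d" using T by (auto simp: chebyshev_def)
  obtain h where "h \<in> L" "h \<bullet> g t = 1" using chebyshev_interpolate[OF T X, of "{}" t] t d by auto
  then have dim: "dim ?L = d - 1" using dim_hyperplane_section(2)[OF L(1), of h "g t"] L(2) by simp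
  have s: "subspace ?L" using L(1) by (auto simp: subspace_def inner_add_left)
  have "finite {x \<in> X - {t}. l \<bullet> divdiff t g x = 0} \<and> card {x \<in> X - {t}. l \<bullet> divdiff t g x = 0} < d - 1"
    if l: "l \<in> ?L" "l \<noteq> 0" for l
  proof -
    let ?Z = "{x \<in> X - {t}. l \<bullet> divdiff t g x = 0}"
    have z: "l \<bullet> g x = 0" if "x \<in> insert t ?Z" for x
      using that l divdiff_eq[of g x t] by (auto simp: inner_add_right)
    have "finite (insert t ?Z)" "card (insert t ?Z) < d"
      using chebyshev_zeros[OF T, of l "insert t ?Z"] l t z by auto
    then show ?thesis by (auto simp: card_insert_if)
  qed
  then show ?thesis using s dim by (simp add: chebyshev_def)
qed

lemma small_perturbation:
  fixes f k :: "real \<Rightarrow> real"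
  assumes "finite P" "\<And>x. x \<in> P \<Longrightarrow> f x \<noteq> 0"
  obtains e where "e > 0" "\<And>x. x \<in> P \<Longrightarrow> \<bar>e * k x\<bar> < \<bar>f x\<bar>"
  using assms
proof (induction P arbitrary: thesis rule: finite_induct)
  case empty
  then show ?case using empty.prems(1)[of 1] by simp
next
  case (insert x P)
  obtain e where e: "e > 0" "\<And>x. x \<in> P \<Longrightarrow> \<bar>e * k x\<bar> < \<bar>f x\<bar>" using insert by auto
  define c where "c = min e (\<bar>f x\<bar> / (2 * (\<bar>k x\<bar> + 1)))"
  have fx: "\<bar>f x\<bar> > 0" using insert.prems(2)[of x] by simp
  have c: "c > 0" using e fx by (auto simp: c_def)
  have "\<bar>c * k x\<bar> = c * \<bar>k x\<bar>" using c by (simp add: abs_mult)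
  also have "\<dots> \<le> \<bar>f x\<bar> / (2 * (\<bar>k x\<bar> + 1)) * \<bar>k x\<bar>"
    by (rule mult_right_mono) (auto simp: c_def)
  also have "\<dots> < \<bar>f x\<bar>" using fx by (simp add: field_simps add_strict_increasing)
  finally have 1: "\<bar>c * k x\<bar> < \<bar>f x\<bar>" .
  have 2: "\<bar>c * k y\<bar> < \<bar>f y\<bar>" if "y \<in> P" for y
  proof -
    have "c \<le> e" by (simp add: c_def)
    then have "c * \<bar>k y\<bar> \<le> e * \<bar>k y\<bar>" by (rule mult_right_mono) simp
    then have "\<bar>c * k y\<bar> \<le> \<bar>e * k y\<bar>" using c e(1) by (simp add: abs_mult)
    then show ?thesis using e(2)[OF that] by simp
  qed
  show ?case using insert.prems(1)[OF c] 1 2 by auto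
qed

lemma sign_stable: "\<bar>b\<bar> < \<bar>a\<bar> \<Longrightarrow> a * (a + b) > (0::real)"
  by (cases "a > 0") (auto simp: zero_less_mult_iff abs_if split: if_splits)

lemma sign_stable2:
  assumes "a * a' < (0::real)" "\<bar>b\<bar> < \<bar>a\<bar>" "\<bar>b'\<bar> < \<bar>a'\<bar>"
  shows "(a + b) * (a' + b') < 0"
  using assms by (auto simp: mult_less_0_iff abs_if split: if_splits)

lemma sign_change_zero:
  fixes F :: "real \<Rightarrow> real"
  assumes c: "continuous_on UNIV F" and ab: "a < b" and F: "F a * F b < 0"
  obtains x where "a < x" "x < b" "F x = 0"
proof -
  have c': "continuous_on {a..b} F" by (rule continuous_on_subset[OF c]) auto
  have "\<exists>x\<ge>a. x \<le> b \<and> F x = 0"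
  proof (cases "F a < 0")
    case True
    then have "F b > 0" using F by (simp add: mult_less_0_iff)
    then show ?thesis using IVT'[of F a 0 b] True ab c' by auto
  next
    case False
    then have "F a > 0" "F b < 0" using F by (auto simp: mult_less_0_iff)
    then show ?thesis using IVT2'[of F b 0 a] ab c' by auto
  qed
  then obtain x where x: "a \<le> x" "x \<le> b" "F x = 0" by auto
  moreover have "x \<noteq> a" "x \<noteq> b" using F x(3) by auto
  ultimately show ?thesis using that[of x] by simp
qed

lemma separation_radius:
  assumes X: "open X" and Z: "finite Z" "Z \<subseteq> X"
  obtains \<delta> :: real where "\<delta> > 0" "\<And>z. z \<in> Z \<Longrightarrow> {z - \<delta>..z + \<delta>} \<subseteq> X"
    "\<And>y z. y \<in> Z \<Longrightarrow> z \<in> Z \<Longrightarrow> y \<noteq> z \<Longrightarrow> 2 * \<delta> < \<bar>y - z\<bar>"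
proof -
  have "\<exists>\<delta>>0. \<forall>z\<in>Z. {z - \<delta>..z + \<delta>} \<subseteq> X" using Z
  proof (induction Z rule: finite_induct)
    case (insert z Z)
    then obtain \<delta> where d: "\<delta> > 0" "\<forall>z\<in>Z. {z - \<delta>..z + \<delta>} \<subseteq> X" by auto
    obtain e where e: "e > 0" "cball z e \<subseteq> X" using insert.prems X by (meson insert_subset open_contains_cball)
    have "{z - min \<delta> e..z + min \<delta> e} \<subseteq> cball z e" by (auto simp: dist_real_def)
    moreover have "{y - min \<delta> e..y + min \<delta> e} \<subseteq> {y - \<delta>..y + \<delta>}" for y by auto
    ultimately have "{y - min \<delta> e..y + min \<delta> e} \<subseteq> X" if "y \<in> insert z Z" for y
      using that d(2) e(2) by blast
    then show ?case using d(1) e(1) by (intro exI[of _ "min \<delta> e"]) simp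
  qed (auto intro: exI[of _ 1])
  then obtain d1 where d1: "d1 > 0" "\<forall>z\<in>Z. {z - d1..z + d1} \<subseteq> X" by auto
  define D where "D = insert 1 ((\<lambda>(y, z). \<bar>y - z\<bar>) ` {p \<in> Z \<times> Z. fst p \<noteq> snd p})"
  have D: "finite D" "D \<noteq> {}" "\<forall>x\<in>D. x > 0" using Z(1) by (auto simp: D_def)
  then have m: "Min D > 0" by (simp add: Min_gr_iff)
  show ?thesis
  proof (rule that[of "min d1 (Min D / 3)"])
    show "min d1 (Min D / 3) > 0" using d1 m by simp
    show "{z - min d1 (Min D / 3)..z + min d1 (Min D / 3)} \<subseteq> X" if "z \<in> Z" for z
    proof -
      have "{z - min d1 (Min D / 3)..z + min d1 (Min D / 3)} \<subseteq> {z - d1..z + d1}" by auto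
      then show ?thesis using d1(2) that by blast
    qed
    show "2 * min d1 (Min D / 3) < \<bar>y - z\<bar>" if "y \<in> Z" "z \<in> Z" "y \<noteq> z" for y z
    proof -
      have "\<bar>y - z\<bar> \<in> D" using that by (force simp: D_def)
      then have "Min D \<le> \<bar>y - z\<bar>" using D by simp
      then show ?thesis using m by (auto simp: min_def)
    qed
  qed
qed

text \<open>The point \<open>t\<close> may stay in the domain of the projected curve if some functional of the system has a
  simple zero there.  Otherwise \<open>f = l \<bullet> g\<close> has a double zero at \<open>t\<close> and \<open>d - 2\<close> further zeros \<open>S\<close>.
  All zeros in \<open>S\<close> are changes of sign, because a zero without a change of sign can be split into two
  by a functional that vanishes at the other zeros.  Adding a small multiple of the functional \<open>h\<close>
  with a simple zero at \<open>t\<close> then produces a second zero next to \<open>t\<close>, while the zeros in \<open>S\<close> persist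
  nearby.  In both cases there are \<open>d\<close> zeros, which is one too many.\<close>

lemma chebyshev_keep_point:
  fixes g :: "real \<Rightarrow> 'a::euclidean_space"
  assumes T: "chebyshev L g X d" and X: "open X" "infinite X" and t: "t \<in> X" and d: "d \<ge> 2"
    and g: "continuous_on UNIV g" and ddg: "continuous_on UNIV (divdiff t g)"
    and h: "h \<in> L" "h \<bullet> g t = 0" "h \<bullet> divdiff t g t \<noteq> 0"
  shows "chebyshev {l \<in> L. l \<bullet> g t = 0} (divdiff t g) X (d - 1)"
proof -
  let ?L = "{l \<in> L. l \<bullet> g t = 0}"
  have L: "subspace L" "dim L = d" using T by (auto simp: chebyshev_def)
  have drop: "chebyshev ?L (divdiff t g) (X - {t}) (d - 1)" by (rule chebyshev_drop_point[OF T X(2) t]) (use d in simp)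
  then have s: "subspace ?L" and dim: "dim ?L = d - 1" by (auto simp: chebyshev_def)
  have "finite {x \<in> X. l \<bullet> divdiff t g x = 0} \<and> card {x \<in> X. l \<bullet> divdiff t g x = 0} < d - 1"
    if l: "l \<in> L" "l \<bullet> g t = 0" "l \<noteq> 0" for l
  proof -
    define S where "S = {x \<in> X - {t}. l \<bullet> divdiff t g x = 0}"
    have S: "finite S" "card S < d - 1"
      using drop l unfolding chebyshev_def S_def by auto
    define f where "f x = l \<bullet> g x" for x
    define k where "k x = h \<bullet> g x" for x
    have f_divdiff: "f x = (x - t) * (l \<bullet> divdiff t g x)" for x
      using divdiff_eq[of g x t] l(2) by (simp add: f_def inner_add_right)
    have k_divdiff: "k x = (x - t) * (h \<bullet> divdiff t g x)" for x
      using divdiff_eq[of g x t] h(2) by (simp add: k_def inner_add_right)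
    have fZ: "f x = 0 \<longleftrightarrow> x \<in> insert t S" if "x \<in> X" for x
      using that by (auto simp: f_divdiff S_def)
    have cont: "continuous_on UNIV (\<lambda>x. a \<bullet> g x)" "continuous_on UNIV (\<lambda>x. a \<bullet> divdiff t g x)" for a
      by (intro continuous_intros g ddg)+
    show ?thesis
    proof (cases "l \<bullet> divdiff t g t = 0")
      case False
      then have "{x \<in> X. l \<bullet> divdiff t g x = 0} = S" by (auto simp: S_def)
      then show ?thesis using S by simp
    next
      case True
      have eq: "{x \<in> X. l \<bullet> divdiff t g x = 0} = insert t S" using True t by (auto simp: S_def)
      have card_Z: "card (insert t S) = Suc (card S)" using S by (simp add: S_def)
      have "Suc (card S) < d - 1"
      proof (rule ccontr)
        assume "\<not> ?thesis"
        then have cS: "card S + 2 = d" using S(2) d by simp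
        let ?Z = "insert t S"
        have Zf: "finite ?Z" "?Z \<subseteq> X" using S(1) t by (auto simp: S_def)
        obtain \<delta> where \<delta>: "\<delta> > 0" "\<And>z. z \<in> ?Z \<Longrightarrow> {z - \<delta>..z + \<delta>} \<subseteq> X"
          "\<And>y z. y \<in> ?Z \<Longrightarrow> z \<in> ?Z \<Longrightarrow> y \<noteq> z \<Longrightarrow> 2 * \<delta> < \<bar>y - z\<bar>"
          using separation_radius[OF X(1) Zf] by blast
        have near: "f x \<noteq> 0" if "z \<in> ?Z" "x \<noteq> z" "\<bar>x - z\<bar> \<le> \<delta>" for x z
        proof
          assume "f x = 0"
          moreover have "x \<in> X" using \<delta>(2)[OF that(1)] that(3) by (auto simp: abs_le_iff)
          ultimately have "x \<in> ?Z" using fZ by blast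
          then show False using \<delta>(1) \<delta>(3)[of x z] that by auto
        qed
        have tS: "t \<notin> S" by (simp add: S_def)
        have nodal: "f (z - \<delta>) * f (z + \<delta>) < 0" if z: "z \<in> S" for z
        proof (rule ccontr)
          assume neg: "\<not> ?thesis"
          have nz: "f (z - \<delta>) \<noteq> 0" "f (z + \<delta>) \<noteq> 0" using near[of z "z - \<delta>"] near[of z "z + \<delta>"] z \<delta>(1) by auto
          have "f (z - \<delta>) * f (z + \<delta>) > 0" using neg nz by (simp add: not_less order_le_less)
          obtain h1 where h1: "h1 \<in> L" "\<And>x. x \<in> ?Z - {z} \<Longrightarrow> h1 \<bullet> g x = 0" "h1 \<bullet> g z = 1"
          proof (rule chebyshev_interpolate[OF T X(2), of "?Z - {z}" z])
            show "card (?Z - {z}) < d" using z S(1) cS card_Z by simp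
          qed (use z Zf in auto)
          \<comment> \<open>The sign is chosen such that the perturbation at \<open>z\<close> is opposite to the values of \<open>f\<close> on both sides.\<close>
          define k1 where "k1 x = - f (z + \<delta>) * (h1 \<bullet> g x)" for x
          obtain e where e: "e > 0" "\<And>x. x \<in> {z - \<delta>, z + \<delta>} \<Longrightarrow> \<bar>e * k1 x\<bar> < \<bar>f x\<bar>"
            using small_perturbation[of "{z - \<delta>, z + \<delta>}" f k1] nz by auto
          define l1 where "l1 = l + (e * - f (z + \<delta>)) *\<^sub>R h1"
          have l1: "l1 \<in> L" unfolding l1_def using l h1 L(1) by (simp add: subspace_add subspace_diff subspace_scale)
          have F: "l1 \<bullet> g x = f x + e * k1 x" for x
            by (simp add: l1_def f_def k1_def inner_add_left inner_diff_left algebra_simps)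
          have Fz: "l1 \<bullet> g z = - e * f (z + \<delta>)" using fZ[of z] z Zf h1 by (auto simp: F k1_def)
          have "f (z + \<delta>) * (l1 \<bullet> g (z + \<delta>)) > 0" "f (z - \<delta>) * (l1 \<bullet> g (z - \<delta>)) > 0"
            using sign_stable e(2) by (auto simp: F)
          then have sg: "(l1 \<bullet> g z) * (l1 \<bullet> g (z + \<delta>)) < 0" "(l1 \<bullet> g (z - \<delta>)) * (l1 \<bullet> g z) < 0"
            using \<open>e > 0\<close> \<open>f (z - \<delta>) * f (z + \<delta>) > 0\<close> unfolding Fz
            by (auto simp: zero_less_mult_iff mult_less_0_iff)
          obtain x1 where x1: "z < x1" "x1 < z + \<delta>" "l1 \<bullet> g x1 = 0"
            using sign_change_zero[OF cont(1)[of l1] _ sg(1)] \<delta>(1) by auto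
          obtain x2 where x2: "z - \<delta> < x2" "x2 < z" "l1 \<bullet> g x2 = 0"
            using sign_change_zero[OF cont(1)[of l1] _ sg(2)] \<delta>(1) by auto
          let ?W = "insert x1 (insert x2 (?Z - {z}))"
          have "l1 \<noteq> 0" using Fz nz e(1) by auto
          moreover have "l1 \<bullet> g x = 0" if "x \<in> ?W" for x
            using that x1 x2 h1(2) fZ Zf by (auto simp: F k1_def)
          moreover have xX: "x1 \<in> X" "x2 \<in> X" using x1 x2 \<delta>(2)[of z] z by auto
          ultimately have "card ?W < d" using chebyshev_zeros(2)[OF T l1, of ?W] Zf by auto
          moreover have "x1 \<notin> ?Z" "x2 \<notin> ?Z"
            using near[of z x1] near[of z x2] x1 x2 z fZ xX by auto
          then have "card ?W = Suc (Suc (card (?Z - {z})))" using x1 x2 S(1) by simp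
          moreover have "card (?Z - {z}) = card S" using z card_Z S(1) by simp
          ultimately show False using cS by simp
        qed
        define a where "a = f (t + \<delta>)"
        have a: "a \<noteq> 0" using near[of t "t + \<delta>"] \<delta>(1) by (simp add: a_def)
        \<comment> \<open>The sign is chosen such that, after division by \<open>x - t\<close>, the perturbation at \<open>t\<close> is opposite to \<open>f\<close> on the right.\<close>
        define k1 where "k1 x = - a * (h \<bullet> divdiff t g t) * k x" for x
        obtain e where e: "e > 0" "\<And>x. x \<in> insert (t + \<delta>) ((\<lambda>z. z - \<delta>) ` S \<union> (\<lambda>z. z + \<delta>) ` S) \<Longrightarrow> \<bar>e * k1 x\<bar> < \<bar>f x\<bar>"
        proof (rule small_perturbation[of "insert (t + \<delta>) ((\<lambda>z. z - \<delta>) ` S \<union> (\<lambda>z. z + \<delta>) ` S)" f k1])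
          show "f x \<noteq> 0" if "x \<in> insert (t + \<delta>) ((\<lambda>z. z - \<delta>) ` S \<union> (\<lambda>z. z + \<delta>) ` S)" for x
          proof -
            from that consider "x = t + \<delta>" | z where "z \<in> S" "x = z - \<delta>" | z where "z \<in> S" "x = z + \<delta>" by auto
            then show ?thesis
            proof cases
              case 1 then show ?thesis using near[of t x] \<delta>(1) by simp
            next
              case (2 z) then show ?thesis using near[of z x] \<delta>(1) by simp
            next
              case (3 z) then show ?thesis using near[of z x] \<delta>(1) by simp
            qed
          qed
        qed (use S(1) in auto)
        define c where "c = - (e * a * (h \<bullet> divdiff t g t))"
        define l1 where "l1 = l + c *\<^sub>R h"
        have l1: "l1 \<in> L" unfolding l1_def using l h L(1) by (simp add: subspace_add subspace_diff subspace_scale)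
        have F: "l1 \<bullet> g x = f x + e * k1 x" for x
          by (simp add: l1_def f_def k1_def k_def c_def inner_add_left inner_diff_left algebra_simps)
        have l1t: "l1 \<bullet> g t = 0" using l(2) h(2) by (simp add: l1_def inner_add_left)
        have F_dd: "l1 \<bullet> g x = (x - t) * (l1 \<bullet> divdiff t g x)" for x
          using divdiff_eq[of g x t] l1t by (simp add: inner_add_right)
        have G_t: "l1 \<bullet> divdiff t g t = - (e * a * (h \<bullet> divdiff t g t)\<^sup>2)"
          using True by (simp add: l1_def c_def inner_add_left inner_diff_left power2_eq_square algebra_simps)
        have "a * (l1 \<bullet> g (t + \<delta>)) > 0" using sign_stable e(2)[of "t + \<delta>"] by (simp add: F a_def)
        then have "\<delta> * (a * (l1 \<bullet> divdiff t g (t + \<delta>))) > 0"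
          using F_dd[of "t + \<delta>"] by (simp add: ac_simps)
        then have "a * (l1 \<bullet> divdiff t g (t + \<delta>)) > 0" using \<delta>(1) by (rule zero_less_mult_pos)
        then have sg: "(l1 \<bullet> divdiff t g t) * (l1 \<bullet> divdiff t g (t + \<delta>)) < 0"
          using e(1) h(3) unfolding G_t by (auto simp: zero_less_mult_iff mult_less_0_iff)
        obtain \<tau> where \<tau>: "t < \<tau>" "\<tau> < t + \<delta>" "l1 \<bullet> divdiff t g \<tau> = 0"
          using sign_change_zero[OF cont(2)[of l1] _ sg] \<delta>(1) by auto
        have "\<exists>x. z - \<delta> < x \<and> x < z + \<delta> \<and> l1 \<bullet> g x = 0" if z: "z \<in> S" for z
        proof -
          have "(l1 \<bullet> g (z - \<delta>)) * (l1 \<bullet> g (z + \<delta>)) < 0"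
            unfolding F by (rule sign_stable2[OF nodal[OF z]]) (use e(2) z in auto)
          moreover have "z - \<delta> < z + \<delta>" using \<delta>(1) by simp
          ultimately show ?thesis using sign_change_zero[OF cont(1)[of l1], of "z - \<delta>" "z + \<delta>"] by blast
        qed
        then obtain \<zeta> where \<zeta>: "\<And>z. z \<in> S \<Longrightarrow> z - \<delta> < \<zeta> z \<and> \<zeta> z < z + \<delta> \<and> l1 \<bullet> g (\<zeta> z) = 0"
          by metis
        have inj: "inj_on \<zeta> S"
        proof (rule inj_onI, rule ccontr)
          fix y z assume yz: "y \<in> S" "z \<in> S" "\<zeta> y = \<zeta> z" "y \<noteq> z"
          then have "2 * \<delta> < \<bar>y - z\<bar>" using \<delta>(3) by auto
          then show False using \<zeta>[of y] \<zeta>[of z] yz by (auto simp: abs_if split: if_splits)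
        qed
        have far: "\<zeta> z \<noteq> x" if "z \<in> S" "t \<le> x" "x < t + \<delta>" for z x
        proof -
          have "z \<noteq> t" using that(1) tS by blast
          then have "2 * \<delta> < \<bar>z - t\<bar>" using \<delta>(3)[of z t] that(1) by simp
          then show ?thesis using \<zeta>[OF that(1)] that by (auto simp: abs_if split: if_splits)
        qed
        let ?W = "insert t (insert \<tau> (\<zeta> ` S))"
        have "l1 \<noteq> 0" using G_t e(1) a h(3) by auto
        moreover have "l1 \<bullet> g x = 0" if "x \<in> ?W" for x
          using that \<zeta> \<tau> l1t F_dd[of \<tau>] by auto
        moreover have "?W \<subseteq> X"
        proof -
          have "\<zeta> z \<in> X" if "z \<in> S" for z using \<zeta>[OF that] \<delta>(2)[of z] that by auto
          moreover have "\<tau> \<in> X" using \<tau> \<delta>(1) \<delta>(2)[of t] by auto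
          ultimately show ?thesis using t by auto
        qed
        ultimately have "card ?W < d" using chebyshev_zeros(2)[OF T l1, of ?W] by blast
        moreover have "card ?W = Suc (Suc (card (\<zeta> ` S)))"
        proof -
          have "\<tau> \<notin> \<zeta> ` S" using far[of _ \<tau>] \<tau> by auto
          moreover have "t \<notin> \<zeta> ` S" using far[of _ t] \<delta>(1) by auto
          moreover have "t \<noteq> \<tau>" using \<tau> by simp
          ultimately have "t \<notin> insert \<tau> (\<zeta> ` S)" "\<tau> \<notin> \<zeta> ` S" by auto
          then show ?thesis using S(1) by simp
        qed
        ultimately show False using cS card_image[OF inj] by simp
      qed
      then show ?thesis unfolding eq using card_Z S(1) by simp
    qed
  qed
  then show ?thesis using s dim unfolding chebyshev_def by simp
qed

section \<open>Newton interpolation and confluent blocks\<close>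

text \<open>Iterated divided differences; the first point of the list is divided out first.\<close>

fun newton_divdiff :: "(real \<Rightarrow> 'a::real_normed_vector) \<Rightarrow> real list \<Rightarrow> real \<Rightarrow> 'a" where
  "newton_divdiff g [] = g" | "newton_divdiff g (p # ps) = newton_divdiff (divdiff p g) ps"

text \<open>The coefficients of Newton interpolation at the points \<open>ps\<close>.\<close>

definition newton_coeffs :: "(real \<Rightarrow> 'a::real_normed_vector) \<Rightarrow> real list \<Rightarrow> 'a list" where
  "newton_coeffs g ps = map (\<lambda>i. newton_divdiff g (take i ps) (ps ! i)) [0..<length ps]"

text \<open>The values of \<open>g\<close> at the points \<open>ps\<close> in the confluent sense: a repeated occurrence of a point
  contributes the derivative whose order is the number of earlier occurrences.\<close>

definition confluent_list :: "(real \<Rightarrow> 'a::real_normed_vector) \<Rightarrow> real list \<Rightarrow> 'a list" where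
  "confluent_list g ps = map (\<lambda>i. nth_vector_derivative (count_list (take i ps) (ps ! i)) g (ps ! i)) [0..<length ps]"

lemma newton_divdiff_snoc: "newton_divdiff g (ps @ [x]) = divdiff x (newton_divdiff g ps)"
  by (induction ps arbitrary: g) auto

lemma newton_coeffs_Nil [simp]: "newton_coeffs g [] = []" by (simp add: newton_coeffs_def)

lemma newton_coeffs_Cons: "newton_coeffs g (p # ps) = g p # newton_coeffs (divdiff p g) ps"
  unfolding newton_coeffs_def by (simp add: upt_conv_Cons map_Suc_upt[symmetric] del: upt_Suc)

lemma newton_coeffs_snoc: "newton_coeffs g (ps @ [x]) = newton_coeffs g ps @ [newton_divdiff g ps x]"
  unfolding newton_coeffs_def by (auto simp: nth_append intro!: map_cong)

lemma confluent_list_snoc: "confluent_list g (ps @ [x]) = confluent_list g ps @ [nth_vector_derivative (count_list ps x) g x]"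
  unfolding confluent_list_def by (auto simp: nth_append intro!: map_cong)

lemma length_newton_coeffs [simp]: "length (newton_coeffs g ps) = length ps" by (simp add: newton_coeffs_def)

lemma smooth_fun_newton_divdiff:
  fixes g :: "real \<Rightarrow> 'a::euclidean_space"
  shows "smooth_fun g \<Longrightarrow> smooth_fun (newton_divdiff g ps)"
  by (induction ps arbitrary: g) (auto intro: smooth_fun_divdiff)

lemma newton_interpolation: "g x - (\<Prod>p\<leftarrow>ps. x - p) *\<^sub>R newton_divdiff g ps x \<in> span (set (newton_coeffs g ps))"
proof (induction ps arbitrary: g)
  case (Cons p ps)
  let ?r = "divdiff p g x - (\<Prod>p\<leftarrow>ps. x - p) *\<^sub>R newton_divdiff (divdiff p g) ps x"
  have "set (newton_coeffs (divdiff p g) ps) \<subseteq> set (newton_coeffs g (p # ps))" by (auto simp: newton_coeffs_Cons)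
  then have "?r \<in> span (set (newton_coeffs g (p # ps)))" using Cons.IH[of "divdiff p g"] span_mono by blast
  moreover have "g p \<in> span (set (newton_coeffs g (p # ps)))" by (auto simp: newton_coeffs_Cons intro: span_base)
  ultimately have "g p + (x - p) *\<^sub>R ?r \<in> span (set (newton_coeffs g (p # ps)))"
    by (intro span_add span_scale)
  moreover have "g p + (x - p) *\<^sub>R ?r = g x - (\<Prod>p\<leftarrow>p # ps. x - p) *\<^sub>R newton_divdiff g (p # ps) x"
    using divdiff_eq[of g x p] by (simp add: scaleR_diff_right)
  ultimately show ?case by simp
qed simp

lemma smooth_fun_inner: "smooth_fun g \<Longrightarrow> smooth_fun (\<lambda>y. l \<bullet> g y)"
  by (rule smooth_fun_linear[OF bounded_linear_inner_right])

lemma nth_vder_inner: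
  fixes g :: "real \<Rightarrow> 'a::real_inner"
  assumes "smooth_fun g"
  shows "nth_vector_derivative j (\<lambda>y. l \<bullet> g y) = (\<lambda>y. l \<bullet> nth_vector_derivative j g y)"
proof (induction j)
  case (Suc j)
  have "((\<lambda>y. l \<bullet> nth_vector_derivative j g y) has_vector_derivative l \<bullet> nth_vector_derivative (Suc j) g y) (at y)" for y
    unfolding nth_vder_Suc
    by (rule bounded_linear.has_vector_derivative[OF bounded_linear_inner_right smooth_fun_vder(1)])
      (rule smooth_fun_nth[OF assms])
  then show ?case unfolding nth_vder_Suc[of j "\<lambda>y. l \<bullet> g y"] Suc by (intro ext vector_derivative_at)
qed simp

text \<open>The order of the derivative is the order of the zero, so that only the leading Taylor coefficient is
  left.\<close>

lemma nth_vder_power: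
  fixes R :: "real \<Rightarrow> real"
  assumes "smooth_fun R"
  shows "nth_vector_derivative c (\<lambda>y. (y - x) ^ c * R y) x = fact c * R x"
  using assms
proof (induction c arbitrary: R)
  case (Suc c)
  define R1 where "R1 y = real (Suc c) * R y + (y - x) * vder R y" for y
  have "smooth_fun (\<lambda>y. y + (- x))" by (intro smooth_fun_add smooth_fun_ident smooth_fun_const)
  then have "smooth_fun R1"
    unfolding R1_def using Suc.prems by (intro smooth_fun_add smooth_fun_mult smooth_fun_const smooth_fun_vder(2)) auto
  have "((\<lambda>y. (y - x) ^ Suc c * R y) has_vector_derivative (y - x) ^ c * R1 y) (at y)" for y
  proof -
    have "(R has_real_derivative vder R y) (at y)"
      using smooth_fun_vder(1)[OF Suc.prems] by (simp add: has_real_derivative_iff_has_vector_derivative)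
    moreover have "((\<lambda>y. y - x) has_real_derivative 1) (at y)" by (auto intro!: derivative_eq_intros)
    from DERIV_power[OF this, of "Suc c"]
    have "((\<lambda>y. (y - x) ^ Suc c) has_real_derivative real (Suc c) * (y - x) ^ c) (at y)"
      by (simp del: power_Suc)
    ultimately have "((\<lambda>y. (y - x) ^ Suc c * R y) has_real_derivative
        real (Suc c) * (y - x) ^ c * R y + vder R y * (y - x) ^ Suc c) (at y)"
      by (rule DERIV_mult[rotated])
    moreover have "real (Suc c) * (y - x) ^ c * R y + vder R y * (y - x) ^ Suc c = (y - x) ^ c * R1 y"
      by (simp add: R1_def algebra_simps)
    ultimately have "((\<lambda>y. (y - x) ^ Suc c * R y) has_real_derivative (y - x) ^ c * R1 y) (at y)" by simp
    then show ?thesis by (simp add: has_real_derivative_iff_has_vector_derivative)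
  qed
  then have "vder (\<lambda>y. (y - x) ^ Suc c * R y) = (\<lambda>y. (y - x) ^ c * R1 y)"
    by (intro ext vector_derivative_at)
  then show ?case
    unfolding nth_vder_Suc' using Suc.IH[OF \<open>smooth_fun R1\<close>] by (simp add: R1_def algebra_simps)
qed simp

text \<open>The ratio between the derivative and the Newton coefficient at \<open>x\<close> when the points \<open>ps\<close> precede it.\<close>

definition newton_factor :: "real list \<Rightarrow> real \<Rightarrow> real" where
  "newton_factor ps x = fact (count_list ps x) * (\<Prod>p\<leftarrow>filter (\<lambda>p. p \<noteq> x) ps. x - p)"

lemma newton_factor_nonzero: "newton_factor ps x \<noteq> 0"
  by (auto simp: newton_factor_def prod_list_zero_iff)

lemma newton_factor_pos: "(\<And>p. p \<in> set ps \<Longrightarrow> p \<le> x) \<Longrightarrow> newton_factor ps x > 0"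
proof -
  assume a: "\<And>p. p \<in> set ps \<Longrightarrow> p \<le> x"
  have "(\<Prod>p\<leftarrow>filter (\<lambda>p. p \<noteq> x) ps. x - p) > 0" using a
    by (induction ps) (auto intro!: mult_pos_pos simp: less_le)
  then show ?thesis by (simp add: newton_factor_def)
qed

text \<open>Modulo the earlier Newton coefficients, \<open>g y\<close> is the divided difference times the product of the
  factors \<open>y - p\<close>.  Differentiation at \<open>x\<close>, as often as \<open>x\<close> occurs in \<open>ps\<close>, removes the factors
  \<open>y - x\<close> and evaluates the others.\<close>

lemma confluent_newton:
  fixes g :: "real \<Rightarrow> 'a::euclidean_space"
  assumes g: "smooth_fun g"
  shows "nth_vector_derivative (count_list ps x) g x - newton_factor ps x *\<^sub>R newton_divdiff g ps x \<in> span (set (newton_coeffs g ps))"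
proof (rule ccontr)
  let ?c = "count_list ps x" and ?G = "newton_divdiff g ps"
  assume "\<not> ?thesis"
  then obtain l where l: "\<And>s. s \<in> set (newton_coeffs g ps) \<Longrightarrow> l \<bullet> s = 0"
    "l \<bullet> (nth_vector_derivative ?c g x - newton_factor ps x *\<^sub>R ?G x) \<noteq> 0"
    by (rule separate_from_span) blast
  have annihilator: "l \<bullet> s = 0" if "s \<in> span (set (newton_coeffs g ps))" for s
    using orthogonal_to_span[OF that, of l] l(1) by (auto simp: orthogonal_def)
  have factor: "(\<Prod>p\<leftarrow>qs. y - p) = (y - x) ^ count_list qs x * (\<Prod>p\<leftarrow>filter (\<lambda>p. p \<noteq> x) qs. y - p)" for qs y
    by (induction qs) (auto simp: algebra_simps)
  define R where "R y = (\<Prod>p\<leftarrow>filter (\<lambda>p. p \<noteq> x) ps. y - p) * (l \<bullet> ?G y)" for y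
  have "smooth_fun (\<lambda>y. y + (- p))" for p by (intro smooth_fun_add smooth_fun_ident smooth_fun_const)
  then have "smooth_fun (\<lambda>y. \<Prod>p\<leftarrow>qs. y - p)" for qs :: "real list"
    by (induction qs) (auto intro!: smooth_fun_mult simp: smooth_fun_const)
  then have "smooth_fun R" unfolding R_def
    by (intro smooth_fun_mult smooth_fun_inner smooth_fun_newton_divdiff g)
  have "l \<bullet> g y = (y - x) ^ ?c * R y" for y
  proof -
    have "l \<bullet> g y = (\<Prod>p\<leftarrow>ps. y - p) * (l \<bullet> ?G y)"
      using annihilator[OF newton_interpolation[of g y ps]] unfolding inner_diff_right inner_scaleR_right by linarith
    then show ?thesis unfolding factor[of y ps] R_def by (simp only: mult.assoc)
  qed
  then have "nth_vector_derivative ?c (\<lambda>y. l \<bullet> g y) x = fact ?c * R x"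
    using nth_vder_power[OF \<open>smooth_fun R\<close>, of ?c x] by simp
  then have "l \<bullet> nth_vector_derivative ?c g x = newton_factor ps x * (l \<bullet> ?G x)"
    unfolding nth_vder_inner[OF g] by (simp add: R_def newton_factor_def)
  then show False using l(2) by (simp add: inner_diff_right)
qed

text \<open>The confluent values of \<open>g\<close> at the points of a multiset, without an order.\<close>

definition jets :: "(real \<Rightarrow> 'a::real_normed_vector) \<Rightarrow> real multiset \<Rightarrow> 'a set" where
  "jets g M = {nth_vector_derivative j g x | j x. j < count M x}"

lemma jets_add: "jets g (add_mset x M) = insert (nth_vector_derivative (count M x) g x) (jets g M)"
  by (auto simp: jets_def less_Suc_eq split: if_splits)

lemma span_newton_coeffs:
  fixes g :: "real \<Rightarrow> 'a::euclidean_space"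
  assumes g: "smooth_fun g"
  shows "span (set (newton_coeffs g ps)) = span (jets g (mset ps))"
proof (induction ps rule: rev_induct)
  case (snoc x ps)
  let ?v = "nth_vector_derivative (count_list ps x) g x"
  have "span (set (newton_coeffs g (ps @ [x]))) = span (insert (newton_divdiff g ps x) (set (newton_coeffs g ps)))"
    by (simp add: newton_coeffs_snoc)
  also have "\<dots> = span (insert ?v (set (newton_coeffs g ps)))"
    by (rule span_insert_cong[symmetric, OF confluent_newton[OF g] newton_factor_nonzero])
  also have "\<dots> = span (insert ?v (jets g (mset ps)))"
    using snoc by (simp add: span_insert)
  also have "insert ?v (jets g (mset ps)) = jets g (mset (ps @ [x]))"
    by (simp add: jets_add count_mset)
  finally show ?case .
qed (simp add: jets_def)

lemma dim_jets_le: "dim (jets g M) \<le> size M" for g :: "real \<Rightarrow> 'a::euclidean_space"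
proof (induction M)
  case (add x M)
  then show ?case by (auto simp: jets_add dim_insert)
qed (simp add: jets_def)

lemma dim_jets_mono:
  fixes g :: "real \<Rightarrow> 'a::euclidean_space"
  assumes "dim (jets g (M + N)) = size (M + N)"
  shows "dim (jets g M) = size M"
proof -
  have "dim (jets g (M + N)) \<le> dim (jets g M) + size N"
  proof (induction N)
    case (add x N)
    then show ?case by (auto simp: jets_add dim_insert)
  qed simp
  then show ?thesis using assms dim_jets_le[of g M] by simp
qed

lemma chebyshev_newton_keep:
  fixes g :: "real \<Rightarrow> 'a::euclidean_space"
  assumes g: "smooth_fun g"
    and T: "chebyshev (annihilator (set (newton_coeffs g ps))) (newton_divdiff g ps) X d" and X: "open X" "infinite X" "t \<in> X" and d: "d \<ge> 2"
    and ind: "dim (jets g (mset (ps @ [t, t]))) = length ps + 2"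
  shows "chebyshev (annihilator (set (newton_coeffs g (ps @ [t])))) (newton_divdiff g (ps @ [t])) X (d - 1)"
proof -
  let ?G = "newton_divdiff g ps"
  have "dim (set (newton_coeffs g (ps @ [t, t]))) = length ps + 2"
    using ind span_newton_coeffs[OF g, of "ps @ [t, t]"] by (metis dim_span)
  moreover have e: "newton_coeffs g (ps @ [t, t]) = newton_coeffs g (ps @ [t]) @ [divdiff t ?G t]"
    using newton_coeffs_snoc[of g "ps @ [t]" t] by (simp add: newton_divdiff_snoc)
  moreover have "dim (set (newton_coeffs g (ps @ [t]))) \<le> length ps + 1"
    using dim_le_card'[of "set (newton_coeffs g (ps @ [t]))"] card_length[of "newton_coeffs g (ps @ [t])"] by simp
  ultimately have "divdiff t ?G t \<notin> span (set (newton_coeffs g (ps @ [t])))"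
    by (auto simp: dim_insert split: if_splits)
  then obtain h where h: "\<And>s. s \<in> set (newton_coeffs g (ps @ [t])) \<Longrightarrow> h \<bullet> s = 0" "h \<bullet> divdiff t ?G t \<noteq> 0"
    by (rule separate_from_span) blast
  have "chebyshev {l \<in> annihilator (set (newton_coeffs g ps)). l \<bullet> ?G t = 0} (divdiff t ?G) X (d - 1)"
  proof (rule chebyshev_keep_point[OF T X d])
    show "continuous_on UNIV ?G" "continuous_on UNIV (divdiff t ?G)"
      by (intro smooth_fun_continuous smooth_fun_divdiff smooth_fun_newton_divdiff g)+
    show "h \<in> annihilator (set (newton_coeffs g ps))" "h \<bullet> ?G t = 0" using h(1) by (auto simp: annihilator_def newton_coeffs_snoc)
    show "h \<bullet> divdiff t ?G t \<noteq> 0" by (rule h(2))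
  qed
  moreover have "{l \<in> annihilator (set (newton_coeffs g ps)). l \<bullet> ?G t = 0} = annihilator (set (newton_coeffs g (ps @ [t])))"
    by (auto simp: annihilator_def newton_coeffs_snoc)
  ultimately show ?thesis by (simp add: newton_divdiff_snoc)
qed

lemma chebyshev_newton_drop:
  fixes g :: "real \<Rightarrow> 'a::euclidean_space"
  assumes T: "chebyshev (annihilator (set (newton_coeffs g ps))) (newton_divdiff g ps) X d" and X: "infinite X" "t \<in> X" and d: "d \<ge> 1"
  shows "chebyshev (annihilator (set (newton_coeffs g (ps @ [t])))) (newton_divdiff g (ps @ [t])) (X - {t}) (d - 1)"
proof -
  have "{l \<in> annihilator (set (newton_coeffs g ps)). l \<bullet> newton_divdiff g ps t = 0} = annihilator (set (newton_coeffs g (ps @ [t])))"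
    by (auto simp: annihilator_def newton_coeffs_snoc)
  then show ?thesis using chebyshev_drop_point[OF T X d] by (simp add: newton_divdiff_snoc)
qed

text \<open>A set of points, some of them multiple, imposes independent conditions as soon as each of the points
  does so with its multiplicity.  By induction on the size: split \<open>M\<close> into one copy \<open>qs\<close> of each point
  and the rest \<open>rs\<close>.  The points of \<open>rs\<close> are divided out while the domain stays \<open>X\<close>.  The condition for
  this concerns an initial part of \<open>rs\<close> whose last point is doubled; if \<open>M\<close> has two points it is a
  proper part of \<open>M\<close>, and the induction hypothesis applies.  The points of \<open>qs\<close> are distinct, so
  that each can be divided out at the price of removing it from the domain.\<close>

theorem chebyshev_confluent_independent:
  fixes g :: "real \<Rightarrow> 'a::euclidean_space"
  assumes g: "smooth_fun g" and T: "chebyshev UNIV g X DIM('a)" and X: "open X" "infinite X"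
    and M: "set_mset M \<subseteq> X" "size M \<le> DIM('a)"
    and single: "\<And>x. x \<in># M \<Longrightarrow> dim (jets g (replicate_mset (count M x) x)) = count M x"
  shows "dim (jets g M) = size M"
  using M single
proof (induction "size M" arbitrary: M rule: less_induct)
  case less
  consider "set_mset M = {}" | x where "set_mset M = {x}" | x y where "x \<in># M" "y \<in># M" "x \<noteq> y"
    by (metis is_singletonI' is_singleton_def)
  then show ?case
  proof cases
    case 1
    then show ?thesis by (simp add: jets_def)
  next
    case (2 x)
    then have "M = replicate_mset (count M x) x" by (metis set_mset_subset_singletonD count_replicate_mset empty_not_insert set_mset_empty subset_refl)
    then show ?thesis using less.prems(3)[of x] 2 by (metis singletonI size_replicate_mset)
  next
    case (3 x y)
    obtain qs where dist: "distinct qs" "set qs = set_mset M"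
      using finite_distinct_list[OF finite_set_mset[of M]] by blast
    have "mset qs = mset_set (set_mset M)" using mset_set_set[OF dist(1)] dist(2) by simp
    then have Q_le: "mset qs \<subseteq># M" by (simp add: mset_set_set_mset_msubset)
    obtain rs where rs: "mset rs = M - mset qs" by (metis ex_mset)
    have M_eq: "M = mset rs + mset qs" using Q_le rs by simp
    have sub_single: "dim (jets g (replicate_mset j z)) = j" if "z \<in># M" "j \<le> count M z" for z j
    proof -
      have "replicate_mset (count M z) z = replicate_mset j z + replicate_mset (count M z - j) z"
        using that(2) by (intro multiset_eqI) simp
      then show ?thesis using dim_jets_mono[of g "replicate_mset j z" "replicate_mset (count M z - j) z"]
          less.prems(3)[OF that(1)] that by simp
    qed
    have two: "2 \<le> length qs"
    proof -
      have "card {x, y} \<le> card (set qs)" using 3 dist by (intro card_mono) auto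
      then show ?thesis using 3 dist distinct_card by fastforce
    qed
    have len: "length rs + length qs = size M" using M_eq by (metis size_mset size_union)
    have keep: "chebyshev (annihilator (set (newton_coeffs g (take i rs)))) (newton_divdiff g (take i rs)) X (DIM('a) - i)" if "i \<le> length rs" for i
      using that
    proof (induction i)
      case 0
      then show ?case using T by (simp add: annihilator_def)
    next
      case (Suc i)
      let ?ps = "take i rs" and ?t = "rs ! i"
      have take: "take (Suc i) rs = ?ps @ [?t]" using Suc.prems by (simp add: take_Suc_conv_app_nth)
      have t_in: "?t \<in># mset rs" using Suc.prems by simp
      then have tM: "?t \<in># M" using M_eq by simp
      let ?N = "mset (?ps @ [?t, ?t])"
      have N1: "mset (?ps @ [?t]) \<subseteq># mset rs" by (metis take append_take_drop_id mset_append mset_subset_eq_add_left)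
      \<comment> \<open>A copy of some other point is left over, hence the induction hypothesis applies to \<open>?N\<close>.\<close>
      have N2: "{#?t#} \<subset># mset qs"
      proof -
        have "{#?t#} \<subseteq># mset qs" using dist tM by simp
        moreover have "{#?t#} \<noteq> mset qs" using two by (metis One_nat_def Suc_1 not_less_eq_eq order_refl size_mset size_single)
        ultimately show ?thesis by (simp add: subset_mset.order_iff_strict)
      qed
      have "?N = mset (?ps @ [?t]) + {#?t#}" by simp
      then have N: "?N \<subset># M" unfolding M_eq using N1 N2
        by (metis subset_mset.add_le_less_mono)
      have "dim (jets g ?N) = size ?N"
      proof (rule less.hyps)
        show "size ?N < size M" using N by (rule mset_subset_size)
        show "set_mset ?N \<subseteq> X" using N less.prems(1) by (meson set_mset_mono subset_mset.less_imp_le subset_trans)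
        show "size ?N \<le> DIM('a)" using \<open>size ?N < size M\<close> less.prems(2) by simp
        fix z assume "z \<in># ?N"
        then have "z \<in># M" using N by (meson mset_subset_eqD subset_mset.less_imp_le)
        moreover have "count ?N z \<le> count M z" using N by (meson mset_subset_eq_count subset_mset.less_imp_le)
        ultimately show "dim (jets g (replicate_mset (count ?N z) z)) = count ?N z" by (rule sub_single)
      qed
      then have "chebyshev (annihilator (set (newton_coeffs g (?ps @ [?t])))) (newton_divdiff g (?ps @ [?t])) X (DIM('a) - i - 1)"
        using Suc len two less.prems(1,2) tM by (intro chebyshev_newton_keep[OF g _ X]) auto
      then show ?case unfolding take by simp
    qed
    have drop: "chebyshev (annihilator (set (newton_coeffs g (rs @ take i qs)))) (newton_divdiff g (rs @ take i qs)) (X - set (take i qs)) (DIM('a) - length rs - i)"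
      if "i \<le> length qs" for i
      using that
    proof (induction i)
      case 0
      then show ?case using keep[of "length rs"] by simp
    next
      case (Suc i)
      let ?t = "qs ! i"
      have take: "take (Suc i) qs = take i qs @ [?t]" using Suc.prems by (simp add: take_Suc_conv_app_nth)
      have "?t \<notin> set (take i qs)" using dist(1) Suc.prems by (auto simp: in_set_conv_nth nth_eq_iff_index_eq)
      moreover have "?t \<in> X" using dist Suc.prems less.prems(1) by (metis Suc_le_lessD nth_mem subsetD)
      ultimately have "chebyshev (annihilator (set (newton_coeffs g ((rs @ take i qs) @ [?t])))) (newton_divdiff g ((rs @ take i qs) @ [?t])) (X - set (take i qs) - {?t}) (DIM('a) - length rs - i - 1)"
        using Suc X(2) len less.prems(2) by (intro chebyshev_newton_drop) auto
      moreover have "X - set (take i qs) - {?t} = X - set (take (Suc i) qs)" unfolding take by auto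
      ultimately show ?case unfolding take by simp
    qed
    have "chebyshev (annihilator (set (newton_coeffs g (rs @ qs)))) (newton_divdiff g (rs @ qs)) (X - set qs) (DIM('a) - length rs - length qs)"
      using drop[of "length qs"] by simp
    then have "dim (annihilator (set (newton_coeffs g (rs @ qs)))) = DIM('a) - size M" using len by (simp add: chebyshev_def)
    then have "dim (set (newton_coeffs g (rs @ qs))) = size M"
      using dim_annihilator[of "set (newton_coeffs g (rs @ qs))"] less.prems(2) by simp
    then show ?thesis using span_newton_coeffs[OF g, of "rs @ qs"] M_eq by (metis dim_span mset_append)
  qed
qed

section \<open>Signs of confluent determinants\<close>

lemma replicate_jets: "jets g (replicate_mset c x) = (\<lambda>j. nth_vector_derivative j g x) ` {..<c}"
  by (auto simp: jets_def)

text \<open>Let the smallest parameter tend to \<open>u\<close> from the right; then subtract \<open>g u\<close> from the other rows and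
  divide them by the differences of the parameters, which are positive.\<close>

lemma weak_positivity_step:
  fixes g :: "real \<Rightarrow> real^'n::{finite,wellorder}"
  assumes g: "smooth_fun g" and len: "length ws < CARD('n)"
    and pos: "\<And>xs. sorted_wrt (<) xs \<Longrightarrow> set xs \<subseteq> {t<..<b} \<Longrightarrow> length ws + length xs = CARD('n)
        \<Longrightarrow> s * det_list (ws @ map g xs) \<ge> 0"
    and u: "t \<le> u" "u < b"
    and xs: "sorted_wrt (<) xs" "set xs \<subseteq> {u<..<b}" "length (ws @ [g u]) + length xs = CARD('n)"
  shows "s * det_list ((ws @ [g u]) @ map (divdiff u g) xs) \<ge> 0"
proof -
  have "((\<lambda>x. s * det_list (ws @ g x # map g xs)) \<longlongrightarrow> s * det_list (ws @ g u # map g xs)) (at_right u)"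
  proof (intro tendsto_mult tendsto_const det_list_tendsto)
    fix i
    have "(g \<longlongrightarrow> g u) (at_right u)"
      using smooth_fun_isCont[OF g, of u] by (simp add: isCont_def filterlim_at_split)
    then show "((\<lambda>x. (ws @ g x # map g xs) ! i) \<longlongrightarrow> (ws @ g u # map g xs) ! i) (at_right u)"
      by (simp add: nth_append nth_Cons')
  qed
  moreover have "\<forall>\<^sub>F x in at_right u. s * det_list (ws @ g x # map g xs) \<ge> 0"
  proof -
    define c where "c = (if xs = [] then b else hd xs)"
    have c: "u < c" "c \<le> b" using u xs(2) by (auto simp: c_def intro: less_imp_le) (cases xs; auto)+
    have "s * det_list (ws @ g x # map g xs) \<ge> 0" if x: "u < x" "x < c" for x
    proof -
      have "sorted_wrt (<) (x # xs)" using xs(1) x by (cases xs) (auto simp: c_def)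
      moreover have "set (x # xs) \<subseteq> {t<..<b}" using xs(2) x c u by auto
      moreover have "length ws + length (x # xs) = CARD('n)" using xs(3) by simp
      ultimately show ?thesis using pos[of "x # xs"] by simp
    qed
    then show ?thesis using c(1) unfolding eventually_at_right_field by blast
  qed
  ultimately have ge: "s * det_list (ws @ g u # map g xs) \<ge> 0"
    by (rule tendsto_lowerbound) simp
  have map_nth': "map f xs = map (\<lambda>i. f (xs ! i)) [0..<length xs]" for f :: "real \<Rightarrow> real^'n::{finite,wellorder}"
    by (rule nth_equalityI) auto
  have "det_list ((ws @ [g u]) @ map g xs @ []) = (\<Prod>j<length xs. xs ! j - u) * det_list ((ws @ [g u]) @ map (divdiff u g) xs @ [])"
    unfolding map_nth'[of g] map_nth'[of "divdiff u g"]
  proof (rule det_list_triangular)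
    fix j
    have "g (xs ! j) - (xs ! j - u) *\<^sub>R divdiff u g (xs ! j) = g u" using divdiff_eq[of g "xs ! j" u] by simp
    then show "g (xs ! j) - (xs ! j - u) *\<^sub>R divdiff u g (xs ! j) \<in> span (set (ws @ [g u]) \<union> (\<lambda>i. divdiff u g (xs ! i)) ` {..<j})"
      by (auto intro: span_base)
  qed (use xs in auto)
  moreover have "(\<Prod>j<length xs. xs ! j - u) > 0"
    using xs(2) by (intro prod_pos) (auto dest: nth_mem)
  ultimately show ?thesis using ge by (auto simp: zero_le_mult_iff mult_le_0_iff)
qed

lemma weak_positivity:
  fixes g :: "real \<Rightarrow> real^'n::{finite,wellorder}"
  assumes g: "smooth_fun g" and len: "length ws + length ps = CARD('n)"
    and pos: "\<And>xs. sorted_wrt (<) xs \<Longrightarrow> set xs \<subseteq> {t<..<b} \<Longrightarrow> length ws + length xs = CARD('n)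
        \<Longrightarrow> s * det_list (ws @ map g xs) \<ge> 0"
    and ps: "sorted ps" "set ps \<subseteq> {t..<b}"
  shows "s * det_list (ws @ newton_coeffs g ps) \<ge> 0"
  using assms
proof (induction ps arbitrary: ws t g)
  case Nil
  then show ?case using Nil.prems(3)[of "[]"] by simp
next
  case (Cons u ps)
  have "s * det_list ((ws @ [g u]) @ newton_coeffs (divdiff u g) ps) \<ge> 0"
  proof (rule Cons.IH)
    fix xs assume "sorted_wrt (<) xs" "set xs \<subseteq> {u<..<b}" "length (ws @ [g u]) + length xs = CARD('n)"
    then show "s * det_list ((ws @ [g u]) @ map (divdiff u g) xs) \<ge> 0"
      using Cons.prems by (intro weak_positivity_step[where t = t and b = b]) auto
  qed (use Cons.prems in \<open>auto intro: smooth_fun_divdiff\<close>)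
  then show ?case by (simp add: newton_coeffs_Cons)
qed

lemma det_list_confluent_list:
  fixes g :: "real \<Rightarrow> real^'n::{finite,wellorder}"
  assumes g: "smooth_fun g" and len: "length ps = CARD('n)" and ps: "sorted ps"
  obtains k where "k > 0" "det_list (confluent_list g ps) = k * det_list (newton_coeffs g ps)"
proof -
  have "det_list ([] @ confluent_list g ps @ []) = (\<Prod>j<length ps. newton_factor (take j ps) (ps ! j)) * det_list ([] @ newton_coeffs g ps @ [])"
    unfolding confluent_list_def newton_coeffs_def
  proof (rule det_list_triangular)
    fix j assume j: "j < length ps"
    have "set (newton_coeffs g (take j ps)) = (\<lambda>i. newton_divdiff g (take i ps) (ps ! i)) ` {..<j}"
      using j by (auto simp: newton_coeffs_def lessThan_atLeast0 min_def)
    then show "nth_vector_derivative (count_list (take j ps) (ps ! j)) g (ps ! j)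
        - newton_factor (take j ps) (ps ! j) *\<^sub>R newton_divdiff g (take j ps) (ps ! j)
        \<in> span (set [] \<union> (\<lambda>i. newton_divdiff g (take i ps) (ps ! i)) ` {..<j})"
      using confluent_newton[OF g, of "take j ps" "ps ! j"] by simp
  qed (use len in simp)
  moreover have "(\<Prod>j<length ps. newton_factor (take j ps) (ps ! j)) > 0"
  proof (intro prod_pos ballI newton_factor_pos)
    fix j p assume "j \<in> {..<length ps}" "p \<in> set (take j ps)"
    then show "p \<le> ps ! j" using ps by (auto simp: in_set_conv_nth sorted_iff_nth_mono_less)
  qed
  ultimately show ?thesis using that by simp
qed

text \<open>The increasing tuples of parameters in an interval form a convex set, on which the determinant has no
  zero.\<close>

lemma chebyshev_sign:
  fixes g :: "real \<Rightarrow> real^'n::{finite,wellorder}"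
  assumes T: "chebyshev UNIV g {a<..<b} CARD('n)" and g: "continuous_on UNIV g"
  obtains s where "s = 1 \<or> s = -1"
    "\<And>xs. sorted_wrt (<) xs \<Longrightarrow> set xs \<subseteq> {a<..<b} \<Longrightarrow> length xs = CARD('n) \<Longrightarrow> s * det_list (map g xs) > 0"
proof -
  let ?P = "\<lambda>xs. sorted_wrt (<) xs \<and> set xs \<subseteq> {a<..<b} \<and> length xs = CARD('n)"
  have nz: "det_list (map g xs) \<noteq> 0" if xs: "?P xs" for xs
  proof
    assume "det_list (map g xs) = 0"
    then obtain l where l: "l \<noteq> 0" "\<forall>v\<in>set (map g xs). l \<bullet> v = 0"
      using det_list_eq_0_iff[of "map g xs"] xs by auto
    have "card (set xs) < CARD('n)"
      by (rule chebyshev_zeros(2)[OF T, of l "set xs"]) (use l xs in auto)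
    moreover have "card (set xs) = CARD('n)"
      using xs distinct_card strict_sorted_iff by metis
    ultimately show False by simp
  qed
  have same: "det_list (map g xs) * det_list (map g ys) > 0" if xs: "?P xs" and ys: "?P ys" for xs ys
  proof (rule ccontr)
    assume neg: "\<not> ?thesis"
    define zs where "zs \<theta> = map (\<lambda>i. (1 - \<theta>) * xs ! i + \<theta> * ys ! i) [0..<CARD('n)]" for \<theta> :: real
    define F where "F \<theta> = det_list (map g (zs \<theta>))" for \<theta>
    have zsP: "?P (zs \<theta>)" if "\<theta> \<in> {0..1}" for \<theta>
    proof -
      have lt: "(1 - \<theta>) * x + \<theta> * y < (1 - \<theta>) * x' + \<theta> * y'" if "x < x'" "y < y'" for x x' y y'
      proof (cases "\<theta> = 0")
        case False
        have "(1 - \<theta>) * x \<le> (1 - \<theta>) * x'" using \<open>\<theta> \<in> {0..1}\<close> that by (intro mult_left_mono) auto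
        moreover have "\<theta> * y < \<theta> * y'" using \<open>\<theta> \<in> {0..1}\<close> that False by (intro mult_strict_left_mono) auto
        ultimately show ?thesis by simp
      qed (use that in simp)
      have "sorted_wrt (<) (zs \<theta>)"
        unfolding sorted_wrt_iff_nth_less zs_def
        using xs ys by (auto intro!: lt simp: sorted_wrt_iff_nth_less)
      moreover have "z \<in> {a<..<b}" if z: "z \<in> set (zs \<theta>)" for z
      proof -
        obtain i where i: "i < CARD('n)" "z = (1 - \<theta>) * xs ! i + \<theta> * ys ! i"
          using z by (auto simp: zs_def)
        have "xs ! i \<in> {a<..<b}" "ys ! i \<in> {a<..<b}" using xs ys i(1) by (metis nth_mem subsetD)+
        then have "(1 - \<theta>) * a + \<theta> * a < z" "z < (1 - \<theta>) * b + \<theta> * b" unfolding i(2) by (auto intro!: lt)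
        then show ?thesis by (simp add: algebra_simps)
      qed
      ultimately show ?thesis by (auto simp: zs_def)
    qed
    have ends: "zs 0 = xs" "zs 1 = ys" using xs ys by (auto simp: zs_def intro: nth_equalityI)
    have "continuous_on UNIV (\<lambda>\<theta>. g ((1 - \<theta>) * x + \<theta> * y))" for x y
      using continuous_on_compose2[OF g, of UNIV "\<lambda>\<theta>. (1 - \<theta>) * x + \<theta> * y"] by (simp add: continuous_intros)
    then have "continuous_on UNIV F"
      unfolding F_def det_list_def
      by (intro mdet_continuous_on) (auto simp: zs_def intro!: continuous_intros)
    moreover have "F 0 * F 1 < 0" using neg nz[OF xs] nz[OF ys] unfolding F_def ends
      by (metis linorder_neqE_linordered_idom mult_eq_0_iff)
    ultimately obtain \<theta> where "0 < \<theta>" "\<theta> < 1" "F \<theta> = 0" using sign_change_zero[of F 0 1] by auto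
    then show False using nz[OF zsP[of \<theta>]] by (simp add: F_def)
  qed
  show ?thesis
  proof (cases "\<exists>xs. ?P xs")
    case True
    then obtain xs where xs: "?P xs" by blast
    define s :: real where "s = (if det_list (map g xs) > 0 then 1 else -1)"
    have "s * det_list (map g ys) > 0" if "?P ys" for ys
      using same[OF xs that] by (auto simp: s_def zero_less_mult_iff)
    then show ?thesis using that[of s] by (auto simp: s_def)
  qed (use that[of 1] in blast)
qed

text \<open>The weak inequality is the limit of the inequality for simple points, taken one point after the other
  from the left; it is strict because the confluent values are independent.\<close>

theorem chebyshev_confluent_sign:
  fixes g :: "real \<Rightarrow> real^'n::{finite,wellorder}"
  assumes g: "smooth_fun g" and T: "chebyshev UNIV g {a<..<b} CARD('n)" and ab: "a < b"
  obtains s where "s = 1 \<or> s = -1"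
    "\<And>ps. sorted ps \<Longrightarrow> set ps \<subseteq> {a<..<b} \<Longrightarrow> length ps = CARD('n) \<Longrightarrow>
       (\<And>x. x \<in> set ps \<Longrightarrow> dim (jets g (replicate_mset (count_list ps x) x)) = count_list ps x) \<Longrightarrow>
       s * det_list (confluent_list g ps) > 0"
proof -
  obtain s where s: "s = 1 \<or> s = -1"
    "\<And>xs. sorted_wrt (<) xs \<Longrightarrow> set xs \<subseteq> {a<..<b} \<Longrightarrow> length xs = CARD('n) \<Longrightarrow> s * det_list (map g xs) > 0"
    using chebyshev_sign[OF T smooth_fun_continuous[OF g]] by blast
  have "s * det_list (confluent_list g ps) > 0"
    if ps: "sorted ps" "set ps \<subseteq> {a<..<b}" "length ps = CARD('n)"
      and single: "\<And>x. x \<in> set ps \<Longrightarrow> dim (jets g (replicate_mset (count_list ps x) x)) = count_list ps x" for ps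
  proof -
    obtain k where k: "k > 0" "det_list (confluent_list g ps) = k * det_list (newton_coeffs g ps)" by (rule det_list_confluent_list[OF g ps(3,1)])
    have "s * det_list ([] @ newton_coeffs g ps) \<ge> 0"
      by (rule weak_positivity[OF g, where t = a and b = b]) (use ps s(2) in \<open>auto intro: less_imp_le\<close>)
    moreover have "det_list (newton_coeffs g ps) \<noteq> 0"
    proof
      assume "det_list (newton_coeffs g ps) = 0"
      then obtain l where l: "l \<noteq> 0" "\<forall>v\<in>set (newton_coeffs g ps). l \<bullet> v = 0"
        using det_list_eq_0_iff[of "newton_coeffs g ps"] ps by auto
      have "dim (jets g (mset ps)) = size (mset ps)"
        by (rule chebyshev_confluent_independent[OF g, of "{a<..<b}"])
          (use T ps single ab in \<open>auto simp: count_mset infinite_Ioo\<close>)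
      then have "dim (set (newton_coeffs g ps)) = CARD('n)" using span_newton_coeffs[OF g, of ps] ps(3) by (metis dim_span size_mset)
      then have "dim (annihilator (set (newton_coeffs g ps))) = 0" using dim_annihilator[of "set (newton_coeffs g ps)"] by simp
      then have "l = 0" using l(2) by (auto simp: annihilator_def)
      then show False using l(1) by simp
    qed
    ultimately show ?thesis using k s(1) by (auto simp: zero_less_mult_iff mult_less_0_iff zero_le_mult_iff)
  qed
  then show ?thesis using that s(1) by blast
qed

section \<open>The flow of positive controls\<close>

text \<open>The entries of the solution of \<open>u' = u N\<close> with \<open>u(0) = 1\<close>, where \<open>N(t)\<close> has the entry \<open>c j t\<close> in row
  \<open>j\<close> and column \<open>j + 1\<close>, and zeros elsewhere.  A column depends only on the one before it, so that
  one definition by recursion on the column serves all sizes.\<close>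

fun flow :: "(nat \<Rightarrow> real \<Rightarrow> real) \<Rightarrow> nat \<Rightarrow> nat \<Rightarrow> real \<Rightarrow> real" where
  "flow c i 0 = (\<lambda>t. if i = 0 then 1 else 0)"
| "flow c i (Suc j) = (\<lambda>t. (if i = Suc j then 1 else 0) + antideriv (\<lambda>s. c j s * flow c i j s) t)"

lemma flow_0: "flow c i j 0 = (if i = j then 1 else 0)"
  by (cases j) auto

lemma flow_continuous:
  assumes "\<And>j. continuous_on UNIV (c j)"
  shows "continuous_on UNIV (flow c i j)"
proof (induction j)
  case (Suc j)
  then have "continuous_on UNIV (\<lambda>s. c j s * flow c i j s)" by (intro continuous_intros assms)
  then have "continuous_on UNIV (antideriv (\<lambda>s. c j s * flow c i j s))"
    by (meson DERIV_continuous_on antideriv_deriv)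
  then show ?case by (auto intro!: continuous_intros)
qed (auto intro: continuous_intros)

lemma flow_deriv:
  assumes "\<And>j. continuous_on UNIV (c j)"
  shows "(flow c i (Suc j) has_real_derivative c j t * flow c i j t) (at t)"
proof -
  have "continuous_on UNIV (\<lambda>s. c j s * flow c i j s)" by (intro continuous_intros assms flow_continuous)
  from antideriv_deriv[OF this, of t] show ?thesis by (auto intro!: derivative_eq_intros)
qed

lemma flow_lower: "j < i \<Longrightarrow> flow c i j t = 0"
proof (induction j arbitrary: t)
  case (Suc j)
  then have "(\<lambda>s. c j s * flow c i j s) = (\<lambda>s. 0)" by auto
  then show ?case using Suc.prems by (simp add: antideriv_def)
qed auto

lemma flow_diag: "flow c i i t = 1"
proof (cases i)
  case (Suc j)
  then have "(\<lambda>s. c j s * flow c i j s) = (\<lambda>s. 0)" by (auto simp: flow_lower)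
  then show ?thesis using Suc by (simp add: antideriv_def)
qed auto

lemma flow_smooth_fun:
  assumes "\<And>j. smooth_fun (c j)"
  shows "smooth_fun (flow c i j)"
proof (induction j)
  case 0
  then show ?case by (simp add: smooth_fun_const)
next
  case (Suc j)
  show ?case
    by (rule csmoothI[of _ "\<lambda>t. c j t * flow c i j t"])
      (use flow_deriv[of c i j] assms Suc in \<open>auto simp: has_real_derivative_iff_has_vector_derivative
          smooth_fun_continuous simp del: flow.simps intro!: smooth_fun_mult\<close>)
qed

lemma ode_unique:
  fixes F G :: "nat \<Rightarrow> real \<Rightarrow> real"
  assumes F0: "\<And>t. t \<in> {a..b} \<Longrightarrow> F 0 t = G 0 t"
    and F: "\<And>j t. t \<in> {a..b} \<Longrightarrow> (F (Suc j) has_real_derivative c j t * F j t) (at t within {a..b})"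
    and G: "\<And>j t. t \<in> {a..b} \<Longrightarrow> (G (Suc j) has_real_derivative c j t * G j t) (at t within {a..b})"
    and init: "\<And>j. F j a = G j a"
    and t: "t \<in> {a..b}"
  shows "F j t = G j t"
  using t
proof (induction j arbitrary: t)
  case 0
  then show ?case using F0 by simp
next
  case (Suc j)
  have "((\<lambda>t. F (Suc j) t - G (Suc j) t) has_real_derivative 0) (at s within {a..b})" if "s \<in> {a..b}" for s
    using DERIV_diff[OF F[OF that, of j] G[OF that, of j]] Suc.IH[OF that] by simp
  then obtain k where k: "\<And>s. s \<in> {a..b} \<Longrightarrow> F (Suc j) s - G (Suc j) s = k"
    using has_field_derivative_zero_constant[of "{a..b}" "\<lambda>t. F (Suc j) t - G (Suc j) t"] by auto
  have "k = 0" using k[of a] init[of "Suc j"] Suc.prems by simp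
  then show ?case using k[OF Suc.prems] by simp
qed

text \<open>The solution after time \<open>a\<close> is the product of the solution at time \<open>a\<close> with the solution for the
  shifted controls, since both satisfy the same equation.\<close>

lemma flow_shift:
  assumes c: "\<And>j. continuous_on UNIV (c j)" and d: "\<And>j. continuous_on UNIV (d j)"
    and eq: "\<And>j s. s \<in> {0..b} \<Longrightarrow> d j s = c j (a + s)" and t: "t \<in> {0..b}"
  shows "flow c i j (a + t) = (\<Sum>l\<le>j. flow c i l a * flow d l j t)"
proof (rule ode_unique[where a = 0 and b = b and c = d and
    F = "\<lambda>j t. flow c i j (a + t)" and G = "\<lambda>j t. \<Sum>l\<le>j. flow c i l a * flow d l j t"])
  fix j s assume s: "s \<in> {0..b}"
  have "(flow c i (Suc j) has_real_derivative c j (a + s) * flow c i j (a + s)) (at (s + a))"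
    unfolding add.commute[of a s] by (rule flow_deriv) (rule c)
  then have "((\<lambda>t. flow c i (Suc j) (t + a)) has_real_derivative c j (a + s) * flow c i j (a + s)) (at s)"
    by (rule iffD1[OF DERIV_shift])
  then have "((\<lambda>t. flow c i (Suc j) (a + t)) has_real_derivative c j (a + s) * flow c i j (a + s)) (at s)"
    unfolding add.commute[of a] .
  then show "((\<lambda>t. flow c i (Suc j) (a + t)) has_real_derivative d j s * flow c i j (a + s)) (at s within {0..b})"
    using eq[OF s] by (simp add: has_field_derivative_at_within del: flow.simps)
  have "((\<lambda>t. \<Sum>l\<le>Suc j. flow c i l a * flow d l (Suc j) t) has_real_derivative
      (\<Sum>l\<le>Suc j. flow c i l a * (d j s * flow d l j s))) (at s)"
    by (intro DERIV_sum DERIV_cmult flow_deriv d)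
  moreover have "(\<Sum>l\<le>Suc j. flow c i l a * (d j s * flow d l j s)) = d j s * (\<Sum>l\<le>j. flow c i l a * flow d l j s)"
    by (simp add: flow_lower sum_distrib_left mult_ac)
  ultimately show "((\<lambda>t. \<Sum>l\<le>Suc j. flow c i l a * flow d l (Suc j) t) has_real_derivative
      d j s * (\<Sum>l\<le>j. flow c i l a * flow d l j s)) (at s within {0..b})"
    by (simp only: has_field_derivative_at_within)
next
  fix j
  show "flow c i j (a + 0) = (\<Sum>l\<le>j. flow c i l a * flow d l j 0)"
    by (simp add: flow_0 if_distrib[of "\<lambda>x. _ * x"] sum.delta cong: if_cong)
qed (use t in auto)

section \<open>Minors of the flow\<close>

lemma mdet_deriv:
  assumes "\<And>i j. i < p \<Longrightarrow> j < p \<Longrightarrow> ((\<lambda>t. f t i j) has_real_derivative f' i j) (at t)"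
  shows "((\<lambda>t. mdet p (f t)) has_real_derivative (\<Sum>b<p. mdet p (\<lambda>i j. if i = b then f' i j else f t i j))) (at t)"
proof -
  have "((\<lambda>t. signof \<pi> * (\<Prod>i = 0..<p. f t i (\<pi> i))) has_real_derivative
      (\<Sum>b<p. signof \<pi> * (\<Prod>i = 0..<p. if i = b then f' i (\<pi> i) else f t i (\<pi> i)))) (at t)"
    if \<pi>: "\<pi> permutes {0..<p}" for \<pi>
  proof -
    have d: "((\<lambda>t. f t i (\<pi> i)) has_derivative (*) (f' i (\<pi> i))) (at t)" if "i \<in> {0..<p}" for i
      using assms[of i "\<pi> i"] that permutes_in_image[OF \<pi>, of i] by (simp add: has_field_derivative_def)
    have "((\<lambda>t. \<Prod>i = 0..<p. f t i (\<pi> i)) has_derivative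
        (\<lambda>y. \<Sum>b = 0..<p. f' b (\<pi> b) * y * (\<Prod>j\<in>{0..<p} - {b}. f t j (\<pi> j)))) (at t)"
      by (rule has_derivative_prod) (rule d)
    moreover have "(\<lambda>y. \<Sum>b = 0..<p. f' b (\<pi> b) * y * (\<Prod>j\<in>{0..<p} - {b}. f t j (\<pi> j)))
        = (*) (\<Sum>b<p. \<Prod>i = 0..<p. if i = b then f' i (\<pi> i) else f t i (\<pi> i))"
    proof
      fix y
      have *: "f' b (\<pi> b) * y * (\<Prod>j\<in>{0..<p} - {b}. f t j (\<pi> j))
          = (\<Prod>i = 0..<p. if i = b then f' i (\<pi> i) else f t i (\<pi> i)) * y" if "b < p" for b
      proof -
        have "(\<Prod>i = 0..<p. if i = b then f' i (\<pi> i) else f t i (\<pi> i))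
            = f' b (\<pi> b) * (\<Prod>i\<in>{0..<p} - {b}. if i = b then f' i (\<pi> i) else f t i (\<pi> i))"
          using that by (subst prod.remove[of _ b]) auto
        also have "(\<Prod>i\<in>{0..<p} - {b}. if i = b then f' i (\<pi> i) else f t i (\<pi> i)) = (\<Prod>j\<in>{0..<p} - {b}. f t j (\<pi> j))"
          by (rule prod.cong) auto
        finally show ?thesis by simp
      qed
      show "(\<Sum>b = 0..<p. f' b (\<pi> b) * y * (\<Prod>j\<in>{0..<p} - {b}. f t j (\<pi> j)))
        = (\<Sum>b<p. \<Prod>i = 0..<p. if i = b then f' i (\<pi> i) else f t i (\<pi> i)) * y"
        unfolding sum_distrib_right lessThan_atLeast0[of p] by (intro sum.cong[OF refl] *) simp
    qed
    ultimately have "((\<lambda>t. \<Prod>i = 0..<p. f t i (\<pi> i)) has_real_derivative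
        (\<Sum>b<p. \<Prod>i = 0..<p. if i = b then f' i (\<pi> i) else f t i (\<pi> i))) (at t)"
      by (simp add: has_field_derivative_def)
    from DERIV_cmult[OF this, of "signof \<pi>"] show ?thesis by (simp add: sum_distrib_left)
  qed
  then have "((\<lambda>t. mdet p (f t)) has_real_derivative (\<Sum>\<pi> | \<pi> permutes {0..<p}. \<Sum>b<p. signof \<pi> * (\<Prod>i = 0..<p. if i = b then f' i (\<pi> i) else f t i (\<pi> i)))) (at t)"
    unfolding mdet_leibniz by (intro DERIV_sum) simp
  then show ?thesis unfolding mdet_leibniz by (subst sum.swap)
qed

lemma mdet_zero_row:
  assumes "k < p" "\<And>j. j < p \<Longrightarrow> f k j = 0"
  shows "mdet p f = 0"
  using mdet_row_linear[of k p f 0 f 0 f] assms by simp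

text \<open>If \<open>r \<le> q\<close> fails, the zeros below the diagonal form a block that is too large.\<close>

lemma minor_zero:
  assumes r: "\<And>a b. a < b \<Longrightarrow> b < p \<Longrightarrow> r a < r b" and q: "\<And>a b. a < b \<Longrightarrow> b < p \<Longrightarrow> q a < q b"
    and up: "\<And>a b. a < p \<Longrightarrow> b < p \<Longrightarrow> q b < r a \<Longrightarrow> A (r a) (q b) = (0::real)"
    and b: "b < p" "q b < (r b :: nat)"
  shows "mdet p (\<lambda>a b. A (r a) (q b)) = 0"
proof (rule mdet_zero_block[OF b(1)])
  fix i j assume ij: "b \<le> i" "i < p" "j \<le> b"
  have "r b \<le> r i" using r[of b i] ij by (cases "b = i") auto
  moreover have "q j \<le> q b" using q[of j b] ij b by (cases "b = j") auto
  ultimately show "A (r i) (q j) = 0" using up[of i j] ij b by simp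
qed

text \<open>The derivative of a minor is a sum over its columns: column \<open>q b\<close> is replaced by column \<open>q b - 1\<close>,
  with the factor \<open>c (q b - 1)\<close>.  By induction on the sum of the column indices these terms are
  nonnegative, and if \<open>q \<noteq> r\<close> the first column with \<open>r k < q k\<close> gives a positive one.  As the minor
  vanishes at time 0, it is positive afterwards.\<close>

theorem flow_minor_pos:
  assumes c: "\<And>j. continuous_on UNIV (c j)" and cpos: "\<And>j t. c j t > 0"
    and r: "\<And>a b. a < b \<Longrightarrow> b < p \<Longrightarrow> r a < r b" and q: "\<And>a b. a < b \<Longrightarrow> b < p \<Longrightarrow> q a < q b"
    and rq: "\<And>b. b < p \<Longrightarrow> r b \<le> q b" and t: "t > 0"
  shows "mdet p (\<lambda>b a. flow c (r a) (q b) t) > 0"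
  using q rq t
proof (induction "\<Sum>b<p. q b" arbitrary: q t rule: less_induct)
  case less
  show ?case
  proof (cases "\<forall>b<p. q b = r b")
    case True
    have "mdet p (\<lambda>b a. flow c (r a) (q b) t) = mdet p (\<lambda>a b. flow c (r a) (q b) t)" by (rule mdet_transpose)
    also have "\<dots> = (\<Prod>a<p. flow c (r a) (q a) t)"
      by (rule mdet_upper_triangular) (use True r in \<open>auto intro: flow_lower\<close>)
    also have "\<dots> = 1" using True by (simp add: flow_diag)
    finally show ?thesis by simp
  next
    case False
    define k where "k = (LEAST b. b < p \<and> q b \<noteq> r b)"
    have k: "k < p" "q k \<noteq> r k" using LeastI_ex[of "\<lambda>b. b < p \<and> q b \<noteq> r b"] False unfolding k_def by auto
    have below: "q b = r b" if "b < k" for b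
      using not_less_Least[of b "\<lambda>b. b < p \<and> q b \<noteq> r b"] that k(1) unfolding k_def[symmetric] by auto
    have rk: "r k < q k" using k less.prems(2)[of k] by simp
    define M where "M q t = mdet p (\<lambda>b a. flow c (r a) (q b) t)" for q t
    have M0: "M q 0 = 0"
    proof -
      have "mdet p (\<lambda>a b. flow c (r a) (q b) 0) = 0"
      proof (rule mdet_zero_row[OF k(1)])
        fix b assume b: "b < p"
        have "r k \<noteq> q b"
        proof (cases "b < k")
          case True
          then show ?thesis using below[OF True] r[OF True k(1)] by simp
        next
          case False
          then have "q k \<le> q b" using less.prems(1)[of k b] b by (cases "b = k") auto
          then show ?thesis using rk by simp
        qed
        then show "flow c (r k) (q b) 0 = 0" by (simp add: flow_0)
      qed
      then show ?thesis unfolding M_def by (subst mdet_transpose)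
    qed
    define low where "low b = q(b := q b - 1)" for b
    define D where "D s = (\<Sum>b<p. if q b = 0 then 0 else c (q b - 1) s * M (low b) s)" for s
    have deriv: "(M q has_real_derivative D s) (at s)" for s
    proof -
      define f' where "f' b a = (if q b = 0 then 0 else c (q b - 1) s * flow c (r a) (q b - 1) s)" for b a
      have "((\<lambda>t. flow c (r a) (q b) t) has_real_derivative f' b a) (at s)" for a b
        using flow_deriv[where c = c and i = "r a" and j = "q b - 1" and t = s, OF c]
        by (cases "q b") (auto simp: f'_def simp del: flow.simps(2))
      then have "(M q has_real_derivative (\<Sum>b<p. mdet p (\<lambda>i j. if i = b then f' i j else flow c (r j) (q i) s))) (at s)"
        unfolding M_def by (intro mdet_deriv)
      moreover have *: "mdet p (\<lambda>i j. if i = b then f' i j else flow c (r j) (q i) s)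
          = (if q b = 0 then 0 else c (q b - 1) s * M (low b) s)" if "b < p" for b
      proof (cases "q b = 0")
        case True
        then show ?thesis using that by (simp add: mdet_zero_row[of b] f'_def)
      next
        case False
        have "mdet p (\<lambda>i j. if i = b then f' i j else flow c (r j) (q i) s)
            = c (q b - 1) s * M (low b) s + 0 * M (low b) s"
          unfolding M_def by (rule mdet_row_linear[OF that]) (use False in \<open>auto simp: f'_def low_def\<close>)
        then show ?thesis using False by simp
      qed
      have "(\<Sum>b<p. mdet p (\<lambda>i j. if i = b then f' i j else flow c (r j) (q i) s)) = D s"
        unfolding D_def by (intro sum.cong[OF refl] *) simp
      ultimately show ?thesis by simp
    qed
    have strict: "M (low b) s > 0" if b: "b < p" "q b \<noteq> 0" and ok: "\<And>a. a < b \<Longrightarrow> q a < q b - 1" "r b \<le> q b - 1" and s: "s > 0" for b s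
      unfolding M_def
    proof (rule less.hyps)
      show "(\<Sum>x<p. low b x) < (\<Sum>x<p. q x)" unfolding low_def
        by (rule sum_strict_mono_ex1) (use b in auto)
      show "low b a < low b a'" if "a < a'" "a' < p" for a a'
        using less.prems(1)[of a a'] that ok(1)[of a] by (auto simp: low_def)
      show "r a \<le> low b a" if "a < p" for a using less.prems(2)[OF that] ok(2) by (auto simp: low_def)
      show "s > 0" by (rule s)
    qed
    have weak: "M (low b) s \<ge> 0" if b: "b < p" "q b \<noteq> 0" and s: "s > 0" for b s
    proof (cases "\<exists>a<b. q a = q b - 1")
      case True
      then obtain a where "a < b" "q a = q b - 1" by blast
      then have "M (low b) s = 0" unfolding M_def
        by (intro mdet_identical_rows[of a _ b]) (use b in \<open>auto simp: low_def\<close>)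
      then show ?thesis by simp
    next
      case False
      have lt: "q a < q b - 1" if "a < b" for a using less.prems(1)[of a b] b that False by force
      show ?thesis
      proof (cases "r b \<le> q b - 1")
        case True
        then show ?thesis using strict[OF b lt True s] by simp
      next
        case F: False
        have mono: "low b a < low b a'" if "a < a'" "a' < p" for a a'
          using less.prems(1)[of a a'] that lt[of a] by (auto simp: low_def)
        have "mdet p (\<lambda>a d. flow c (r a) (low b d) s) = 0"
          by (rule minor_zero[where A = "\<lambda>i j. flow c i j s" and b = b])
            (use r mono b F in \<open>auto simp: flow_lower low_def\<close>)
        then have "M (low b) s = 0" unfolding M_def by (subst mdet_transpose)
        then show ?thesis by simp
      qed
    qed
    have Dpos: "D s > 0" if s: "s > 0" for s
    proof -
      have nn: "0 \<le> (if q b = 0 then 0 else c (q b - 1) s * M (low b) s)" if "b < p" for b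
        using weak[OF that _ s] cpos[of "q b - 1" s] by auto
      have "q a < q k - 1" if "a < k" for a
      proof -
        have "r a < r k" using r[OF that k(1)] .
        then show ?thesis using below[OF that] rk by simp
      qed
      then have "M (low k) s > 0" using strict[OF k(1) _ _ _ s] rk by simp
      then have "0 < (if q k = 0 then 0 else c (q k - 1) s * M (low k) s)" using cpos rk by simp
      then show ?thesis unfolding D_def using nn k(1) by (intro sum_pos2[of _ k]) auto
    qed
    have "M q 0 < M q t"
    proof (rule DERIV_pos_imp_increasing_open[where f = "M q"])
      show "\<exists>y. (M q has_real_derivative y) (at x) \<and> y > 0" if "0 < x" "x < t" for x using deriv Dpos[OF that(1)] by blast
      show "continuous_on {0..t} (M q)" using deriv by (meson DERIV_continuous_on has_field_derivative_at_within)
    qed (rule less.prems)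
    then show ?thesis using M0 by (simp add: M_def)
  qed
qed

section \<open>Total positivity\<close>

lemma sorted_list_en:
  fixes I :: "'n::{finite,wellorder} set"
  obtains r where "\<And>a. a < card I \<Longrightarrow> r a < CARD('n) \<and> sorted_list_of_set I ! a = en (r a)"
    "\<And>a b. a < b \<Longrightarrow> b < card I \<Longrightarrow> r a < r b"
proof -
  define r where "r a = (SOME i. i < CARD('n) \<and> sorted_list_of_set I ! a = (en i :: 'n))" for a
  have r: "r a < CARD('n) \<and> sorted_list_of_set I ! a = en (r a)" for a
  proof -
    obtain i where "i < CARD('n)" "sorted_list_of_set I ! a = (en i :: 'n)" by (rule en_cases)
    then show ?thesis unfolding r_def by (intro someI[of "\<lambda>i. i < CARD('n) \<and> sorted_list_of_set I ! a = (en i :: 'n)"]) simp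
  qed
  moreover have "r a < r b" if "a < b" "b < card I" for a b
  proof -
    have "sorted_list_of_set I ! a < sorted_list_of_set I ! b"
      using strict_sorted_list_of_set[of I] that by (simp add: sorted_wrt_iff_nth_less)
    then show ?thesis using r[of a] r[of b] en_less_iff[of "r a" "r b", where 'n = 'n] by simp
  qed
  ultimately show ?thesis using that[of r] by blast
qed

lemma upper_unipotent_en:
  fixes A :: "'n::{finite,wellorder} sqmat"
  shows "upper_unipotent A \<longleftrightarrow> (\<forall>i<CARD('n). A $ en i $ en i = 1) \<and> (\<forall>i<CARD('n). \<forall>j<i. A $ en i $ en j = 0)"
    (is "?L \<longleftrightarrow> ?R")
proof
  assume ?L
  then show ?R unfolding upper_unipotent_def by (auto simp: en_less_iff)
next
  assume R: ?R
  have "A $ i $ i = 1" for i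
  proof -
    obtain a where "a < CARD('n)" "i = en a" by (rule en_cases)
    then show ?thesis using R by simp
  qed
  moreover have "A $ i $ j = 0" if "j < i" for i j
  proof -
    obtain a where a: "a < CARD('n)" "i = en a" by (rule en_cases)
    obtain b where b: "b < CARD('n)" "j = en b" by (rule en_cases)
    show ?thesis using R a b that by (auto simp: en_less_iff)
  qed
  ultimately show ?L unfolding upper_unipotent_def by blast
qed

lemma minor_mdet:
  assumes "card I = card J"
  shows "minor A I J = mdet (card I) (\<lambda>a b. A $ (sorted_list_of_set I ! a) $ (sorted_list_of_set J ! b))"
  unfolding minor_def mdet_def using assms by simp

theorem flow_totally_positive:
  fixes A :: "'n::{finite,wellorder} sqmat"
  assumes c: "\<And>j. continuous_on UNIV (c j)" and cpos: "\<And>j t. c j t > 0" and t: "t > 0"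
    and A: "\<And>i j. i < CARD('n) \<Longrightarrow> j < CARD('n) \<Longrightarrow> A $ en i $ en j = flow c i j t"
  shows "totally_positive_unipotent A"
  unfolding totally_positive_unipotent_def
proof (intro conjI allI impI)
  show "upper_unipotent A" unfolding upper_unipotent_en using A by (auto simp: flow_diag flow_lower)
  fix I J :: "'n set" assume "card I = card J \<and> (\<exists>v. upper_unipotent v \<and> minor v I J \<noteq> 0)"
  then obtain v where IJ: "card I = card J" and v: "upper_unipotent v" "minor v I J \<noteq> 0" by blast
  obtain r where r: "\<And>a. a < card I \<Longrightarrow> r a < CARD('n) \<and> sorted_list_of_set I ! a = en (r a)"
    "\<And>a b. a < b \<Longrightarrow> b < card I \<Longrightarrow> r a < r b" using sorted_list_en[of I] by blast
  obtain q where q: "\<And>a. a < card I \<Longrightarrow> q a < CARD('n) \<and> sorted_list_of_set J ! a = en (q a)"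
    "\<And>a b. a < b \<Longrightarrow> b < card I \<Longrightarrow> q a < q b" using sorted_list_en[of J] unfolding IJ by blast
  have minor: "minor B I J = mdet (card I) (\<lambda>a b. B $ en (r a) $ en (q b))" for B
    unfolding minor_mdet[OF IJ] by (rule mdet_cong) (simp add: r q)
  have rq: "r b \<le> q b" if "b < card I" for b
  proof (rule ccontr)
    assume "\<not> ?thesis"
    then have "minor v I J = 0" unfolding minor
      by (intro minor_zero[where A = "\<lambda>i j. v $ en i $ en j" and b = b])
        (use r q that v(1) in \<open>auto simp: upper_unipotent_en\<close>)
    then show False using v(2) by simp
  qed
  have "minor A I J = mdet (card I) (\<lambda>b a. flow c (r a) (q b) t)"
    unfolding minor mdet_transpose[of _ "\<lambda>b a. flow c (r a) (q b) t", symmetric]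
    by (rule mdet_cong) (simp add: A r q)
  also have "\<dots> > 0" by (rule flow_minor_pos[OF c cpos r(2) q(2) rq t])
  finally show "minor A I J > 0" .
qed

text \<open>Consecutive rows and the last columns.  For unipotent upper triangular matrices the positivity of these
  minors implies the positivity of all the others, as shown below.\<close>

definition corner_positive :: "'n::{finite,wellorder} sqmat \<Rightarrow> bool" where
  "corner_positive A \<longleftrightarrow> (\<forall>i p. i + p \<le> CARD('n) \<longrightarrow>
     mdet p (\<lambda>a b. A $ en (i + a) $ en (CARD('n) - p + b)) > 0)"

definition of_nat_mat :: "(nat \<Rightarrow> nat \<Rightarrow> real) \<Rightarrow> 'n::{finite,wellorder} sqmat" where
  "of_nat_mat f = (\<chi> x y. f (card {z. z < x}) (card {z. z < y}))"

lemma of_nat_mat_en: "i < CARD('n) \<Longrightarrow> j < CARD('n) \<Longrightarrow> of_nat_mat f $ (en i :: 'n::{finite,wellorder}) $ en j = f i j"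
  by (simp add: of_nat_mat_def card_below_en)

lemma sorted_list_en_interval:
  assumes "j \<le> CARD('n)"
  shows "sorted_list_of_set (en ` {i..<j} :: 'n::{finite,wellorder} set) = map en [i..<j]"
proof -
  have "sorted_wrt (<) (map (en :: nat \<Rightarrow> 'n) [i..<j])"
    unfolding sorted_wrt_iff_nth_less using assms by (auto simp: en_less_iff)
  then have "sorted (map (en :: nat \<Rightarrow> 'n) [i..<j])" "distinct (map (en :: nat \<Rightarrow> 'n) [i..<j])"
    unfolding strict_sorted_iff by blast+
  then have "sorted_list_of_set (set (map (en :: nat \<Rightarrow> 'n) [i..<j])) = map en [i..<j]"
    by (rule sorted_list_of_set.idem_if_sorted_distinct)
  then show ?thesis by simp
qed

lemma totally_positive_corner_positive:
  fixes A :: "'n::{finite,wellorder} sqmat"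
  assumes A: "totally_positive_unipotent A"
  shows "corner_positive A"
  unfolding corner_positive_def
proof (intro allI impI)
  fix i p assume ip: "i + p \<le> CARD('n)"
  let ?I = "en ` {i..<i + p} :: 'n set" and ?J = "en ` {CARD('n) - p..<CARD('n)} :: 'n set"
  have cI: "card ?I = p" using ip by (subst card_image) (auto simp: inj_on_def en_eq_iff)
  have cJ: "card ?J = p" using ip by (subst card_image) (auto simp: inj_on_def en_eq_iff)
  have minor: "minor B ?I ?J = mdet p (\<lambda>a b. B $ en (i + a) $ en (CARD('n) - p + b))" for B :: "'n sqmat"
  proof -
    have cIJ: "card ?I = card ?J" using cI cJ by simp
    show ?thesis
      unfolding minor_mdet[OF cIJ] cI sorted_list_en_interval[OF ip] sorted_list_en_interval[OF order_refl]
      by (intro mdet_cong) (use ip in simp)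
  qed
  let ?v = "of_nat_mat (\<lambda>i j. flow (\<lambda>j t. 1) i j 1) :: 'n sqmat"
  have "upper_unipotent ?v" unfolding upper_unipotent_en by (auto simp: of_nat_mat_en flow_diag flow_lower)
  moreover have "minor ?v ?I ?J > 0"
  proof -
    have "minor ?v ?I ?J = mdet p (\<lambda>b a. flow (\<lambda>j t. 1) (i + a) (CARD('n) - p + b) 1)"
      unfolding minor mdet_transpose[of _ "\<lambda>b a. flow (\<lambda>j t. 1) (i + a) (CARD('n) - p + b) 1", symmetric]
      by (rule mdet_cong) (use ip in \<open>simp add: of_nat_mat_en\<close>)
    also have "\<dots> > 0" by (rule flow_minor_pos) (use ip in auto)
    finally show ?thesis .
  qed
  ultimately show "mdet p (\<lambda>a b. A $ en (i + a) $ en (CARD('n) - p + b)) > 0"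
    using A cI cJ unfolding totally_positive_unipotent_def minor[symmetric] by (metis less_irrefl)
qed

section \<open>Words in elementary matrices\<close>

text \<open>Multiplication from the left by the elementary matrix whose only entry off the diagonal is \<open>a\<close>, in
  row \<open>k\<close> and column \<open>k + 1\<close>.\<close>

definition row_op :: "nat \<Rightarrow> real \<Rightarrow> (nat \<Rightarrow> nat \<Rightarrow> real) \<Rightarrow> nat \<Rightarrow> nat \<Rightarrow> real" where
  "row_op k a A = (\<lambda>r c. if r = k then A k c + a * A (Suc k) c else A r c)"

text \<open>Multiplication from the right by the same elementary matrix.\<close>

definition col_op :: "nat \<Rightarrow> real \<Rightarrow> (nat \<Rightarrow> nat \<Rightarrow> real) \<Rightarrow> nat \<Rightarrow> nat \<Rightarrow> real" where
  "col_op k a A = (\<lambda>r c. if c = Suc k then A r (Suc k) + a * A r k else A r c)"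

abbreviation id_fun :: "nat \<Rightarrow> nat \<Rightarrow> real" where "id_fun \<equiv> (\<lambda>r c. if r = c then 1 else 0)"

fun word :: "(nat \<times> real) list \<Rightarrow> nat \<Rightarrow> nat \<Rightarrow> real" where
  "word [] = id_fun"
| "word ((k, a) # ws) = row_op k a (word ws)"

definition rword :: "(nat \<times> real) list \<Rightarrow> (nat \<Rightarrow> nat \<Rightarrow> real) \<Rightarrow> nat \<Rightarrow> nat \<Rightarrow> real" where
  "rword ws A = foldl (\<lambda>A w. col_op (fst w) (snd w) A) A ws"

lemma row_op_col_op: "row_op k a (col_op l b A) = col_op l b (row_op k a A)"
  by (rule ext, rule ext) (simp add: row_op_def col_op_def algebra_simps)

lemma row_op_rword: "row_op k a (rword ws A) = rword ws (row_op k a A)"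
  unfolding rword_def by (induction ws arbitrary: A) (auto simp: row_op_col_op)

text \<open>Elimination of rows builds a product from the left, the flow builds it from the right.\<close>

lemma word_rword: "word ws = rword ws id_fun"
proof (induction ws rule: word.induct)
  case (2 k a ws)
  have "row_op k a id_fun = col_op k a id_fun" by (rule ext, rule ext) (auto simp: row_op_def col_op_def)
  then show ?case using 2 by (simp add: row_op_rword) (simp add: rword_def)
qed (simp add: rword_def)

lemma rword_take_Suc:
  "k < length ws \<Longrightarrow> rword (take (Suc k) ws) A = col_op (fst (ws ! k)) (snd (ws ! k)) (rword (take k ws) A)"
  by (simp add: rword_def take_Suc_conv_app_nth)

lemma word_outside: "(\<And>k a. (k, a) \<in> set ws \<Longrightarrow> Suc k < m) \<Longrightarrow> m \<le> i \<or> m \<le> j \<Longrightarrow> word ws i j = id_fun i j"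
proof (induction ws arbitrary: i rule: word.induct)
  case (2 k a ws)
  have k: "Suc k < m" using "2.prems"(1)[of k a] by simp
  have IH: "word ws i j = id_fun i j" if "m \<le> i \<or> m \<le> j" for i
    by (rule "2.IH") (use "2.prems"(1) that in auto)
  show ?case
  proof (cases "i = k")
    case True
    then have "m \<le> j" using "2.prems"(2) k by simp
    then show ?thesis using IH[of k] IH[of "Suc k"] True k by (auto simp: row_op_def)
  qed (use IH "2.prems"(2) in \<open>simp add: row_op_def\<close>)
qed simp

section \<open>Factorisation by elimination of rows\<close>

text \<open>Corner positivity of a unipotent matrix of size \<open>n\<close>, for matrices given as functions, because the size
  decreases during the elimination.\<close>

definition eliminable :: "nat \<Rightarrow> (nat \<Rightarrow> nat \<Rightarrow> real) \<Rightarrow> bool" where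
  "eliminable n A \<longleftrightarrow> (\<forall>i<n. A i i = 1) \<and> (\<forall>i<n. \<forall>j<i. A i j = 0) \<and>
     (\<forall>i p. i + p \<le> n \<longrightarrow> mdet p (\<lambda>a b. A (i + a) (n - p + b)) > 0)"

lemma eliminable_last_pos:
  assumes "eliminable (Suc m) A" "i \<le> m"
  shows "A i m > 0"
proof -
  have "mdet 1 (\<lambda>a b. A (i + a) (Suc m - 1 + b)) > 0"
    using assms unfolding eliminable_def by (metis Suc_eq_plus1 Suc_le_mono)
  then show ?thesis by simp
qed

text \<open>Each row is reduced by the multiple of the next row that clears the last column.  The same row
  operations, applied to the minor with one more row and column, leave in its last column only the
  bottom entry; so the new minor is the quotient of two positive numbers.\<close>

lemma eliminable_eliminate:
  assumes A: "eliminable (Suc m) A"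
  shows "eliminable m (\<lambda>i j. A i j - A i m / A (Suc i) m * A (Suc i) j)"
proof -
  define a where "a i = A i m / A (Suc i) m" for i
  define A' where "A' i j = A i j - a i * A (Suc i) j" for i j
  have up: "A i i = 1" "j < i \<Longrightarrow> A i j = 0" if "i \<le> m" for i j using A that by (auto simp: eliminable_def)
  have "mdet p (\<lambda>c b. A' (i + c) (m - p + b)) > 0" if ip: "i + p \<le> m" for i p
  proof -
    define B where "B c b = A (i + c) (m - p + b)" for c b
    define L where "L c l = (if l = c then 1 else if l = Suc c then - a (i + c) else 0)" for c l
    define C where "C c b = (\<Sum>l<Suc p. L c l * B l b)" for c b
    have "i + Suc p \<le> Suc m" using ip by simp
    then have "mdet (Suc p) (\<lambda>c b. A (i + c) (Suc m - Suc p + b)) > 0"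
      using A unfolding eliminable_def by blast
    then have "mdet (Suc p) B > 0" by (simp add: B_def[abs_def])
    moreover have "mdet (Suc p) L = 1"
      by (subst mdet_upper_triangular) (auto simp: L_def)
    ultimately have "mdet (Suc p) C > 0" unfolding C_def mdet_mult by simp
    have C1: "C c b = A' (i + c) (m - p + b)" if "c < p" for c b
    proof -
      have "C c b = (\<Sum>l\<in>{c, Suc c}. L c l * B l b)"
        unfolding C_def by (rule sum.mono_neutral_right) (use that in \<open>auto simp: L_def\<close>)
      then show ?thesis by (simp add: L_def B_def A'_def)
    qed
    have C2: "C p b = A (i + p) (m - p + b)" for b
    proof -
      have "C p b = (\<Sum>l\<in>{p}. L p l * B l b)"
        unfolding C_def by (rule sum.mono_neutral_right) (auto simp: L_def)
      then show ?thesis by (simp add: L_def B_def)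
    qed
    have z: "A' k m = 0" if "k < m" for k
      using eliminable_last_pos[OF A, of "Suc k"] that by (simp add: A'_def a_def)
    have "mdet (p + 1) C = mdet p C * mdet 1 (\<lambda>c b. C (p + c) (p + b))"
    proof (rule mdet_block_lower)
      fix c b assume c: "c < p" "p \<le> b" "b < p + 1"
      then have "m - p + b = m" using ip by simp
      then show "C c b = 0" using C1[of c b] z[of "i + c"] ip c by simp
    qed
    also have "mdet p C = mdet p (\<lambda>c b. A' (i + c) (m - p + b))" by (rule mdet_cong) (simp add: C1)
    also have "mdet 1 (\<lambda>c b. C (p + c) (p + b)) = A (i + p) m" using ip by (simp add: C2)
    finally show ?thesis
      using \<open>mdet (Suc p) C > 0\<close> eliminable_last_pos[OF A ip] by (simp add: zero_less_mult_iff)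
  qed
  moreover have "A' i i = 1" if "i < m" for i using up[of i] up(2)[of "Suc i" i] that by (simp add: A'_def)
  moreover have "A' i j = 0" if "i < m" "j < i" for i j using up(2)[of i j] up(2)[of "Suc i" j] that by (simp add: A'_def)
  ultimately have "eliminable m A'" unfolding eliminable_def by blast
  then show ?thesis unfolding A'_def a_def .
qed

text \<open>The parameters are quotients of entries.  They are recorded as continuous functions of the matrix,
  since a whole neighbourhood of a matrix has to be factored at once.\<close>

theorem factorisation:
  fixes A :: "'a::topological_space \<Rightarrow> nat \<Rightarrow> nat \<Rightarrow> real"
  assumes "\<And>x. x \<in> S \<Longrightarrow> eliminable n (A x)"
    and "\<And>i j. i < n \<Longrightarrow> j < n \<Longrightarrow> continuous_on S (\<lambda>x. A x i j)"
  shows "\<exists>ws :: (nat \<times> ('a \<Rightarrow> real)) list.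
    (\<forall>(k, a)\<in>set ws. Suc k < n \<and> continuous_on S a \<and> (\<forall>x\<in>S. a x > 0)) \<and>
    (\<forall>x\<in>S. \<forall>i<n. \<forall>j<n. word (map (\<lambda>(k, a). (k, a x)) ws) i j = A x i j)"
  using assms
proof (induction n arbitrary: A)
  case 0
  then show ?case by (intro exI[of _ "[]"]) simp
next
  case (Suc m)
  define a where "a i x = A x i m / A x (Suc i) m" for i x
  define A' where "A' x i j = A x i j - A x i m / A x (Suc i) m * A x (Suc i) j" for x i j
  have pos: "A x i m > 0" if "x \<in> S" "i \<le> m" for x i
    using eliminable_last_pos[OF Suc.prems(1)[OF that(1)] that(2)] .
  have nz: "A x i m \<noteq> 0" if "x \<in> S" "i \<le> m" for x i using pos[OF that] by simp
  have "\<exists>ws :: (nat \<times> ('a \<Rightarrow> real)) list.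
    (\<forall>(k, a)\<in>set ws. Suc k < m \<and> continuous_on S a \<and> (\<forall>x\<in>S. a x > 0)) \<and>
    (\<forall>x\<in>S. \<forall>i<m. \<forall>j<m. word (map (\<lambda>(k, a). (k, a x)) ws) i j = A' x i j)"
  proof (rule Suc.IH)
    show "eliminable m (A' x)" if "x \<in> S" for x
      unfolding A'_def by (rule eliminable_eliminate[OF Suc.prems(1)[OF that]])
    show "continuous_on S (\<lambda>x. A' x i j)" if "i < m" "j < m" for i j
      unfolding A'_def using that nz by (intro continuous_intros Suc.prems(2)) auto
  qed
  then obtain ws :: "(nat \<times> ('a \<Rightarrow> real)) list" where ws:
    "\<forall>(k, a)\<in>set ws. Suc k < m \<and> continuous_on S a \<and> (\<forall>x\<in>S. a x > 0)"
    "\<forall>x\<in>S. \<forall>i<m. \<forall>j<m. word (map (\<lambda>(k, a). (k, a x)) ws) i j = A' x i j" by blast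
  define vs where "vs = map (\<lambda>i. (i, a i)) [0..<m] @ ws"
  have 1: "Suc k < Suc m \<and> continuous_on S b \<and> (\<forall>x\<in>S. b x > 0)" if "(k, b) \<in> set vs" for k b
  proof (cases "(k, b) \<in> set ws")
    case True
    then show ?thesis using ws(1) by auto
  next
    case False
    then have k: "k < m" "b = a k" using that by (auto simp: vs_def)
    have "continuous_on S (a k)" unfolding a_def[abs_def]
      using k nz by (intro continuous_intros Suc.prems(2)) auto
    moreover have "a k x > 0" if "x \<in> S" for x using pos[OF that] k by (simp add: a_def)
    ultimately show ?thesis using k by simp
  qed
  have 2: "word (map (\<lambda>(k, a). (k, a x)) vs) i j = A x i j" if x: "x \<in> S" and ij: "i < Suc m" "j < Suc m" for x i j
  proof -
    let ?W = "word (map (\<lambda>(k, a). (k, a x)) ws)"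
    have out: "?W i j = id_fun i j" if "m \<le> i \<or> m \<le> j" for i j
      by (rule word_outside[of _ m]) (use ws(1) that in auto)
    have Am: "A x m j = id_fun m j" if "j \<le> m" for j
      using Suc.prems(1)[OF x] that unfolding eliminable_def by (auto simp: order_le_less)
    have "word (map (\<lambda>(k, a). (k, a x)) (map (\<lambda>i. (i, a i)) [s..<m] @ ws)) i j = (if i < s then ?W i j else A x i j)"
      if "s \<le> m" "i \<le> m" "j \<le> m" for s i j
      using that
    proof (induction "m - s" arbitrary: s i j)
      case 0
      then have "s = m" by simp
      show ?case
      proof (cases "i < m")
        case False
        then show ?thesis using 0 \<open>s = m\<close> out[of m j] Am[of j] by simp
      qed (use \<open>s = m\<close> in simp)
    next
      case (Suc d)
      then have s: "s < m" by simp
      have IH: "word (map (\<lambda>(k, a). (k, a x)) (map (\<lambda>i. (i, a i)) [Suc s..<m] @ ws)) i j = (if i < Suc s then ?W i j else A x i j)"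
        if "i \<le> m" for i using Suc that by (intro Suc.hyps) auto
      have e: "map (\<lambda>(k, a). (k, a x)) (map (\<lambda>i. (i, a i)) [s..<m] @ ws)
          = (s, a s x) # map (\<lambda>(k, a). (k, a x)) (map (\<lambda>i. (i, a i)) [Suc s..<m] @ ws)"
        using s by (simp add: upt_conv_Cons)
      show ?case
      proof (cases "i = s")
        case True
        have "word (map (\<lambda>(k, a). (k, a x)) (map (\<lambda>i. (i, a i)) [s..<m] @ ws)) s j = ?W s j + a s x * A x (Suc s) j"
          unfolding e word.simps row_op_def using IH[of s] IH[of "Suc s"] s by simp
        also have "\<dots> = A x s j"
        proof (cases "j < m")
          case True
          then show ?thesis using ws(2) x s by (simp add: A'_def a_def)
        next
          case False
          then show ?thesis using Suc.prems(3) out[of s j] s nz[OF x, of "Suc s"] by (simp add: a_def)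
        qed
        finally show ?thesis using True by simp
      next
        case False
        then have "word (map (\<lambda>(k, a). (k, a x)) (map (\<lambda>i. (i, a i)) [s..<m] @ ws)) i j
          = word (map (\<lambda>(k, a). (k, a x)) (map (\<lambda>i. (i, a i)) [Suc s..<m] @ ws)) i j"
          unfolding e word.simps row_op_def by simp
        then show ?thesis using IH[of i] Suc.prems False by auto
      qed
    qed
    from this[of 0 i j] show ?thesis using ij by (simp add: vs_def)
  qed
  show ?case using 1 2 by (intro exI[of _ vs]) auto
qed

section \<open>Controls that follow a word\<close>

text \<open>In the unit interval from \<open>k\<close> to \<open>k + 1\<close> the \<open>k\<close>-th letter is active, with profile \<open>\<phi>\<close>; the constant
  \<open>e\<close> keeps all controls positive and makes them agree near the ends.\<close>

definition control :: "(real \<Rightarrow> real) \<Rightarrow> real \<Rightarrow> (nat \<times> real) list \<Rightarrow> nat \<Rightarrow> real \<Rightarrow> real" where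
  "control \<phi> e ws j t = e + (\<Sum>k<length ws. if fst (ws ! k) = j then snd (ws ! k) * \<phi> (t - real k) else 0)"

lemma control_smooth_fun: "smooth_fun \<phi> \<Longrightarrow> smooth_fun (control \<phi> e ws j)"
proof -
  assume \<phi>: "smooth_fun \<phi>"
  have "smooth_fun (\<lambda>t. if b then x * \<phi> (t - real k) else 0)" for b x k
    using smooth_fun_affine[OF \<phi>, of 1 "- real k"] by (cases b) (auto intro!: smooth_fun_mult smooth_fun_const)
  then show ?thesis unfolding control_def[abs_def] by (intro smooth_fun_add smooth_fun_const smooth_fun_sum)
qed

lemma control_pos:
  assumes "\<And>t. \<phi> t \<ge> 0" "e > 0" "\<And>k a. (k, a) \<in> set ws \<Longrightarrow> a \<ge> 0"
  shows "control \<phi> e ws j t > 0"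
proof -
  have "snd (ws ! k) \<ge> 0" if "k < length ws" for k
    using assms(3)[of "fst (ws ! k)" "snd (ws ! k)"] nth_mem[OF that] by simp
  then have "(\<Sum>k<length ws. if fst (ws ! k) = j then snd (ws ! k) * \<phi> (t - real k) else 0) \<ge> 0"
    using assms(1) by (intro sum_nonneg) auto
  then show ?thesis using assms(2) by (simp add: control_def)
qed

text \<open>Without the constant \<open>e\<close> only one control is active at a time, and its effect is one elementary
  column operation.\<close>

lemma word_flow:
  assumes \<phi>: "smooth_fun \<phi>" "\<And>t. t \<le> 0 \<or> t \<ge> 1 \<Longrightarrow> \<phi> t = 0" "integral {0..1} \<phi> = 1"
    and k: "k \<le> length ws"
  shows "flow (control \<phi> 0 ws) i j (real k) = rword (take k ws) id_fun i j"
  using k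
proof (induction k arbitrary: j)
  case 0
  then show ?case by (simp add: flow_0 rword_def)
next
  case (Suc k)
  let ?c = "control \<phi> 0 ws" and ?\<kappa> = "fst (ws ! k)" and ?a = "snd (ws ! k)"
  have c: "\<And>j. continuous_on UNIV (?c j)" using smooth_fun_continuous[OF control_smooth_fun[OF \<phi>(1)]] .
  have ck: "?c j t = (if j = ?\<kappa> then ?a * \<phi> (t - real k) else 0)" if "t \<in> {real k..real (Suc k)}" for j t
  proof -
    have "(if fst (ws ! l) = j then snd (ws ! l) * \<phi> (t - real l) else 0) = 0" if "l \<noteq> k" for l
    proof -
      have "t - real l \<le> 0 \<or> t - real l \<ge> 1" using that \<open>t \<in> _\<close> by (cases "l < k") auto
      then show ?thesis using \<phi>(2) by simp
    qed
    then have "(\<Sum>l<length ws. if fst (ws ! l) = j then snd (ws ! l) * \<phi> (t - real l) else 0)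
        = (\<Sum>l\<in>{k}. if fst (ws ! l) = j then snd (ws ! l) * \<phi> (t - real l) else 0)"
      using Suc.prems by (intro sum.mono_neutral_right) auto
    then show ?thesis by (auto simp: control_def)
  qed
  define F where "F j t = flow ?c i j t" for j t
  \<comment> \<open>The explicit solution on the interval of the letter \<open>k\<close>.\<close>
  define G where "G j t = (if j = Suc ?\<kappa> then F j k + ?a * antideriv \<phi> (t - real k) * F ?\<kappa> k else F j k)" for j t
  have F': "(F (Suc j) has_real_derivative ?c j t * F j t) (at t)" for j t
    unfolding F_def using flow_deriv[where c = ?c, OF c] .
  have "F j t = G j t" if "t \<in> {real k..real (Suc k)}" for j t
  proof (rule ode_unique[OF _ _ _ _ that, where c = ?c])
    show "F 0 t = G 0 t" for t by (simp add: F_def G_def)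
    show "(F (Suc j) has_real_derivative ?c j t * F j t) (at t within {real k..real (Suc k)})" for j t
      using F' by (rule has_field_derivative_at_within)
    show "F j (real k) = G j (real k)" for j by (simp add: G_def)
    show "(G (Suc j) has_real_derivative ?c j t * G j t) (at t within {real k..real (Suc k)})"
      if t: "t \<in> {real k..real (Suc k)}" for j t
    proof (cases "j = ?\<kappa>")
      case True
      have "(antideriv \<phi> has_real_derivative \<phi> (t - real k)) (at (t + (- real k)))"
        using antideriv_deriv[OF smooth_fun_continuous[OF \<phi>(1)], of "t - real k"] by simp
      then have "((\<lambda>t. antideriv \<phi> (t - real k)) has_real_derivative \<phi> (t - real k)) (at t)"
        using DERIV_shift[of "antideriv \<phi>" "\<phi> (t - real k)" t "- real k"] by simp
      then have "((\<lambda>t. F (Suc j) k + ?a * antideriv \<phi> (t - real k) * F ?\<kappa> k) has_real_derivative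
          ?a * \<phi> (t - real k) * F ?\<kappa> k) (at t)"
        by (auto intro!: derivative_eq_intros)
      moreover have "G (Suc j) = (\<lambda>t. F (Suc j) k + ?a * antideriv \<phi> (t - real k) * F ?\<kappa> k)"
        using True by (auto simp: G_def)
      moreover have "?c j t * G j t = ?a * \<phi> (t - real k) * F ?\<kappa> k"
        using True ck[OF t, of j] by (simp add: G_def)
      ultimately show ?thesis by (simp add: has_field_derivative_at_within)
    next
      case False
      then have "G (Suc j) = (\<lambda>t. F (Suc j) k)" "?c j t = 0" using ck[OF t, of j] by (auto simp: G_def)
      then show ?thesis by simp
    qed
  qed
  then have e: "F j (real (Suc k)) = G j (real (Suc k))" by simp
  have "antideriv \<phi> 1 = 1" using \<phi>(3) by (simp add: antideriv_def)
  then have "G j (real (Suc k)) = (if j = Suc ?\<kappa> then F j k + ?a * F ?\<kappa> k else F j k)"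
    by (simp add: G_def)
  also have "\<dots> = rword (take (Suc k) ws) id_fun i j"
  proof -
    have IH: "F j (real k) = rword (take k ws) id_fun i j" for j
      unfolding F_def using Suc by simp
    have k: "k < length ws" using Suc.prems by simp
    show ?thesis unfolding rword_take_Suc[OF k] col_op_def IH by simp
  qed
  finally show ?case using e unfolding F_def by simp
qed

text \<open>The substitution that turns the integral over \<open>{0..t}\<close> into one over \<open>{0..1}\<close> makes continuous
  dependence of the integral on parameters applicable to \<open>t\<close> as well.\<close>

lemma flow_param_continuous:
  fixes c :: "'p::topological_space \<Rightarrow> nat \<Rightarrow> real \<Rightarrow> real"
  assumes cp: "\<And>j. continuous_on (P \<times> {0..T}) (\<lambda>(p, t). c p j t)"
  shows "continuous_on (P \<times> {0..T}) (\<lambda>(p, t). flow (c p) i j t)"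
proof (induction j)
  case 0
  then show ?case by (auto simp: split_def intro: continuous_intros)
next
  case (Suc j)
  let ?f = "\<lambda>p s. c p j s * flow (c p) i j s"
  have f: "continuous_on (P \<times> {0..T}) (\<lambda>(p, s). ?f p s)"
    using cp[of j] Suc by (auto simp: split_def intro!: continuous_intros)
  have anti: "antideriv (?f p) t = integral (cbox 0 1) (\<lambda>s. t * ?f p (t * s))" if "p \<in> P" "t \<in> {0..T}" for p t
  proof (cases "t = 0")
    case False
    have "continuous_on {0..t} (?f p)"
    proof -
      have "continuous_on {0..t} (\<lambda>s. (\<lambda>(p, s). ?f p s) (p, s))"
        by (rule continuous_on_compose2[OF f]) (use that in \<open>auto intro!: continuous_intros\<close>)
      then show ?thesis by simp
    qed
    then have "(?f p has_integral integral {0..t} (?f p)) {0..t}"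
      by (intro integrable_integral integrable_continuous_real)
    from has_integral_affinity[of "?f p" _ 0 t t 0, OF this[folded cbox_interval]] False
    have "((\<lambda>s. ?f p (t * s)) has_integral (1 / \<bar>t\<bar>) *\<^sub>R integral {0..t} (?f p)) ((\<lambda>x. (1 / t) * x) ` cbox 0 t)"
      by simp
    moreover have "(\<lambda>x. (1 / t) * x) ` cbox 0 t = {0..1}"
      using that False by (auto simp: image_iff divide_simps intro!: bexI[of _ "t * _"])
    ultimately have "((\<lambda>s. t * ?f p (t * s)) has_integral t * ((1 / \<bar>t\<bar>) *\<^sub>R integral {0..t} (?f p))) {0..1}"
      by (metis has_integral_mult_right)
    moreover have "t * ((1 / \<bar>t\<bar>) *\<^sub>R integral {0..t} (?f p)) = integral {0..t} (?f p)"
      using that False by simp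
    ultimately have "((\<lambda>s. t * ?f p (t * s)) has_integral integral {0..t} (?f p)) {0..1}"
      by (simp only:)
    then have "integral {0..1} (\<lambda>s. t * ?f p (t * s)) = integral {0..t} (?f p)"
      by (rule integral_unique)
    moreover have "antideriv (?f p) t = integral {0..t} (?f p)" using that False by (simp add: antideriv_def)
    ultimately show ?thesis by simp
  qed simp
  have "continuous_on ((P \<times> {0..T}) \<times> cbox 0 1) (\<lambda>(x, s). snd x * ?f (fst x) (snd x * s))"
  proof -
    have "continuous_on ((P \<times> {0..T}) \<times> cbox 0 1) (\<lambda>y. (\<lambda>(p, s). ?f p s) (fst (fst y), snd (fst y) * snd y))"
      by (rule continuous_on_compose2[OF f]) (auto intro!: continuous_intros mult_nonneg_nonneg simp: mult_le_one
          intro: order_trans[OF mult_left_le])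
    then show ?thesis by (auto simp: split_def intro!: continuous_intros)
  qed
  then have "continuous_on (P \<times> {0..T}) (\<lambda>x. integral (cbox 0 1) (\<lambda>s. snd x * ?f (fst x) (snd x * s)))"
    by (rule integral_continuous_on_param)
  then have "continuous_on (P \<times> {0..T}) (\<lambda>x. (if i = Suc j then 1 else 0) + integral (cbox 0 1) (\<lambda>s. snd x * ?f (fst x) (snd x * s)))"
    by (intro continuous_intros)
  then show ?case
  proof (rule continuous_on_eq)
    fix x assume x: "x \<in> P \<times> {0..T}"
    show "(if i = Suc j then 1 else 0) + integral (cbox 0 1) (\<lambda>s. snd x * ?f (fst x) (snd x * s))
        = (case x of (p, t) \<Rightarrow> flow (c p) i (Suc j) t)"
      using anti[of "fst x" "snd x"] x by (simp add: split_def mem_Times_iff)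
  qed
qed

lemma corner_positive_eliminable:
  fixes w :: "'n::{finite,wellorder} sqmat"
  assumes "upper_unipotent w" "corner_positive w"
  shows "eliminable CARD('n) (\<lambda>i j. w $ en i $ en j)"
  using assms unfolding eliminable_def corner_positive_def upper_unipotent_en by simp

lemma open_corner_positive: "open {w :: 'n::{finite,wellorder} sqmat. corner_positive w}"
proof -
  have o: "open {w :: 'n sqmat. 0 < mdet p (\<lambda>a b. w $ en (i + a) $ en (CARD('n) - p + b))}" for i p
    by (intro open_Collect_less mdet_continuous_on continuous_intros)
  have "open (\<Inter>x\<in>{x \<in> {..CARD('n)} \<times> {..CARD('n)}. fst x + snd x \<le> CARD('n)}.
      {w :: 'n sqmat. 0 < mdet (snd x) (\<lambda>a b. w $ en (fst x + a) $ en (CARD('n) - snd x + b))})"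
    by (rule open_INT) (simp, intro ballI o)
  moreover have "{w :: 'n sqmat. corner_positive w} = (\<Inter>x\<in>{x \<in> {..CARD('n)} \<times> {..CARD('n)}. fst x + snd x \<le> CARD('n)}.
      {w :: 'n sqmat. 0 < mdet (snd x) (\<lambda>a b. w $ en (fst x + a) $ en (CARD('n) - snd x + b))})"
    unfolding corner_positive_def by fastforce
  ultimately show ?thesis by simp
qed

lemma sqmat_eq_en: "(\<And>i j. i < CARD('n) \<Longrightarrow> j < CARD('n) \<Longrightarrow> A $ en i $ en j = B $ en i $ en j) \<Longrightarrow> A = (B :: 'n::{finite,wellorder} sqmat)"
proof -
  assume *: "\<And>i j. i < CARD('n) \<Longrightarrow> j < CARD('n) \<Longrightarrow> A $ en i $ en j = B $ en i $ en j"
  have "A $ x $ y = B $ x $ y" for x y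
  proof -
    obtain i where "i < CARD('n)" "x = en i" by (rule en_cases)
    moreover obtain j where "j < CARD('n)" "y = en j" by (rule en_cases)
    ultimately show ?thesis using * by simp
  qed
  then show ?thesis by (simp add: vec_eq_iff)
qed

text \<open>Near \<open>u\<close> let \<open>\<Psi> (e, w)\<close> be the endpoint of the controls that spell the factorisation of \<open>w\<close> with
  constant \<open>e\<close>.  For \<open>e = 0\<close> it is \<open>w\<close>; by compactness it is uniformly close to \<open>w\<close> for small \<open>e\<close>.
  A fixed point of \<open>w - \<Psi> (e, w) + u\<close>, which exists by Brouwer's theorem, has endpoint exactly \<open>u\<close>.\<close>

theorem corner_positive_reachable:
  fixes u :: "'n::{finite,wellorder} sqmat"
  assumes \<phi>: "smooth_fun \<phi>" "\<And>t. \<phi> t \<ge> 0" "\<And>t. t \<le> 0 \<or> t \<ge> 1 \<Longrightarrow> \<phi> t = 0" "integral {0..1} \<phi> = 1"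
    and u: "upper_unipotent u" "corner_positive u"
  obtains e0 where "e0 > 0"
    "\<And>e. 0 < e \<Longrightarrow> e \<le> e0 \<Longrightarrow> \<exists>ws. (\<forall>(k, a)\<in>set ws. a \<ge> 0) \<and>
       (\<forall>i<CARD('n). \<forall>j<CARD('n). flow (control \<phi> e ws) i j (real (length ws)) = u $ en i $ en j)"
proof -
  let ?n = "CARD('n)"
  obtain r where r: "r > 0" "cball u r \<subseteq> {w. corner_positive w}"
    using open_corner_positive[where 'n = 'n] u(2) by (metis mem_Collect_eq open_contains_cball)
  define K where "K = {w. upper_unipotent w} \<inter> cball u r"
  have closed: "closed {w :: 'n sqmat. upper_unipotent w}"
  proof -
    have "{w :: 'n sqmat. upper_unipotent w} = {w. \<forall>i. w $ i $ i = 1} \<inter> {w. \<forall>i j. j < i \<longrightarrow> w $ i $ j = 0}"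
      by (auto simp: upper_unipotent_def)
    then show ?thesis by (auto intro!: closed_Int closed_Collect_all closed_Collect_eq closed_Collect_imp continuous_intros)
  qed
  have convex: "convex {w :: 'n sqmat. upper_unipotent w}"
    by (auto simp: convex_def upper_unipotent_def)
  have K: "compact K" "convex K" "u \<in> K"
    unfolding K_def using closed convex u(1) r(1) by (auto intro!: closed_Int_compact convex_Int)
  have "\<exists>ws :: (nat \<times> ('n sqmat \<Rightarrow> real)) list.
    (\<forall>(k, a)\<in>set ws. Suc k < ?n \<and> continuous_on K a \<and> (\<forall>x\<in>K. a x > 0)) \<and>
    (\<forall>x\<in>K. \<forall>i<?n. \<forall>j<?n. word (map (\<lambda>(k, a). (k, a x)) ws) i j = x $ en i $ en j)"
  proof (rule factorisation)
    show "eliminable ?n (\<lambda>i j. x $ en i $ en j)" if "x \<in> K" for x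
      using that r(2) by (intro corner_positive_eliminable) (auto simp: K_def)
  qed (intro continuous_intros)
  then obtain ws :: "(nat \<times> ('n sqmat \<Rightarrow> real)) list" where ws:
    "\<And>k a. (k, a) \<in> set ws \<Longrightarrow> continuous_on K a" "\<And>k a x. (k, a) \<in> set ws \<Longrightarrow> x \<in> K \<Longrightarrow> a x > 0"
    "\<And>x i j. x \<in> K \<Longrightarrow> i < ?n \<Longrightarrow> j < ?n \<Longrightarrow> word (map (\<lambda>(k, a). (k, a x)) ws) i j = x $ en i $ en j"
    by fast
  let ?N = "length ws"
  define wx where "wx x = map (\<lambda>(k, a). (k, a x)) ws" for x
  define C where "C p = control \<phi> (fst p) (wx (snd p))" for p :: "real \<times> 'n sqmat"
  let ?P = "{0..1} \<times> K"
  define \<Psi> where "\<Psi> p = (of_nat_mat (\<lambda>i j. flow (C p) i j (real ?N)) :: 'n sqmat)" for p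
  have C: "continuous_on (?P \<times> {0..real ?N}) (\<lambda>(p, t). C p j t)" for j
  proof -
    have "continuous_on (?P \<times> {0..real ?N}) (\<lambda>z. if fst (ws ! k) = j then snd (ws ! k) (snd (fst z)) * \<phi> (snd z - real k) else 0)"
      if "k < ?N" for k
    proof -
      have "continuous_on K (snd (ws ! k))" using ws(1)[of "fst (ws ! k)" "snd (ws ! k)"] nth_mem[OF that] by simp
      then have "continuous_on (?P \<times> {0..real ?N}) (\<lambda>z. snd (ws ! k) (snd (fst z)))"
        by (rule continuous_on_compose2) (auto intro!: continuous_intros)
      moreover have "continuous_on (?P \<times> {0..real ?N}) (\<lambda>z. \<phi> (snd z - real k))"
        by (rule continuous_on_compose2[OF smooth_fun_continuous[OF \<phi>(1), of UNIV]]) (auto intro!: continuous_intros)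
      ultimately show ?thesis by (cases "fst (ws ! k) = j") (auto intro!: continuous_intros)
    qed
    then have "continuous_on (?P \<times> {0..real ?N}) (\<lambda>z. fst (fst z) + (\<Sum>k<?N. if fst (ws ! k) = j then snd (ws ! k) (snd (fst z)) * \<phi> (snd z - real k) else 0))"
      by (intro continuous_on_add continuous_on_sum continuous_intros) auto
    then show ?thesis
      by (rule continuous_on_eq) (auto simp: C_def control_def wx_def split_def intro!: sum.cong)
  qed
  have \<Psi>_cont: "continuous_on ?P \<Psi>"
  proof -
    have "continuous_on ?P (\<lambda>p. flow (C p) i j (real ?N))" for i j
    proof -
      have "continuous_on ?P (\<lambda>p. (\<lambda>(p, t). flow (C p) i j t) (p, real ?N))"
        by (rule continuous_on_compose2[OF flow_param_continuous[OF C]]) (auto intro!: continuous_intros)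
      then show ?thesis by simp
    qed
    then show ?thesis unfolding \<Psi>_def of_nat_mat_def by (intro continuous_on_vec_lambda)
  qed
  have \<Psi>0: "\<Psi> (0, w) = w" if w: "w \<in> K" for w
  proof (rule sqmat_eq_en)
    fix i j assume ij: "i < ?n" "j < ?n"
    have "length (wx w) = ?N" by (simp add: wx_def)
    then have "flow (C (0, w)) i j (real ?N) = word (wx w) i j"
      using word_flow[OF \<phi>(1,3,4), of ?N "wx w" i j] by (simp add: C_def word_rword)
    also have "\<dots> = w $ en i $ en j" unfolding wx_def by (rule ws(3)[OF w ij])
    finally show "\<Psi> (0, w) $ en i $ en j = w $ en i $ en j" by (simp add: \<Psi>_def of_nat_mat_en ij)
  qed
  have "uniformly_continuous_on ?P \<Psi>"
    by (rule compact_uniformly_continuous[OF \<Psi>_cont]) (intro compact_Times K compact_Icc)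
  then obtain d where d: "d > 0" "\<And>p q. p \<in> ?P \<Longrightarrow> q \<in> ?P \<Longrightarrow> dist q p < d \<Longrightarrow> dist (\<Psi> q) (\<Psi> p) < r"
    using r(1) unfolding uniformly_continuous_on_def by metis
  define e0 where "e0 = min 1 (d / 2)"
  have "\<exists>vs. (\<forall>(k, a)\<in>set vs. a \<ge> 0) \<and> (\<forall>i<?n. \<forall>j<?n. flow (control \<phi> e vs) i j (real (length vs)) = u $ en i $ en j)"
    if e: "0 < e" "e \<le> e0" for e
  proof -
    have e1: "e \<in> {0..1}" "e < d" using e d(1) by (auto simp: e0_def min_def split: if_splits)
    define f where "f w = w - \<Psi> (e, w) + u" for w
    obtain w where w: "w \<in> K" "f w = w"
    proof (rule brouwer[OF K(1,2), of f])
      show "K \<noteq> {}" using K(3) by blast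
      have "continuous_on K (\<lambda>w. \<Psi> (e, w))"
        by (rule continuous_on_compose2[OF \<Psi>_cont]) (use e1 in \<open>auto intro!: continuous_intros\<close>)
      then show "continuous_on K f" unfolding f_def by (intro continuous_intros)
      show "f \<in> K \<rightarrow> K"
      proof
        fix w assume w: "w \<in> K"
        have "dist (\<Psi> (e, w)) (\<Psi> (0, w)) < r"
          using e1 w d(2)[of "(0, w)" "(e, w)"] by (auto simp: dist_Pair_Pair dist_real_def)
        then have "f w \<in> cball u r" unfolding \<Psi>0[OF w] by (simp add: f_def dist_norm norm_minus_commute)
        moreover have "upper_unipotent (f w)"
          using w u(1) unfolding K_def upper_unipotent_en f_def \<Psi>_def by (auto simp: of_nat_mat_en flow_diag flow_lower)
        ultimately show "f w \<in> K" by (simp add: K_def)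
      qed
    qed
    then have \<Psi>u: "\<Psi> (e, w) = u" by (simp add: f_def)
    have "flow (control \<phi> e (wx w)) i j (real (length (wx w))) = u $ en i $ en j" if "i < ?n" "j < ?n" for i j
    proof -
      have "\<Psi> (e, w) $ en i $ en j = flow (C (e, w)) i j (real ?N)"
        unfolding \<Psi>_def by (rule of_nat_mat_en) (use that in auto)
      moreover have "C (e, w) = control \<phi> e (wx w)" "length (wx w) = ?N" by (simp_all add: C_def wx_def)
      ultimately show ?thesis using \<Psi>u by simp
    qed
    moreover have "a \<ge> 0" if "(k, a) \<in> set (wx w)" for k a
      using that ws(2)[OF _ w(1)] by (fastforce simp: wx_def intro: less_imp_le)
    ultimately show ?thesis by (intro exI[of _ "wx w"]) auto
  qed
  moreover have "e0 > 0" using d(1) by (simp add: e0_def)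
  ultimately show ?thesis using that by blast
qed

lemma word_nonempty:
  fixes u :: "'n::{finite,wellorder} sqmat"
  assumes n: "CARD('n) \<ge> 2" and u: "corner_positive u"
    and ws: "\<forall>i<CARD('n). \<forall>j<CARD('n). flow (control \<phi> e ws) i j (real (length ws)) = u $ en i $ en j"
  shows "ws \<noteq> []"
proof
  assume "ws = []"
  then have "u $ en 0 $ en (CARD('n) - 1) = 0" using ws[rule_format, of 0 "CARD('n) - 1"] n by (simp add: flow_0)
  moreover have "0 + 1 \<le> CARD('n) \<longrightarrow> mdet 1 (\<lambda>a b. u $ en (0 + a) $ en (CARD('n) - 1 + b)) > 0"
    using u unfolding corner_positive_def by blast
  ultimately show False using n by simp
qed

text \<open>The matrix is the endpoint of a path with positive controls.\<close>

theorem corner_positive_totally_positive: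
  fixes u :: "'n::{finite,wellorder} sqmat"
  assumes n: "CARD('n) \<ge> 2" and u: "upper_unipotent u" "corner_positive u"
  shows "totally_positive_unipotent u"
proof -
  obtain \<phi> :: "real \<Rightarrow> real" where \<phi>: "smooth_fun \<phi>" "\<And>t. \<phi> t \<ge> 0" "\<And>t. t \<le> 0 \<or> t \<ge> 1 \<Longrightarrow> \<phi> t = 0" "integral {0..1} \<phi> = 1"
    by (rule bump_exists) blast
  obtain e where e: "e > 0" "\<exists>ws. (\<forall>(k, a)\<in>set ws. a \<ge> 0) \<and>
       (\<forall>i<CARD('n). \<forall>j<CARD('n). flow (control \<phi> e ws) i j (real (length ws)) = u $ en i $ en j)"
  proof (rule corner_positive_reachable[OF \<phi> u])
    fix e0 :: real
    assume "e0 > 0" and *: "\<And>e. 0 < e \<Longrightarrow> e \<le> e0 \<Longrightarrow> \<exists>ws. (\<forall>(k, a)\<in>set ws. a \<ge> 0) \<and>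
       (\<forall>i<CARD('n). \<forall>j<CARD('n). flow (control \<phi> e ws) i j (real (length ws)) = u $ en i $ en j)"
    then show thesis by (intro that[of e0] *) auto
  qed
  then obtain ws where ws: "\<And>k a. (k, a) \<in> set ws \<Longrightarrow> a \<ge> 0"
    "\<And>i j. i < CARD('n) \<Longrightarrow> j < CARD('n) \<Longrightarrow> flow (control \<phi> e ws) i j (real (length ws)) = u $ en i $ en j"
    by fast
  have "ws \<noteq> []" using word_nonempty[OF n u(2)] ws(2) by blast
  show ?thesis
  proof (rule flow_totally_positive[where c = "control \<phi> e ws" and t = "real (length ws)"])
    show "continuous_on UNIV (control \<phi> e ws j)" for j by (intro smooth_fun_continuous control_smooth_fun \<phi>(1))
    show "control \<phi> e ws j t > 0" for j t by (rule control_pos[OF \<phi>(2) e(1)]) (rule ws(1))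
  qed (use \<open>ws \<noteq> []\<close> ws(2) in auto)
qed

section \<open>Flags spanned by sequences of vectors\<close>

lemma matrix_vector_eb: "k < CARD('n) \<Longrightarrow> i < CARD('n) \<Longrightarrow> (A *v eb k) $ en i = (A :: 'n::{finite,wellorder} sqmat) $ en i $ en k"
  by (simp add: matrix_vector_nth_en eb_nth if_distrib[of "\<lambda>x. _ * x"] sum.delta cong: if_cong)

lemma vec_eb_expansion: "(x :: (real, 'n::{finite,wellorder}) vec) = (\<Sum>k<CARD('n). x $ en k *\<^sub>R eb k)"
proof (rule vec_eq_en)
  fix i assume i: "i < CARD('n)"
  have "(\<Sum>k<CARD('n). x $ en k *\<^sub>R (eb k :: (real, 'n) vec)) $ en i = (\<Sum>k<CARD('n). x $ en k * (if i = k then 1 else 0))"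
    unfolding sum_component by (rule sum.cong) (use i in \<open>auto simp: eb_nth\<close>)
  then show "x $ en i = (\<Sum>k<CARD('n). x $ en k *\<^sub>R (eb k :: (real, 'n) vec)) $ en i"
    using i by (simp add: if_distrib[of "\<lambda>x. _ * x"] sum.delta cong: if_cong)
qed

lemma span_eb_lower:
  assumes "j \<le> CARD('n)"
  shows "x \<in> span (eb ` {..<j}) \<longleftrightarrow> (\<forall>i. j \<le> i \<longrightarrow> i < CARD('n) \<longrightarrow> (x :: (real, 'n::{finite,wellorder}) vec) $ en i = 0)"
proof
  assume "x \<in> span (eb ` {..<j})"
  then show "\<forall>i. j \<le> i \<longrightarrow> i < CARD('n) \<longrightarrow> x $ en i = 0"
    by (induction rule: span_induct_alt) (use assms in \<open>auto simp: eb_nth\<close>)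
next
  assume *: "\<forall>i. j \<le> i \<longrightarrow> i < CARD('n) \<longrightarrow> x $ en i = 0"
  have "x = (\<Sum>k<CARD('n). x $ en k *\<^sub>R eb k)" by (rule vec_eb_expansion)
  also have "\<dots> = (\<Sum>k<j. x $ en k *\<^sub>R eb k)"
    by (rule sum.mono_neutral_right) (use assms * in auto)
  also have "\<dots> \<in> span (eb ` {..<j})"
    by (intro span_sum span_scale span_base) auto
  finally show "x \<in> span (eb ` {..<j})" .
qed

lemma det_sqmat_eb: "det_sqmat A = det_list (map (\<lambda>k. A *v eb k) [0..<CARD('n)])" for A :: "'n::{finite,wellorder} sqmat"
proof -
  have "det_list (map (\<lambda>k. A *v eb k) [0..<CARD('n)]) = mdet CARD('n) (\<lambda>i j. A $ en j $ en i)"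
    unfolding det_list_def by (rule mdet_cong) (simp add: matrix_vector_eb)
  also have "\<dots> = det_sqmat A" unfolding det_sqmat_def by (rule mdet_transpose)
  finally show ?thesis by (rule sym)
qed

lemma det_sqmat_mult: "det_sqmat (A ** B) = det_sqmat A * det_sqmat B" for A B :: "'n::{finite,wellorder} sqmat"
proof -
  have "det_sqmat (A ** B) = det_list (map ((*v) A) (map (\<lambda>k. B *v eb k) [0..<CARD('n)]))"
    unfolding det_sqmat_eb[of "A ** B"] by (simp add: matrix_vector_mul_assoc o_def)
  also have "\<dots> = det_sqmat A * det_sqmat B" unfolding det_sqmat_eb[of B] by (rule det_list_matrix) simp
  finally show ?thesis .
qed

lemma det_sqmat_upper: "upper_unipotent A \<Longrightarrow> det_sqmat A = 1" for A :: "'n::{finite,wellorder} sqmat"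
  unfolding det_sqmat_def by (subst mdet_upper_triangular) (auto simp: upper_unipotent_en)

lemma upper_unipotent_one: "upper_unipotent (Finite_Cartesian_Product.mat 1 :: 'n::{finite,wellorder} sqmat)"
  by (auto simp: upper_unipotent_def mat_def)

lemma det_sqmat_invertible:
  fixes A :: "'n::{finite,wellorder} sqmat"
  assumes "det_sqmat A \<noteq> 0"
  obtains B where "B ** A = Finite_Cartesian_Product.mat 1" "A ** B = Finite_Cartesian_Product.mat 1" "det_sqmat B = 1 / det_sqmat A"
proof -
  have "x = 0" if x: "A *v x = 0" for x
  proof (rule ccontr)
    assume "x \<noteq> 0"
    have "det_sqmat A = 0" unfolding det_sqmat_def mdet_eq_0_iff
    proof (intro exI[of _ "\<lambda>j. x $ en j"] conjI allI impI)
      show "\<exists>j<CARD('n). x $ en j \<noteq> 0"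
      proof (rule ccontr)
        assume "\<not> ?thesis"
        then have "x = 0" by (intro vec_eq_en) simp
        then show False using \<open>x \<noteq> 0\<close> by simp
      qed
      show "(\<Sum>j<CARD('n). A $ en i $ en j * x $ en j) = 0" for i
        using arg_cong[OF x, of "\<lambda>v. v $ en i"] by (simp add: matrix_vector_nth_en)
    qed
    then show False using assms by simp
  qed
  then obtain B where B: "B ** A = Finite_Cartesian_Product.mat 1" using matrix_left_invertible_ker[of A] by blast
  then have B': "A ** B = Finite_Cartesian_Product.mat 1" by (simp add: matrix_left_right_inverse)
  have "det_sqmat B * det_sqmat A = 1"
    using det_sqmat_mult[of B A] det_sqmat_upper[OF upper_unipotent_one, where 'n = 'n] by (simp add: B)
  then show ?thesis using that[OF B B'] assms by (simp add: field_simps)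
qed

text \<open>Unipotence as a condition on flags; products and inverses are handled in this form.\<close>

lemma upper_unipotent_span:
  fixes A :: "'n::{finite,wellorder} sqmat"
  shows "upper_unipotent A \<longleftrightarrow> (\<forall>j<CARD('n). A *v eb j - eb j \<in> span (eb ` {..<j}))"
proof -
  have "A *v eb j - eb j \<in> span (eb ` {..<j}) \<longleftrightarrow> A $ en j $ en j = 1 \<and> (\<forall>i. j < i \<longrightarrow> i < CARD('n) \<longrightarrow> A $ en i $ en j = 0)"
    if j: "j < CARD('n)" for j
  proof -
    have "A *v eb j - eb j \<in> span (eb ` {..<j}) \<longleftrightarrow>
        (\<forall>i. j \<le> i \<longrightarrow> i < CARD('n) \<longrightarrow> A $ en i $ en j - (if i = j then 1 else 0) = 0)"
      unfolding span_eb_lower[OF less_imp_le[OF j]] using j by (simp add: matrix_vector_eb eb_nth)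
    then show ?thesis using j by (auto simp: le_less split: if_splits)
  qed
  then show ?thesis unfolding upper_unipotent_en by (meson less_trans)
qed

lemma upper_unipotent_preserves:
  fixes A :: "'n::{finite,wellorder} sqmat"
  assumes A: "upper_unipotent A" and x: "x \<in> span (eb ` {..<j})" and j: "j \<le> CARD('n)"
  shows "A *v x \<in> span (eb ` {..<j})"
  using x
proof (induction rule: span_induct_alt)
  case (step c x y)
  then obtain k where k: "k < j" "x = eb k" by auto
  have "A *v eb k - eb k \<in> span (eb ` {..<k})" using A k j unfolding upper_unipotent_span by simp
  then have "A *v eb k - eb k \<in> span (eb ` {..<j})" using k span_mono[of "eb ` {..<k}" "eb ` {..<j}"] by force
  moreover have "eb k \<in> span (eb ` {..<j})" using k by (intro span_base) auto
  ultimately have "A *v x \<in> span (eb ` {..<j})" using span_add k by fastforce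
  then show ?case using step by (simp add: matrix_vector_right_distrib matrix_vector_mult_scaleR span_add span_scale)
qed (simp add: span_zero)

lemma upper_unipotent_mult:
  fixes A B :: "'n::{finite,wellorder} sqmat"
  assumes A: "upper_unipotent A" and B: "upper_unipotent B"
  shows "upper_unipotent (A ** B)"
  unfolding upper_unipotent_span
proof (intro allI impI)
  fix j assume j: "j < CARD('n)"
  have "B *v eb j - eb j \<in> span (eb ` {..<j})" using B j unfolding upper_unipotent_span by simp
  then have "A *v (B *v eb j - eb j) \<in> span (eb ` {..<j})" using upper_unipotent_preserves[OF A] j by simp
  moreover have "A *v eb j - eb j \<in> span (eb ` {..<j})" using A j unfolding upper_unipotent_span by simp
  ultimately have "A *v (B *v eb j - eb j) + (A *v eb j - eb j) \<in> span (eb ` {..<j})" by (rule span_add)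
  then show "(A ** B) *v eb j - eb j \<in> span (eb ` {..<j})"
    by (simp add: matrix_vector_mult_diff_distrib matrix_vector_mul_assoc)
qed

lemma upper_unipotent_inverse:
  fixes A :: "'n::{finite,wellorder} sqmat"
  assumes A: "upper_unipotent A"
  obtains B where "upper_unipotent B" "B ** A = Finite_Cartesian_Product.mat 1" "A ** B = Finite_Cartesian_Product.mat 1"
proof -
  obtain B where B: "B ** A = Finite_Cartesian_Product.mat 1" "A ** B = Finite_Cartesian_Product.mat 1"
    using det_sqmat_invertible[of A] det_sqmat_upper[OF A] by (metis zero_neq_one)
  have "B *v eb j - eb j \<in> span (eb ` {..<j})" if "j < CARD('n)" for j
    using that
  proof (induction j rule: less_induct)
    case (less j)
    have sub: "B *v x \<in> span (eb ` {..<j})" if "x \<in> span (eb ` {..<j})" for x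
      using that
    proof (induction rule: span_induct_alt)
      case (step c x y)
      then obtain k where k: "k < j" "x = eb k" by auto
      have "B *v eb k - eb k \<in> span (eb ` {..<j})"
        using less.IH[OF k(1)] less.prems k span_mono[of "eb ` {..<k}" "eb ` {..<j}"] by force
      moreover have "eb k \<in> span (eb ` {..<j})" using k by (intro span_base) auto
      ultimately have "B *v x \<in> span (eb ` {..<j})" using span_add k by fastforce
      then show ?case using step by (simp add: matrix_vector_right_distrib matrix_vector_mult_scaleR span_add span_scale)
    qed (simp add: span_zero)
    have "A *v eb j - eb j \<in> span (eb ` {..<j})" using A less.prems unfolding upper_unipotent_span by simp
    then have "- (B *v (A *v eb j - eb j)) \<in> span (eb ` {..<j})" by (intro span_neg sub)
    then show ?case by (simp add: matrix_vector_mult_diff_distrib matrix_vector_mul_assoc B)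
  qed
  then show ?thesis using that[of B] B unfolding upper_unipotent_span by blast
qed

text \<open>The list ends at dimension \<open>CARD('n) - 1\<close>: a flag leaves out the whole space.\<close>

definition flag_of :: "(nat \<Rightarrow> real^'n) \<Rightarrow> 'n::finite flag" where
  "flag_of v = map (\<lambda>j. span (v ` {..j})) [0..<CARD('n) - 1]"

lemma osculating_flag_of: "osculating_flag \<gamma> t = flag_of (\<lambda>i. nth_vector_derivative i \<gamma> t)"
  by (simp add: osculating_flag_def flag_of_def)

lemma flag_act_of: "flag_act g (flag_of v) = flag_of (\<lambda>j. g *v v j)"
proof -
  have "(\<lambda>x. g *v x) ` span (v ` {..j}) = span ((\<lambda>j. g *v v j) ` {..j})" for j
    using linear_span_image[OF matrix_vector_mul_linear[of g], of "v ` {..j}"] by (simp add: image_image)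
  then show ?thesis unfolding flag_act_def flag_of_def by simp
qed

lemma flag_act_mult: "flag_act (A ** B) F = flag_act A (flag_act B F)"
  unfolding flag_act_def by (simp add: image_image matrix_vector_mul_assoc)

lemma flag_act_one: "flag_act (Finite_Cartesian_Product.mat 1) F = F"
  unfolding flag_act_def by (rule map_idI) simp

lemma flag_plus_of: "flag_plus = flag_of (eb :: nat \<Rightarrow> (real, 'n::{finite,wellorder}) vec)"
proof -
  have "{axis i 1 :: (real, 'n) vec | i. card {i'. i' < i} \<le> j} = eb ` {..j}" if "j < CARD('n) - 1" for j
  proof (intro equalityI subsetI)
    fix x :: "(real, 'n) vec" assume "x \<in> {axis i 1 | i. card {i'. i' < i} \<le> j}"
    then obtain i where i: "x = axis i 1" "card {i'. i' < i} \<le> j" by blast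
    obtain k where "k < CARD('n)" "i = en k" by (rule en_cases)
    then show "x \<in> eb ` {..j}" using i by (auto simp: card_below_en eb_def)
  next
    fix x :: "(real, 'n) vec" assume "x \<in> eb ` {..j}"
    then obtain k where "k \<le> j" "x = axis (en k) 1" by (auto simp: eb_def)
    then show "x \<in> {axis i 1 | i. card {i'. i' < i} \<le> j}" using that
      by (intro CollectI exI[of _ "en k"]) (simp add: card_below_en)
  qed
  then show ?thesis unfolding flag_plus_def flag_of_def by (intro map_cong) auto
qed

lemma flag_minus_of: "flag_minus = flag_of (\<lambda>j. eb (CARD('n) - 1 - j) :: (real, 'n::{finite,wellorder}) vec)"
proof -
  have "{axis i 1 :: (real, 'n) vec | i. card {i'. i < i'} \<le> j} = (\<lambda>j. eb (CARD('n) - 1 - j)) ` {..j}" if "j < CARD('n) - 1" for j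
  proof (intro equalityI subsetI)
    fix x :: "(real, 'n) vec" assume "x \<in> {axis i 1 | i. card {i'. i < i'} \<le> j}"
    then obtain i where i: "x = axis i 1" "card {i'. i < i'} \<le> j" by blast
    obtain k where k: "k < CARD('n)" "i = en k" by (rule en_cases)
    then have "CARD('n) - 1 - k \<le> j" "CARD('n) - 1 - (CARD('n) - 1 - k) = k" using i by (auto simp: card_above_en)
    then show "x \<in> (\<lambda>j. eb (CARD('n) - 1 - j)) ` {..j}" using i k
      by (intro image_eqI[of _ _ "CARD('n) - 1 - k"]) (auto simp: eb_def)
  next
    fix x :: "(real, 'n) vec" assume "x \<in> (\<lambda>j. eb (CARD('n) - 1 - j)) ` {..j}"
    then obtain k where k: "k \<le> j" "x = axis (en (CARD('n) - 1 - k)) 1" by (auto simp: eb_def)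
    have "CARD('n) - 1 - k < CARD('n)" by simp
    then show "x \<in> {axis i 1 | i. card {i'. i < i'} \<le> j}" using k that
      by (intro CollectI exI[of _ "en (CARD('n) - 1 - k)"]) (simp add: card_above_en)
  qed
  then show ?thesis unfolding flag_minus_def flag_of_def by (intro map_cong) auto
qed

lemma span_triangular:
  fixes v w :: "nat \<Rightarrow> 'a::real_vector"
  assumes "\<And>j. j < q \<Longrightarrow> v j - k j *\<^sub>R w j \<in> span (w ` {..<j})" "\<And>j. j < q \<Longrightarrow> k j \<noteq> 0"
  shows "span (v ` {..<q}) = span (w ` {..<q})"
  using assms
proof (induction q)
  case (Suc q)
  then have IH: "span (v ` {..<q}) = span (w ` {..<q})" by simp
  have "v q - k q *\<^sub>R w q \<in> span (w ` {..<q})" "k q \<noteq> 0" using Suc.prems by auto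
  then have "span (insert (v q) (w ` {..<q})) = span (insert (w q) (w ` {..<q}))"
    by (rule span_insert_cong)
  then show ?case by (simp add: lessThan_Suc span_insert IH)
qed simp

lemma flag_of_triangular:
  fixes v w :: "nat \<Rightarrow> real^'n"
  assumes "\<And>j. j < CARD('n) - 1 \<Longrightarrow> v j - k j *\<^sub>R w j \<in> span (w ` {..<j})" "\<And>j. j < CARD('n) - 1 \<Longrightarrow> k j \<noteq> 0"
  shows "flag_of v = flag_of w"
  unfolding flag_of_def
proof (intro map_cong refl)
  fix j assume "j \<in> set [0..<CARD('n) - 1]"
  then have "span (v ` {..<Suc j}) = span (w ` {..<Suc j})"
    using assms by (intro span_triangular[of _ v k w]) auto
  then show "span (v ` {..j}) = span (w ` {..j})" by (simp add: lessThan_Suc_atMost)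
qed

abbreviation be :: "nat \<Rightarrow> real^'n::{finite,wellorder}" where "be j \<equiv> eb (CARD('n) - 1 - j)"

lemma det_list_upper_columns:
  fixes V :: "'n::{finite,wellorder} sqmat"
  assumes V: "upper_unipotent V" and aq: "a + q = CARD('n)"
  shows "det_list (map eb [0..<a] @ map (\<lambda>j. V *v be j) [0..<q]) = rev_sign q"
proof -
  have "map (\<lambda>j. V *v be j) [0..<q] = rev (map (\<lambda>i. V *v eb (a + i)) [0..<q])"
    by (rule nth_equalityI) (use aq in \<open>auto simp: rev_nth intro!: arg_cong[of _ _ "\<lambda>i. V *v eb i"]\<close>)
  then have "det_list (map eb [0..<a] @ map (\<lambda>j. V *v be j) [0..<q])
      = det_list (map eb [0..<a] @ rev (map (\<lambda>i. V *v eb (a + i)) [0..<q]) @ [])" by simp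
  also have "\<dots> = rev_sign q * det_list (map eb [0..<a] @ map (\<lambda>i. V *v eb (a + i)) [0..<q] @ [])"
    using det_list_rev[of "map eb [0..<a]" "map (\<lambda>i. V *v eb (a + i)) [0..<q]" "[]"] aq by simp
  also have "[] = map (eb :: nat \<Rightarrow> (real, 'n) vec) [a + length (map (\<lambda>i. V *v eb (a + i)) [0..<q])..<CARD('n)]"
    using aq by simp
  also have "det_list (map eb [0..<a] @ map (\<lambda>i. V *v eb (a + i)) [0..<q] @ \<dots>)
      = mdet (length (map (\<lambda>i. V *v eb (a + i)) [0..<q])) (\<lambda>i j. map (\<lambda>i. V *v eb (a + i)) [0..<q] ! i $ en (a + j))"
    by (rule det_list_block[where q = 0]) (use aq in simp)
  also have "\<dots> = mdet q (\<lambda>i j. V $ en (a + j) $ en (a + i))"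
  proof -
    have "mdet q (\<lambda>i j. map (\<lambda>i. V *v eb (a + i)) [0..<q] ! i $ en (a + j)) = mdet q (\<lambda>i j. V $ en (a + j) $ en (a + i))"
      by (rule mdet_cong) (use aq in \<open>simp add: matrix_vector_eb\<close>)
    then show ?thesis by simp
  qed
  also have "\<dots> = mdet q (\<lambda>i j. V $ en (a + i) $ en (a + j))" by (rule mdet_transpose)
  also have "\<dots> = 1" by (subst mdet_upper_triangular) (use V aq in \<open>auto simp: upper_unipotent_en\<close>)
  finally show ?thesis by simp
qed

text \<open>The determinants say that the flag of \<open>w\<close> is in general position to the upper flag.  Hence each
  \<open>be j\<close> differs by a vector in the span of earlier basis vectors from one in the span of
  \<open>w 0, \<dots>, w j\<close>, and the latter are the columns of \<open>V\<close>.\<close>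

lemma opposite_flag:
  fixes w :: "nat \<Rightarrow> real^'n::{finite,wellorder}"
  assumes nz: "\<And>a q. a + q = CARD('n) \<Longrightarrow> 1 \<le> a \<Longrightarrow> 1 \<le> q \<Longrightarrow> det_list (map eb [0..<a] @ map w [0..<q]) \<noteq> 0"
  obtains V \<rho> where "upper_unipotent V"
    "\<And>j. j < CARD('n) - 1 \<Longrightarrow> w j - \<rho> j *\<^sub>R (V *v be j) \<in> span ((\<lambda>j. V *v be j) ` {..<j})"
    "\<And>q. q < CARD('n) \<Longrightarrow> (\<Prod>j<q. \<rho> j) * rev_sign q = det_list (map eb [0..<CARD('n) - q] @ map w [0..<q])"
    "\<And>j. j < CARD('n) - 1 \<Longrightarrow> \<rho> j \<noteq> 0"
proof -
  let ?n = "CARD('n)"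
  have "\<exists>x. x \<in> span (w ` {..j}) \<and> x - be j \<in> span (eb ` {..<?n - 1 - j})" if j: "j < ?n - 1" for j
  proof -
    let ?a = "?n - 1 - j"
    have "det_list (map eb [0..<?a] @ map w [0..<Suc j]) \<noteq> 0" by (rule nz) (use j in auto)
    then have nl: "\<not> (\<exists>l. l \<noteq> 0 \<and> (\<forall>v\<in>set (map eb [0..<?a] @ map w [0..<Suc j]). l \<bullet> v = 0))"
      using det_list_eq_0_iff[of "map eb [0..<?a] @ map w [0..<Suc j]"] j by simp
    have "be j \<in> span (set (map eb [0..<?a] @ map w [0..<Suc j]))"
    proof (rule ccontr)
      assume "\<not> ?thesis"
      then obtain h where "\<And>s. s \<in> set (map eb [0..<?a] @ map w [0..<Suc j]) \<Longrightarrow> h \<bullet> s = 0" "h \<bullet> be j \<noteq> 0"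
        by (rule separate_from_span) blast
      then show False using nl by (metis inner_zero_left)
    qed
    moreover have se: "set (map eb [0..<?a] @ map w [0..<Suc j]) = eb ` {..<?a} \<union> w ` {..j}"
      by (simp add: atLeast0LessThan lessThan_Suc_atMost del: upt_Suc)
    ultimately have "\<exists>y x. be j = y + x \<and> y \<in> span (eb ` {..<?a}) \<and> x \<in> span (w ` {..j})"
      unfolding se span_Un by blast
    then obtain y x where "be j = y + x" "y \<in> span (eb ` {..<?a})" "x \<in> span (w ` {..j})" by blast
    then show ?thesis by (intro exI[of _ x]) (auto simp: span_neg)
  qed
  then obtain u where u: "\<And>j. j < ?n - 1 \<Longrightarrow> u j \<in> span (w ` {..j})"
    "\<And>j. j < ?n - 1 \<Longrightarrow> u j - be j \<in> span (eb ` {..<?n - 1 - j})" by metis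
  define V where "V = (of_nat_mat (\<lambda>i k. if k = 0 then (if i = 0 then 1 else 0) else u (?n - 1 - k) $ (en i :: 'n)) :: 'n sqmat)"
  have Vbe: "V *v be j = u j" if j: "j < ?n - 1" for j
  proof (rule vec_eq_en)
    fix i assume "i < ?n"
    moreover have "?n - 1 - (?n - 1 - j) = j" "?n - 1 - j \<noteq> 0" using j by auto
    ultimately show "(V *v be j) $ en i = u j $ en i"
      by (simp add: matrix_vector_eb V_def of_nat_mat_en)
  qed
  have V: "upper_unipotent V" unfolding upper_unipotent_span
  proof (intro allI impI)
    fix k assume k: "k < ?n"
    show "V *v eb k - eb k \<in> span (eb ` {..<k})"
    proof (cases "k = 0")
      case True
      have "V *v eb 0 = eb 0"
        by (rule vec_eq_en) (simp add: matrix_vector_eb V_def of_nat_mat_en eb_nth)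
      then show ?thesis using True by (simp add: span_zero)
    next
      case False
      then show ?thesis using u(2)[of "?n - 1 - k"] Vbe[of "?n - 1 - k"] k by simp
    qed
  qed
  define b where "b j = V *v be j" for j
  have span_eq: "span (b ` {..<q}) = span (w ` {..<q})" if "q < ?n" for q
  proof (rule subspace_dim_equal)
    show "span (b ` {..<q}) \<subseteq> span (w ` {..<q})"
    proof (rule span_minimal)
      show "b ` {..<q} \<subseteq> span (w ` {..<q})"
      proof
        fix x assume "x \<in> b ` {..<q}"
        then obtain j where j: "j < q" "x = b j" by auto
        then have "x \<in> span (w ` {..j})" using u(1)[of j] Vbe[of j] that by (simp add: b_def)
        moreover have "w ` {..j} \<subseteq> w ` {..<q}" using j by auto
        ultimately show "x \<in> span (w ` {..<q})" using span_mono by blast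
      qed
    qed simp
    have "dim (w ` {..<q}) \<le> card (w ` {..<q})" by (rule dim_le_card') simp
    also have "\<dots> \<le> q" using card_image_le[of "{..<q}" w] by simp
    finally have wq: "dim (span (w ` {..<q})) \<le> q" by simp
    have "det_list (map eb [0..<?n - q] @ map b [0..<q]) \<noteq> 0"
      unfolding b_def using det_list_upper_columns[OF V, of "?n - q" q] that by simp
    then have nl: "\<not> (\<exists>l. l \<noteq> 0 \<and> (\<forall>v\<in>set (map eb [0..<?n - q] @ map b [0..<q]). l \<bullet> v = 0))"
      using det_list_eq_0_iff[of "map eb [0..<?n - q] @ map b [0..<q]"] that by simp
    have "annihilator (eb ` {..<?n - q} \<union> b ` {..<q}) = {0}"
    proof -
      have "set (map eb [0..<?n - q] @ map b [0..<q]) = eb ` {..<?n - q} \<union> b ` {..<q}"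
        by (auto simp: lessThan_atLeast0)
      then show ?thesis using nl unfolding annihilator_def by auto
    qed
    then have "dim (eb ` {..<?n - q} \<union> b ` {..<q}) = ?n"
      using dim_annihilator[of "eb ` {..<?n - q} \<union> b ` {..<q}"] by simp
    moreover have "dim (eb ` {..<?n - q} \<union> b ` {..<q}) \<le> dim (b ` {..<q}) + (?n - q)"
    proof -
      have "dim (A \<union> f ` {..<k}) \<le> dim A + k" for A :: "(real, 'n) vec set" and f k
      proof (induction k)
        case (Suc k)
        have "A \<union> f ` {..<Suc k} = insert (f k) (A \<union> f ` {..<k})" by (auto simp: lessThan_Suc)
        then show ?case using Suc by (simp add: dim_insert)
      qed simp
      from this[of "b ` {..<q}" eb "?n - q"] show ?thesis by (simp add: Un_commute)
    qed
    ultimately show "dim (span (w ` {..<q})) \<le> dim (span (b ` {..<q}))" using wq that by simp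
  qed auto
  have "\<exists>k. w j - k *\<^sub>R b j \<in> span (b ` {..<j})" if "j < ?n - 1" for j
  proof -
    have "w j \<in> span (w ` {..<Suc j})" by (intro span_base) auto
    then have "w j \<in> span (insert (b j) (b ` {..<j}))"
      using span_eq[of "Suc j"] that by (simp add: lessThan_Suc)
    then show ?thesis by (simp add: span_breakdown_eq)
  qed
  then obtain \<rho> where \<rho>: "\<And>j. j < ?n - 1 \<Longrightarrow> w j - \<rho> j *\<^sub>R b j \<in> span (b ` {..<j})" by metis
  have prod: "(\<Prod>j<q. \<rho> j) * rev_sign q = det_list (map eb [0..<?n - q] @ map w [0..<q])" if q: "q < ?n" for q
  proof -
    have "det_list (map eb [0..<?n - q] @ map w [0..<q] @ []) = (\<Prod>j<q. \<rho> j) * det_list (map eb [0..<?n - q] @ map b [0..<q] @ [])"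
    proof (rule det_list_triangular)
      fix j assume "j < q"
      then have "w j - \<rho> j *\<^sub>R b j \<in> span (b ` {..<j})" using \<rho>[of j] q by simp
      then show "w j - \<rho> j *\<^sub>R b j \<in> span (set (map eb [0..<?n - q]) \<union> b ` {..<j})"
        using span_mono[of "b ` {..<j}" "set (map eb [0..<?n - q]) \<union> b ` {..<j}"] by blast
    qed (use q in simp)
    then show ?thesis unfolding b_def using det_list_upper_columns[OF V, of "?n - q" q] q by simp
  qed
  have "\<rho> j \<noteq> 0" if j: "j < ?n - 1" for j
  proof -
    have "det_list (map eb [0..<?n - Suc j] @ map w [0..<Suc j]) \<noteq> 0" by (rule nz) (use j in auto)
    moreover have "Suc j < ?n" using j by simp
    ultimately have "(\<Prod>i<Suc j. \<rho> i) * rev_sign (Suc j) \<noteq> 0" using prod[of "Suc j"] by simp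
    then show ?thesis by simp
  qed
  then show ?thesis using that[OF V _ prod] \<rho> unfolding b_def by blast
qed

section \<open>From signs of determinants to positive configurations\<close>

text \<open>Reversing the last \<open>q + p\<close> rows puts the block of \<open>U\<close> between standard basis vectors.\<close>

lemma corner_det:
  fixes U :: "'n::{finite,wellorder} sqmat"
  assumes aqp: "a + q + p = CARD('n)"
  shows "det_list (map eb [0..<a] @ map be [0..<q] @ map (\<lambda>j. U *v be j) [0..<p])
    = rev_sign (q + p) * mdet p (\<lambda>i j. U $ en (a + i) $ en (CARD('n) - p + j))"
proof -
  let ?n = "CARD('n)"
    let ?c = "map (\<lambda>i. U *v eb (?n - p + i)) [0..<p]"
    have r1: "map be [0..<q] = rev (map (eb :: nat \<Rightarrow> (real, 'n) vec) [a + p..<?n])"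
      by (rule nth_equalityI) (use aqp in \<open>auto simp: rev_nth intro!: arg_cong[of _ _ eb]\<close>)
    have r2: "map (\<lambda>j. U *v be j) [0..<p] = rev ?c"
      by (rule nth_equalityI) (use aqp in \<open>auto simp: rev_nth intro!: arg_cong[of _ _ "\<lambda>i. U *v eb i"]\<close>)
    have "det_list (map eb [0..<a] @ map be [0..<q] @ map (\<lambda>j. U *v be j) [0..<p])
        = det_list (map eb [0..<a] @ rev (?c @ map eb [a + p..<?n]) @ [])"
      unfolding r1 r2 by simp
    also have "\<dots> = rev_sign (q + p) * det_list (map eb [0..<a] @ ?c @ map eb [a + p..<?n])"
    proof -
      have len: "length (?c @ map (eb :: nat \<Rightarrow> (real, 'n) vec) [a + p..<?n]) = q + p" using aqp by simp
      have "det_list (map eb [0..<a] @ rev (?c @ map eb [a + p..<?n]) @ [])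
          = rev_sign (length (?c @ map (eb :: nat \<Rightarrow> (real, 'n) vec) [a + p..<?n])) * det_list (map eb [0..<a] @ (?c @ map eb [a + p..<?n]) @ [])"
        by (rule det_list_rev) (use aqp in simp)
      then show ?thesis unfolding len append_Nil2 append_assoc .
    qed
    also have "map eb [a + p..<?n] = map (eb :: nat \<Rightarrow> (real, 'n) vec) [a + length ?c..<?n]" by simp
    also have "det_list (map eb [0..<a] @ ?c @ \<dots>) = mdet (length ?c) (\<lambda>i j. ?c ! i $ en (a + j))"
      by (rule det_list_block[where q = q]) (use aqp in simp)
    also have "\<dots> = mdet p (\<lambda>i j. U $ en (a + j) $ en (?n - p + i))"
    proof -
      have "mdet p (\<lambda>i j. ?c ! i $ en (a + j)) = mdet p (\<lambda>i j. U $ en (a + j) $ en (?n - p + i))"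
        by (rule mdet_cong) (use aqp in \<open>simp add: matrix_vector_eb\<close>)
      then show ?thesis by simp
    qed
    also have "\<dots> = mdet p (\<lambda>i j. U $ en (a + i) $ en (?n - p + j))" by (rule mdet_transpose)
    finally show ?thesis .
qed

lemma triple_corner_positive:
  fixes U :: "'n::{finite,wellorder} sqmat"
  assumes U: "upper_unipotent U"
    and pos: "\<And>a q p. a + q + p = CARD('n) \<Longrightarrow> 1 \<le> q \<Longrightarrow> 1 \<le> p \<Longrightarrow>
        rev_sign (q + p) * det_list (map eb [0..<a] @ map be [0..<q] @ map (\<lambda>j. U *v be j) [0..<p]) > 0"
  shows "corner_positive U"
  unfolding corner_positive_def
proof (intro allI impI)
  fix a p assume ap: "a + p \<le> CARD('n)"
  let ?n = "CARD('n)"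
  define q where "q = ?n - a - p"
  have aqp: "a + q + p = ?n" using ap by (simp add: q_def)
  consider "p = 0" | "q = 0" | "1 \<le> q" "1 \<le> p" by linarith
  then show "mdet p (\<lambda>i j. U $ en (a + i) $ en (?n - p + j)) > 0"
  proof cases
    case 1
    then show ?thesis by simp
  next
    case 2
    then have "?n - p = a" using aqp by simp
    then have "mdet p (\<lambda>i j. U $ en (a + i) $ en (?n - p + j)) = (\<Prod>i<p. U $ en (a + i) $ en (a + i))"
      using mdet_upper_triangular[of p "\<lambda>i j. U $ en (a + i) $ en (a + j)"] U ap by (simp add: upper_unipotent_en)
    also have "\<dots> = 1" using U ap by (simp add: upper_unipotent_en)
    finally show ?thesis by simp
  next
    case 3
    have "rev_sign (q + p) * (rev_sign (q + p) * mdet p (\<lambda>i j. U $ en (a + i) $ en (?n - p + j))) > 0"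
      using pos[OF aqp 3] unfolding corner_det[OF aqp] .
    then show ?thesis unfolding mult.assoc[symmetric] by simp
  qed
qed

lemma matrix_prod_list_snoc: "matrix_prod_list (us @ [u]) = matrix_prod_list us ** u"
  unfolding matrix_prod_list_def by (induction us) (auto simp: matrix_mul_assoc)

lemma sgn_rev_sign: "rev_sign k = 1 \<or> rev_sign k = -1"
  using rev_sign_square[of k] by (metis power2_eq_1_iff power2_eq_square)

lemma upper_unipotent_eb_column:
  fixes V :: "'n::{finite,wellorder} sqmat"
  assumes V: "upper_unipotent V" and len: "a + length Y = CARD('n)"
  shows "det_list (map (\<lambda>k. V *v eb k) [0..<a] @ Y) = det_list (map eb [0..<a] @ Y)"
proof -
  have "det_list ([] @ map (\<lambda>k. V *v eb k) [0..<a] @ Y) = (\<Prod>j<a. 1) * det_list ([] @ map eb [0..<a] @ Y)"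
    by (rule det_list_triangular) (use V len in \<open>auto simp: upper_unipotent_span\<close>)
  then show ?thesis by simp
qed

text \<open>A change of coordinates makes the first flag the upper one.  The signs of the new basis vectors are free,
  and are chosen such that the given signs \<open>\<sigma> a\<close> become those of the standard example, which are
  \<open>rev_sign\<close> of the number of remaining rows.  The other flags then are images of the lower flag under
  unipotent \<open>V i\<close>.  The determinants of two flags show that the coefficients \<open>\<rho>\<close> between the given
  bases and the columns of \<open>V i\<close> have positive products, so the determinants of three flags become
  the corner minors of the inverse of \<open>V i\<close> times \<open>V (i + 1)\<close>.\<close>

theorem determinant_signs_imp_standard:
  fixes f :: "nat \<Rightarrow> real^'n::{finite,wellorder}" and s :: "nat \<Rightarrow> nat \<Rightarrow> real^'n::{finite,wellorder}"
  assumes n: "CARD('n) \<ge> 2" and K: "K \<ge> 1"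
    and A: "\<And>i a q. i < K \<Longrightarrow> a + q = CARD('n) \<Longrightarrow> 1 \<le> a \<Longrightarrow> 1 \<le> q \<Longrightarrow>
        \<sigma> a * det_list (map f [0..<a] @ map (s i) [0..<q]) > 0"
    and B: "\<And>i a q p. Suc i < K \<Longrightarrow> a + q + p = CARD('n) \<Longrightarrow> 1 \<le> q \<Longrightarrow> 1 \<le> p \<Longrightarrow>
        \<sigma> a * det_list (map f [0..<a] @ map (s i) [0..<q] @ map (s (Suc i)) [0..<p]) > 0"
    and \<sigma>: "\<And>a. \<sigma> a = 1 \<or> \<sigma> a = -1"
  obtains g us where "invertible g" "length us + 1 = K" "\<forall>u\<in>set us. totally_positive_unipotent u"
    "map (flag_act g) (flag_of f # map (\<lambda>i. flag_of (s i)) [0..<K]) = standard_tuple us"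
proof -
  let ?n = "CARD('n)"
  let ?I = "Finite_Cartesian_Product.mat 1 :: 'n sqmat"
  \<comment> \<open>A flag leaves the last basis vector open; \<open>s 0 0\<close> is independent of the others.\<close>
  define f' where "f' k = (if k < ?n - 1 then f k else s 0 0)" for k
  define D where "D = det_list (map f' [0..<?n])"
  have "map f' [0..<?n] = map f [0..<?n - 1] @ map (s 0) [0..<1]"
    by (rule nth_equalityI) (use n in \<open>auto simp: f'_def nth_append\<close>)
  moreover have "\<sigma> (?n - 1) * det_list (map f [0..<?n - 1] @ map (s 0) [0..<1]) > 0"
    by (rule A) (use n K in linarith)+
  ultimately have D: "D \<noteq> 0" unfolding D_def by auto
  define h where "h = \<sigma> 0 * rev_sign ?n"
  \<comment> \<open>\<open>C a\<close> is the prescribed product of the first \<open>a\<close> signs; \<open>h\<close> normalises it to 1 at \<open>a = 0\<close>, and the last sign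
    makes the determinant of the coordinate change have the sign \<open>h\<close>.\<close>
  define C where "C a = (if a < ?n then \<sigma> a * rev_sign (?n - a) * h else h * sgn D)" for a
  have pm: "x * x = 1" if "x = 1 \<or> x = -1" for x :: real using that by auto
  have h2: "h * h = 1" using pm[OF \<sigma>[of 0]] by (simp add: h_def mult_ac)
  have C2: "C a * C a = 1" for a
  proof -
    have "(x * y * z) * (x * y * z) = (x * x) * (y * y) * (z * z)" for x y z :: real by simp
    then show ?thesis using pm[OF \<sigma>[of a]] h2 D unfolding C_def
      by (auto simp: sgn_if mult_ac)
  qed
  have C0: "C 0 = 1" using n h2 by (simp add: C_def h_def)
  define c where "c j = C j * C (Suc j)" for j
  have prodc: "(\<Prod>j<a. c j) = C a" for a
  proof (induction a)
    case (Suc a)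
    have "C a * (C a * C (Suc a)) = C (Suc a)" using C2[of a] by (simp flip: mult.assoc)
    then show ?case using Suc by (simp add: c_def)
  qed (simp add: C0)
  have c2: "c j * c j = 1" for j
  proof -
    have "c j * c j = (C j * C j) * (C (Suc j) * C (Suc j))" by (simp add: c_def)
    then show ?thesis by (simp add: C2)
  qed
  define G where "G = (of_nat_mat (\<lambda>i k. c k * f' k $ (en i :: 'n)) :: 'n sqmat)"
  have G_eb: "G *v eb k = c k *\<^sub>R f' k" if "k < ?n" for k
    by (rule vec_eq_en) (use that in \<open>simp add: matrix_vector_eb G_def of_nat_mat_en\<close>)
  have "map (\<lambda>k. G *v eb k) [0..<?n] = map (\<lambda>k. c k *\<^sub>R f' k) [0..<?n]"
    by (rule map_cong) (auto simp: G_eb)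
  then have "det_sqmat G = det_list ([] @ map (\<lambda>k. c k *\<^sub>R f' k) [0..<?n] @ [])"
    unfolding det_sqmat_eb append_Nil append_Nil2 by (rule arg_cong)
  also have "\<dots> = (\<Prod>k<?n. c k) * det_list ([] @ map f' [0..<?n] @ [])"
    by (rule det_list_triangular) (auto simp: span_zero)
  finally have detG: "det_sqmat G = h * \<bar>D\<bar>" unfolding prodc by (simp add: C_def D_def[symmetric] abs_sgn mult_ac)
  have hnz: "h \<noteq> 0" using h2 by auto
  obtain g1 where g1: "g1 ** G = ?I" "G ** g1 = ?I" "det_sqmat g1 = 1 / det_sqmat G"
    using det_sqmat_invertible[of G] detG D hnz by auto
  have g1_f': "g1 *v f' k = c k *\<^sub>R eb k" if "k < ?n" for k
  proof -
    have "g1 *v (G *v eb k) = eb k" by (simp add: matrix_vector_mul_assoc g1)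
    then have "c k *\<^sub>R (g1 *v f' k) = eb k" unfolding G_eb[OF that] by (simp add: matrix_vector_mult_scaleR)
    then have "c k *\<^sub>R c k *\<^sub>R (g1 *v f' k) = c k *\<^sub>R eb k" by simp
    then show ?thesis by (simp add: c2)
  qed
  have hg1: "h * det_sqmat g1 > 0"
  proof -
    have "h * det_sqmat g1 = (h * h) / (h * h * \<bar>D\<bar>)" unfolding g1(3) detG using hnz by simp
    then show ?thesis using D by (simp add: h2)
  qed
  have transf: "rev_sign (?n - a) * det_list (map eb [0..<a] @ map ((*v) g1) Y) > 0"
    if aY: "a + length Y = ?n" "1 \<le> length Y" and pos: "\<sigma> a * det_list (map f [0..<a] @ Y) > 0" for a Y
  proof -
    have a: "a < ?n" using aY by simp
    have "det_sqmat g1 * det_list (map f [0..<a] @ Y) = det_list (map ((*v) g1) (map f [0..<a] @ Y))"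
      by (rule det_list_matrix[symmetric]) (use aY in simp)
    also have "map ((*v) g1) (map f [0..<a] @ Y) = [] @ map (\<lambda>k. c k *\<^sub>R eb k) [0..<a] @ map ((*v) g1) Y"
    proof -
      have "g1 *v f k = c k *\<^sub>R eb k" if "k < a" for k
      proof -
        have "k < ?n - 1" using that aY by linarith
        then show ?thesis using g1_f'[of k] by (simp add: f'_def)
      qed
      then show ?thesis by simp
    qed
    also have "det_list \<dots> = (\<Prod>k<a. c k) * det_list ([] @ map eb [0..<a] @ map ((*v) g1) Y)"
      by (rule det_list_triangular) (use aY in \<open>auto simp: span_zero\<close>)
    finally have e: "det_sqmat g1 * det_list (map f [0..<a] @ Y) = C a * det_list (map eb [0..<a] @ map ((*v) g1) Y)"
      unfolding prodc by simp
    have "(h * det_sqmat g1) * (\<sigma> a * det_list (map f [0..<a] @ Y)) > 0" using hg1 pos by simp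
    also have "(h * det_sqmat g1) * (\<sigma> a * det_list (map f [0..<a] @ Y)) = h * \<sigma> a * (C a * det_list (map eb [0..<a] @ map ((*v) g1) Y))"
      unfolding e[symmetric] by simp
    also have "\<dots> = (h * h) * (\<sigma> a * \<sigma> a) * (rev_sign (?n - a) * det_list (map eb [0..<a] @ map ((*v) g1) Y))"
      using a by (simp add: C_def)
    finally show ?thesis by (simp add: h2 pm[OF \<sigma>])
  qed
  define w where "w i j = g1 *v s i j" for i j
  have wm: "map (w i) [0..<q] = map ((*v) g1) (map (s i) [0..<q])" for i q by (simp add: w_def)
  have A': "rev_sign q * det_list (map eb [0..<a] @ map (w i) [0..<q]) > 0"
    if "i < K" "a + q = ?n" "1 \<le> a" "1 \<le> q" for i a q
  proof -
    have "?n - a = q" using that by simp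
    then show ?thesis using transf[of a "map (s i) [0..<q]"] A[OF that] that unfolding wm by simp
  qed
  have B': "rev_sign (q + p) * det_list (map eb [0..<a] @ map (w i) [0..<q] @ map (w (Suc i)) [0..<p]) > 0"
    if "Suc i < K" "a + q + p = ?n" "1 \<le> q" "1 \<le> p" for i a q p
  proof -
    have "?n - a = q + p" using that by simp
    then show ?thesis using transf[of a "map (s i) [0..<q] @ map (s (Suc i)) [0..<p]"] B[OF that] that unfolding wm by simp
  qed
  define P where "P i V \<rho> \<longleftrightarrow> upper_unipotent V \<and>
      (\<forall>j<?n - 1. w i j - \<rho> j *\<^sub>R (V *v be j) \<in> span ((\<lambda>j. V *v be j) ` {..<j}) \<and> \<rho> j \<noteq> 0) \<and>
      (\<forall>q<?n. (\<Prod>j<q. \<rho> j) * rev_sign q = det_list (map eb [0..<?n - q] @ map (w i) [0..<q]))" for i V \<rho>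
  have "\<exists>V \<rho>. P i V \<rho>" if "i < K" for i
  proof -
    have nz: "det_list (map eb [0..<a] @ map (w i) [0..<q]) \<noteq> 0" if "a + q = ?n" "1 \<le> a" "1 \<le> q" for a q
      using A'[OF \<open>i < K\<close> that] by auto
    show ?thesis
    proof (rule opposite_flag[of "w i", OF nz])
      fix V \<rho>
      assume "upper_unipotent V"
        "\<And>j. j < ?n - 1 \<Longrightarrow> w i j - \<rho> j *\<^sub>R (V *v be j) \<in> span ((\<lambda>j. V *v be j) ` {..<j})"
        "\<And>q. q < ?n \<Longrightarrow> (\<Prod>j<q. \<rho> j) * rev_sign q = det_list (map eb [0..<?n - q] @ map (w i) [0..<q])"
        "\<And>j. j < ?n - 1 \<Longrightarrow> \<rho> j \<noteq> 0"
      then have "P i V \<rho>" unfolding P_def by simp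
      then show ?thesis by blast
    qed
  qed
  then obtain V \<rho> where VP: "\<And>i. i < K \<Longrightarrow> P i (V i) (\<rho> i)" by metis
  have V: "\<And>i. i < K \<Longrightarrow> upper_unipotent (V i)"
    and \<rho>: "\<And>i j. i < K \<Longrightarrow> j < ?n - 1 \<Longrightarrow> w i j - \<rho> i j *\<^sub>R (V i *v be j) \<in> span ((\<lambda>j. V i *v be j) ` {..<j})"
    and \<rho>nz: "\<And>i j. i < K \<Longrightarrow> j < ?n - 1 \<Longrightarrow> \<rho> i j \<noteq> 0"
    and prod\<rho>: "\<And>i q. i < K \<Longrightarrow> q < ?n \<Longrightarrow> (\<Prod>j<q. \<rho> i j) * rev_sign q = det_list (map eb [0..<?n - q] @ map (w i) [0..<q])"
    using VP unfolding P_def by blast+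
  have prod_pos: "(\<Prod>j<q. \<rho> i j) > 0" if i: "i < K" and q: "1 \<le> q" "q < ?n" for i q
  proof -
    have "rev_sign q * ((\<Prod>j<q. \<rho> i j) * rev_sign q) > 0"
      unfolding prod\<rho>[OF i q(2)] by (rule A'[OF i]) (use q in auto)
    then show ?thesis by (simp add: mult.left_commute[of "rev_sign q"])
  qed
  have "\<exists>W. upper_unipotent W \<and> W ** V i = ?I \<and> V i ** W = ?I" if "i < K" for i
    using upper_unipotent_inverse[OF V[OF that]] by metis
  then obtain W where W: "\<And>i. i < K \<Longrightarrow> upper_unipotent (W i)" "\<And>i. i < K \<Longrightarrow> W i ** V i = ?I"
    "\<And>i. i < K \<Longrightarrow> V i ** W i = ?I" by metis
  have TP: "totally_positive_unipotent (W i ** V (Suc i))" if i: "Suc i < K" for i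
  proof (rule corner_positive_totally_positive[OF n])
    let ?U = "W i ** V (Suc i)"
    have i': "i < K" using i by simp
    show U: "upper_unipotent ?U" by (rule upper_unipotent_mult[OF W(1)[OF i'] V[OF i]])
    show "corner_positive ?U"
    proof (rule triple_corner_positive[OF U])
      fix a q p assume aqp: "a + q + p = ?n" "1 \<le> q" "1 \<le> p"
      let ?b = "\<lambda>i j. V i *v be j"
      have sub: "w i j - \<rho> i j *\<^sub>R ?b i j \<in> span (set X \<union> ?b i ` {..<j})" if "i < K" "j < ?n - 1" for i j X
        using \<rho>[OF that] span_mono[of "?b i ` {..<j}" "set X \<union> ?b i ` {..<j}"] by blast
      have "det_list (map eb [0..<a] @ map (w i) [0..<q] @ map (w (Suc i)) [0..<p])
          = (\<Prod>j<q. \<rho> i j) * det_list (map eb [0..<a] @ map (?b i) [0..<q] @ map (w (Suc i)) [0..<p])"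
      proof (rule det_list_triangular)
        show "w i j - \<rho> i j *\<^sub>R ?b i j \<in> span (set (map eb [0..<a]) \<union> ?b i ` {..<j})" if "j < q" for j
          by (rule sub[OF i']) (use that aqp in linarith)
      qed (use aqp in simp)
      also have "det_list (map eb [0..<a] @ map (?b i) [0..<q] @ map (w (Suc i)) [0..<p])
          = det_list ((map eb [0..<a] @ map (?b i) [0..<q]) @ map (w (Suc i)) [0..<p] @ [])" by simp
      also have "\<dots> = (\<Prod>j<p. \<rho> (Suc i) j) * det_list ((map eb [0..<a] @ map (?b i) [0..<q]) @ map (?b (Suc i)) [0..<p] @ [])"
      proof (rule det_list_triangular)
        show "w (Suc i) j - \<rho> (Suc i) j *\<^sub>R ?b (Suc i) j \<in> span (set (map eb [0..<a] @ map (?b i) [0..<q]) \<union> ?b (Suc i) ` {..<j})" if "j < p" for j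
          by (rule sub[OF i]) (use that aqp in linarith)
      qed (use aqp in simp)
      finally have e: "det_list (map eb [0..<a] @ map (w i) [0..<q] @ map (w (Suc i)) [0..<p])
          = (\<Prod>j<q. \<rho> i j) * ((\<Prod>j<p. \<rho> (Suc i) j) * det_list (map eb [0..<a] @ map (?b i) [0..<q] @ map (?b (Suc i)) [0..<p]))"
        by simp
      have P: "(\<Prod>j<q. \<rho> i j) > 0" "(\<Prod>j<p. \<rho> (Suc i) j) > 0" using prod_pos i i' aqp by auto
      have "(\<Prod>j<q. \<rho> i j) * ((\<Prod>j<p. \<rho> (Suc i) j) * (rev_sign (q + p) * det_list (map eb [0..<a] @ map (?b i) [0..<q] @ map (?b (Suc i)) [0..<p]))) > 0"
        using B'[OF i aqp] unfolding e by (simp add: mult_ac)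
      then have 1: "rev_sign (q + p) * det_list (map eb [0..<a] @ map (?b i) [0..<q] @ map (?b (Suc i)) [0..<p]) > 0"
        using P by (simp add: zero_less_mult_iff)
      have "det_list (map ((*v) (W i)) (map eb [0..<a] @ map (?b i) [0..<q] @ map (?b (Suc i)) [0..<p]))
          = det_sqmat (W i) * det_list (map eb [0..<a] @ map (?b i) [0..<q] @ map (?b (Suc i)) [0..<p])"
        by (rule det_list_matrix) (use aqp in simp)
      also have "map ((*v) (W i)) (map eb [0..<a] @ map (?b i) [0..<q] @ map (?b (Suc i)) [0..<p])
          = map (\<lambda>k. W i *v eb k) [0..<a] @ (map be [0..<q] @ map (\<lambda>j. ?U *v be j) [0..<p])"
        by (simp add: o_def matrix_vector_mul_assoc W(2)[OF i'])
      also have "det_list \<dots> = det_list (map eb [0..<a] @ (map be [0..<q] @ map (\<lambda>j. ?U *v be j) [0..<p]))"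
        by (rule upper_unipotent_eb_column[OF W(1)[OF i']]) (use aqp in simp)
      finally show "rev_sign (q + p) * det_list (map eb [0..<a] @ map be [0..<q] @ map (\<lambda>j. ?U *v be j) [0..<p]) > 0"
        using 1 det_sqmat_upper[OF W(1)[OF i']] by simp
    qed
  qed
  define us where "us = map (\<lambda>i. W i ** V (Suc i)) [0..<K - 1]"
  define g where "g = W 0 ** g1"
  have prod_us: "matrix_prod_list (take i us) = W 0 ** V i" if "i < K" for i
    using that
  proof (induction i)
    case 0
    then show ?case by (simp add: matrix_prod_list_def W)
  next
    case (Suc i)
    have "i < length us" "us ! i = W i ** V (Suc i)" using Suc.prems by (auto simp: us_def)
    then have "take (Suc i) us = take i us @ [W i ** V (Suc i)]"
      by (simp add: take_Suc_conv_app_nth)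
    then have "matrix_prod_list (take (Suc i) us) = (W 0 ** V i) ** (W i ** V (Suc i))"
      using Suc by (simp add: matrix_prod_list_snoc)
    also have "\<dots> = W 0 ** (V i ** W i) ** V (Suc i)" by (simp add: matrix_mul_assoc)
    finally show ?case using Suc.prems by (simp add: W)
  qed
  have "invertible g"
  proof -
    have "invertible (W 0)" "invertible g1"
      using W(2,3)[of 0] g1 K unfolding invertible_def by auto
    then show ?thesis unfolding g_def by (rule invertible_mult)
  qed
  moreover have "length us + 1 = K" using K by (simp add: us_def)
  moreover have "\<forall>u\<in>set us. totally_positive_unipotent u" using TP by (auto simp: us_def)
  moreover have "flag_act g (flag_of f) = flag_plus"
  proof -
    have cnz: "c j \<noteq> 0" for j using c2[of j] by auto
    have W0: "upper_unipotent (W 0)" using W(1)[of 0] K by simp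
    have "flag_act g (flag_of f) = flag_of (\<lambda>j. W 0 *v (g1 *v f j))"
      by (simp add: g_def flag_act_of matrix_vector_mul_assoc)
    also have "\<dots> = flag_of eb"
    proof (rule flag_of_triangular[where k = c])
      fix j assume j: "j < ?n - 1"
      have "W 0 *v (g1 *v f j) - c j *\<^sub>R eb j = c j *\<^sub>R (W 0 *v eb j - eb j)"
        using g1_f'[of j] j by (simp add: f'_def matrix_vector_mult_scaleR scaleR_diff_right)
      also have "\<dots> \<in> span (eb ` {..<j})"
        using W0 j unfolding upper_unipotent_span by (intro span_scale) simp
      finally show "W 0 *v (g1 *v f j) - c j *\<^sub>R eb j \<in> span (eb ` {..<j})" .
    qed (rule cnz)
    finally show ?thesis by (simp add: flag_plus_of)
  qed
  moreover have "flag_act g (flag_of (s i)) = flag_act (matrix_prod_list (take i us)) flag_minus" if i: "i < K" for i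
  proof -
    have "flag_of (w i) = flag_of (\<lambda>j. V i *v be j)"
      by (rule flag_of_triangular[where k = "\<rho> i"]) (use \<rho>[OF i] \<rho>nz[OF i] in auto)
    then have "flag_act (W 0) (flag_of (w i)) = flag_act (W 0 ** V i) flag_minus"
      unfolding flag_act_mult flag_minus_of by (simp add: flag_act_of)
    moreover have "flag_act g (flag_of (s i)) = flag_act (W 0) (flag_of (w i))"
      by (simp add: g_def flag_act_of matrix_vector_mul_assoc w_def)
    ultimately show ?thesis using prod_us[OF i] by simp
  qed
  moreover from this have "map (\<lambda>i. flag_act g (flag_of (s i))) [0..<K] = map (\<lambda>i. flag_act (matrix_prod_list (take i us)) flag_minus) [0..<K]"
    by (intro map_cong) auto
  ultimately show ?thesis
    by (intro that[of g us]) (auto simp: standard_tuple_def o_def)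
qed

section \<open>The curve traced by the last column of a flow\<close>


definition flow_col :: "(nat \<Rightarrow> real \<Rightarrow> real) \<Rightarrow> nat \<Rightarrow> real \<Rightarrow> real^'n::{finite,wellorder}" where
  "flow_col c k t = (\<Sum>i<CARD('n). flow c i k t *\<^sub>R eb i)"

lemma flow_col_nth: "i < CARD('n) \<Longrightarrow> (flow_col c k t :: (real, 'n::{finite,wellorder}) vec) $ en i = flow c i k t"
proof -
  assume i: "i < CARD('n)"
  have "(flow_col c k t :: (real, 'n) vec) $ en i = (\<Sum>j<CARD('n). flow c j k t * (if i = j then 1 else 0))"
    unfolding flow_col_def sum_component by (rule sum.cong) (use i in \<open>auto simp: eb_nth\<close>)
  then show ?thesis using i by (simp add: if_distrib[of "\<lambda>x. _ * x"] sum.delta cong: if_cong)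
qed

lemma smooth_fun_flow_col: "(\<And>j. smooth_fun (c j)) \<Longrightarrow> smooth_fun (flow_col c k :: real \<Rightarrow> (real, 'n::{finite,wellorder}) vec)"
  unfolding flow_col_def[abs_def] by (intro smooth_fun_sum smooth_fun_scaleR smooth_fun_const flow_smooth_fun)

lemma flow_col_deriv:
  assumes "\<And>j. continuous_on UNIV (c j)"
  shows "((flow_col c (Suc k) :: real \<Rightarrow> (real, 'n::{finite,wellorder}) vec) has_vector_derivative c k t *\<^sub>R flow_col c k t) (at t)"
proof -
  have "((\<lambda>t. flow c i (Suc k) t *\<^sub>R (eb i :: (real, 'n) vec)) has_vector_derivative (c k t * flow c i k t) *\<^sub>R eb i) (at t)" for i
    using flow_deriv[where c = c and i = i and j = k and t = t, OF assms]
    by (intro bounded_linear.has_vector_derivative[OF bounded_linear_scaleR_left])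
      (simp only: has_real_derivative_iff_has_vector_derivative)
  then have "((\<lambda>t. \<Sum>i<CARD('n). flow c i (Suc k) t *\<^sub>R (eb i :: (real, 'n) vec)) has_vector_derivative
      (\<Sum>i<CARD('n). (c k t * flow c i k t) *\<^sub>R eb i)) (at t)"
    by (intro has_vector_derivative_sum)
  then show ?thesis unfolding flow_col_def[abs_def] by (simp only: scaleR_sum_right scaleR_scaleR)
qed

lemma flow_col_matrix: "k < CARD('n) \<Longrightarrow> flow_col c k t = (of_nat_mat (\<lambda>i j. flow c i j t) :: 'n::{finite,wellorder} sqmat) *v eb k"
  by (rule vec_eq_en) (simp add: flow_col_nth matrix_vector_eb of_nat_mat_en)

text \<open>Differentiation replaces a column by a positive multiple of the preceding one.\<close>

lemma flow_col_derivatives: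
  fixes c :: "nat \<Rightarrow> real \<Rightarrow> real"
  assumes c: "\<And>j. smooth_fun (c j)" and cpos: "\<And>j t. c j t > 0" and j: "j < CARD('n::{finite,wellorder})"
  shows "\<exists>a. (\<forall>i. smooth_fun (a i)) \<and> (\<forall>t. a j t > 0) \<and>
    (\<forall>t. nth_vector_derivative j (flow_col c (CARD('n) - 1)) t = (\<Sum>i\<le>j. a i t *\<^sub>R (flow_col c (CARD('n) - 1 - i) t :: (real, 'n) vec)))"
  using j
proof (induction j)
  case 0
  then show ?case by (intro exI[of _ "\<lambda>i t. 1"]) (simp add: smooth_fun_const)
next
  case (Suc j)
  let ?n = "CARD('n)"
  let ?v = "\<lambda>i t. flow_col c (?n - 1 - i) t :: (real, 'n) vec"
  obtain a where a: "\<And>i. smooth_fun (a i)" "\<And>t. a j t > 0"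
    "\<And>t. nth_vector_derivative j (flow_col c (?n - 1)) t = (\<Sum>i\<le>j. a i t *\<^sub>R ?v i t)"
  proof -
    have "j < ?n" using Suc.prems by simp
    then show ?thesis using Suc.IH that by blast
  qed
  have cc: "\<And>j. continuous_on UNIV (c j)" using c by (intro smooth_fun_continuous)
  define b where "b i t = (if i \<le> j then vder (a i) t else 0) + (if i = 0 then 0 else a (i - 1) t * c (?n - 1 - i) t)" for i t
  have dv: "(?v i has_vector_derivative c (?n - 1 - Suc i) t *\<^sub>R ?v (Suc i) t) (at t)" if "i \<le> j" for i t
  proof -
    have "?n - 1 - i = Suc (?n - 1 - Suc i)" using that Suc.prems by simp
    then show ?thesis using flow_col_deriv[where c = c and k = "?n - 1 - Suc i" and t = t and 'n = 'n, OF cc] by simp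
  qed
  have d: "((\<lambda>t. \<Sum>i\<le>j. a i t *\<^sub>R ?v i t) has_vector_derivative
      (\<Sum>i\<le>j. a i t *\<^sub>R (c (?n - 1 - Suc i) t *\<^sub>R ?v (Suc i) t) + vder (a i) t *\<^sub>R ?v i t)) (at t)" for t
    using smooth_fun_vder(1)[OF a(1)] dv
    by (intro has_vector_derivative_sum has_vector_derivative_scaleR)
      (auto simp: has_real_derivative_iff_has_vector_derivative)
  have eq: "(\<Sum>i\<le>j. a i t *\<^sub>R (c (?n - 1 - Suc i) t *\<^sub>R ?v (Suc i) t) + vder (a i) t *\<^sub>R ?v i t)
      = (\<Sum>i\<le>Suc j. b i t *\<^sub>R ?v i t)" for t
  proof -
    have "(\<Sum>i\<le>Suc j. b i t *\<^sub>R ?v i t) = (\<Sum>i\<le>Suc j. (if i \<le> j then vder (a i) t else 0) *\<^sub>R ?v i t)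
        + (\<Sum>i\<le>Suc j. (if i = 0 then 0 else a (i - 1) t * c (?n - 1 - i) t) *\<^sub>R ?v i t)"
      unfolding b_def scaleR_add_left sum.distrib ..
    also have "(\<Sum>i\<le>Suc j. (if i \<le> j then vder (a i) t else 0) *\<^sub>R ?v i t) = (\<Sum>i\<le>j. vder (a i) t *\<^sub>R ?v i t)"
      by simp
    also have "(\<Sum>i\<le>Suc j. (if i = 0 then 0 else a (i - 1) t * c (?n - 1 - i) t) *\<^sub>R ?v i t)
        = (\<Sum>i\<le>j. (a i t * c (?n - 1 - Suc i) t) *\<^sub>R ?v (Suc i) t)"
      by (subst sum.atMost_Suc_shift) simp
    finally show ?thesis by (simp add: sum.distrib add.commute)
  qed
  have "\<And>t. nth_vector_derivative (Suc j) (flow_col c (?n - 1)) t = (\<Sum>i\<le>Suc j. b i t *\<^sub>R ?v i t)"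
  proof -
    have "nth_vector_derivative j (flow_col c (?n - 1)) = (\<lambda>t. \<Sum>i\<le>j. a i t *\<^sub>R ?v i t)" by (rule ext) (rule a(3))
    then show "nth_vector_derivative (Suc j) (flow_col c (?n - 1)) t = (\<Sum>i\<le>Suc j. b i t *\<^sub>R ?v i t)" for t
      unfolding nth_vder_Suc using vector_derivative_at[OF d[of t]] eq[of t] by simp
  qed
  moreover have "smooth_fun (b i)" for i
  proof -
    have "smooth_fun (\<lambda>t. if i \<le> j then vder (a i) t else 0)" by (cases "i \<le> j") (simp_all add: smooth_fun_const smooth_fun_vder(2)[OF a(1)])
    moreover have "smooth_fun (\<lambda>t. if i = 0 then 0 else a (i - 1) t * c (?n - 1 - i) t)"
      by (cases "i = 0") (simp_all add: smooth_fun_const smooth_fun_mult a(1) c)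
    ultimately show ?thesis unfolding b_def[abs_def] by (rule smooth_fun_add)
  qed
  moreover have "b (Suc j) t > 0" for t using a(2) cpos by (simp add: b_def)
  ultimately show ?case by blast
qed

lemma rolle_count:
  fixes F F' :: "real \<Rightarrow> real"
  assumes F: "\<And>t. (F has_real_derivative F' t) (at t)" and Z: "finite Z" "Z \<noteq> {}" "\<And>z. z \<in> Z \<Longrightarrow> F z = 0"
  shows "\<exists>Y. finite Y \<and> card Z = Suc (card Y) \<and> (\<forall>y\<in>Y. F' y = 0 \<and> y < Max Z)"
  using Z
proof (induction Z rule: finite_linorder_max_induct)
  case (insert b A)
  show ?case
  proof (cases "A = {}")
    case False
    then obtain Y where Y: "finite Y" "card A = Suc (card Y)" "\<forall>y\<in>Y. F' y = 0 \<and> y < Max A"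
      using insert by auto
    have ab: "Max A < b" using insert False by simp
    have "F (Max A) = 0" "F b = 0" using insert.prems insert.hyps(1) False by auto
    then obtain y where y: "Max A < y" "y < b" "(F has_real_derivative 0) (at y)"
      using Rolle[OF ab, of F] F by (metis DERIV_continuous_on DERIV_isCont continuous_at_imp_continuous_on real_differentiable_def)
    then have "F' y = 0" using DERIV_unique[OF F] by blast
    have "y \<notin> Y" using Y y by force
    have m: "Max (insert b A) = b" by (rule Max_eqI) (use insert.hyps in \<open>auto intro: less_imp_le\<close>)
    show ?thesis
    proof (intro exI[of _ "insert y Y"] conjI ballI)
      show "card (insert b A) = Suc (card (insert y Y))"
        using insert.hyps Y \<open>y \<notin> Y\<close> by (subst card_insert_disjoint) auto
      show "F' x = 0" "x < Max (insert b A)" if "x \<in> insert y Y" for x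
        unfolding m using that Y y ab \<open>F' y = 0\<close> by force+
    qed (use Y in auto)
  qed (use insert in auto)
qed simp

text \<open>The derivative of \<open>l \<bullet> flow_col c (k + 1)\<close> is a positive function times \<open>l \<bullet> flow_col c k\<close>, so that by Rolle's
  theorem the number of zeros grows by at most one with \<open>k\<close>; for \<open>k = 0\<close> the function is constant.\<close>

lemma flow_col_zero_count:
  fixes l :: "real^'n::{finite,wellorder}"
  assumes c: "\<And>j. continuous_on UNIV (c j)" and cpos: "\<And>j t. c j t > 0"
  shows "(\<forall>t. l \<bullet> flow_col c k t = 0) \<or> (finite {t. l \<bullet> flow_col c k t = 0} \<and> card {t. l \<bullet> flow_col c k t = 0} \<le> k)"
proof (induction k)
  case 0
  define x where "x = l \<bullet> flow_col c 0 0"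
  have "flow_col c 0 t = (flow_col c 0 0 :: (real, 'n) vec)" for t by (simp add: flow_col_def)
  from arg_cong[OF this, of "\<lambda>v. l \<bullet> v"] have "l \<bullet> flow_col c 0 t = x" for t unfolding x_def .
  then show ?case by (cases "x = 0") simp_all
next
  case (Suc k)
  let ?h = "\<lambda>k t. l \<bullet> flow_col c k t"
  have d: "(?h (Suc k) has_real_derivative c k t * ?h k t) (at t)" for t
    using bounded_linear.has_vector_derivative[OF bounded_linear_inner_right flow_col_deriv[where c = c and k = k and t = t, OF c]]
    by (simp add: has_real_derivative_iff_has_vector_derivative)
  show ?case
  proof (rule ccontr)
    assume neg: "\<not> ?thesis"
    obtain Z where Z: "Z \<subseteq> {t. ?h (Suc k) t = 0}" "finite Z" "card Z = k + 2"
    proof (cases "finite {t. ?h (Suc k) t = 0}")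
      case True
      then have "k + 2 \<le> card {t. ?h (Suc k) t = 0}" using neg by simp
      then show ?thesis using that obtain_subset_with_card_n by metis
    next
      case False
      then show ?thesis using that infinite_arbitrarily_large by metis
    qed
    have "Z \<noteq> {}" using Z by auto
    then obtain Y where Y: "finite Y" "card Z = Suc (card Y)" "\<forall>y\<in>Y. c k y * ?h k y = 0 \<and> y < Max Z"
      using rolle_count[OF d Z(2)] Z(1) by blast
    have "?h k y = 0" if "y \<in> Y" for y using Y(3) that cpos[of k y] by force
    then have sub: "Y \<subseteq> {t. ?h k t = 0}" by blast
    have "\<forall>t. ?h k t = 0"
    proof (rule ccontr)
      assume "\<not> ?thesis"
      then have "finite {t. ?h k t = 0}" "card {t. ?h k t = 0} \<le> k" using Suc by auto
      then show False using card_mono[OF _ sub] Y Z by simp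
    qed
    then have "(?h (Suc k) has_real_derivative 0) (at t)" for t using d[of t] by simp
    then obtain x where x: "\<And>t. ?h (Suc k) t = x"
      using has_field_derivative_zero_constant[of UNIV "?h (Suc k)"] by auto
    obtain z where "z \<in> Z" using \<open>Z \<noteq> {}\<close> by blast
    then have "?h (Suc k) z = 0" using Z(1) by blast
    then have "x = 0" using x[of z] by simp
    then show False using neg x by simp
  qed
qed

lemma flow_col_nontrivial:
  fixes l :: "real^'n::{finite,wellorder}"
  assumes c: "\<And>j. continuous_on UNIV (c j)" and cpos: "\<And>j t. c j t > 0"
    and z: "\<And>t. l \<bullet> flow_col c (CARD('n) - 1) t = 0"
  shows "l = 0"
proof -
  have "\<forall>t. l \<bullet> flow_col c k t = 0" if "k < CARD('n)" for k
  proof -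
    have "k \<le> CARD('n) - 1" using that by simp
    then show ?thesis
    proof (induction rule: inc_induct)
      case (step m)
      have "((\<lambda>t. l \<bullet> flow_col c (Suc m) t) has_vector_derivative l \<bullet> (c m t *\<^sub>R flow_col c m t)) (at t)" for t
        by (rule bounded_linear.has_vector_derivative[OF bounded_linear_inner_right flow_col_deriv[where c = c, OF c]])
      moreover have "(\<lambda>t. l \<bullet> flow_col c (Suc m) t) = (\<lambda>t. 0)" using step.IH by auto
      ultimately have "l \<bullet> (c m t *\<^sub>R flow_col c m t) = 0" for t
        by (metis has_vector_derivative_const vector_derivative_unique_at)
      then show ?case using cpos[of m] by (metis inner_scaleR_right less_irrefl mult_eq_0_iff)
    qed (use z in simp)
  qed
  moreover have "flow_col c k 0 = (eb k :: (real, 'n) vec)" if "k < CARD('n)" for k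
    by (rule vec_eq_en) (use that in \<open>simp add: flow_col_nth flow_0 eb_nth\<close>)
  ultimately have *: "l \<bullet> eb k = 0" if "k < CARD('n)" for k using that by metis
  show ?thesis
  proof (rule vec_eq_en)
    fix i assume "i < CARD('n)"
    then show "l $ en i = 0 $ en i" using *[of i] by (simp add: eb_def inner_axis)
  qed
qed

theorem flow_curve:
  fixes G :: "'n::{finite,wellorder} sqmat" and c :: "nat \<Rightarrow> real \<Rightarrow> real"
  assumes n: "CARD('n) \<ge> 2" and c: "\<And>j. smooth_fun (c j)" and cpos: "\<And>j t. c j t > 0" and G: "invertible G"
  defines "\<gamma> \<equiv> \<lambda>t. G *v flow_col c (CARD('n) - 1) t"
  shows "smooth_curve \<gamma>" "convex_curve (curve_points \<gamma>)" "inj (\<lambda>t. rp_point (\<gamma> t))"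
    "osculating_flag \<gamma> t = flag_act G (flag_act (of_nat_mat (\<lambda>i j. flow c i j t)) flag_minus)"
proof -
  let ?n = "CARD('n)" and ?\<gamma>0 = "flow_col c (CARD('n) - 1) :: real \<Rightarrow> (real, 'n) vec"
  have cc: "\<And>j. continuous_on UNIV (c j)" using c by (intro smooth_fun_continuous)
  obtain G' where G': "G' ** G = Finite_Cartesian_Product.mat 1" using G unfolding invertible_def by blast
  have Ginj: "x = y" if "G *v x = G *v y" for x y
  proof -
    have "G' *v (G *v x) = G' *v (G *v y)" using that by simp
    then show ?thesis by (simp add: matrix_vector_mul_assoc G')
  qed
  have bl: "bounded_linear (\<lambda>x. G *v x)" by (rule matrix_vector_mul_bounded_linear)
  have s0: "smooth_fun ?\<gamma>0" by (rule smooth_fun_flow_col[OF c])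
  have s: "smooth_fun \<gamma>" unfolding \<gamma>_def by (rule smooth_fun_linear[OF bl s0])
  have nth: "nth_vector_derivative j \<gamma> t = G *v nth_vector_derivative j ?\<gamma>0 t" for j t
  proof (induction j arbitrary: t)
    case (Suc j)
    have "((\<lambda>t. G *v nth_vector_derivative j ?\<gamma>0 t) has_vector_derivative G *v vder (nth_vector_derivative j ?\<gamma>0) t) (at t)"
      by (rule bounded_linear.has_vector_derivative[OF bl smooth_fun_vder(1)[OF smooth_fun_nth[OF s0]]])
    moreover have "nth_vector_derivative j \<gamma> = (\<lambda>t. G *v nth_vector_derivative j ?\<gamma>0 t)" using Suc by (intro ext)
    ultimately show ?case unfolding nth_vder_Suc by (simp add: vector_derivative_at)
  qed (simp add: \<gamma>_def)
  \<comment> \<open>The last coordinate is constant and the one before it increases, so the curve has no double points.\<close>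
  have last: "?\<gamma>0 t $ en (?n - 1) = 1" for t using n by (simp add: flow_col_nth flow_diag)
  have proport: "x = y \<and> k = 1" if "?\<gamma>0 x = k *\<^sub>R ?\<gamma>0 y" for x y k
  proof -
    have k: "k = 1" using arg_cong[OF that, of "\<lambda>v. v $ en (?n - 1)"] last by simp
    have n2: "?n - 1 = Suc (?n - 2)" using n by simp
    have eq: "flow c (?n - 2) (?n - 1) x = flow c (?n - 2) (?n - 1) y"
      using arg_cong[OF that, of "\<lambda>v. v $ en (?n - 2)"] k n by (simp add: flow_col_nth)
    have "strict_mono (flow c (?n - 2) (?n - 1))"
    proof (rule strict_monoI)
      fix a b :: real assume "a < b"
      then show "flow c (?n - 2) (?n - 1) a < flow c (?n - 2) (?n - 1) b"
      proof (rule DERIV_pos_imp_increasing)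
        fix t
        have "(flow c (?n - 2) (?n - 1) has_real_derivative c (?n - 2) t * flow c (?n - 2) (?n - 2) t) (at t)"
          unfolding n2 by (rule flow_deriv[OF cc])
        then show "\<exists>d. (flow c (?n - 2) (?n - 1) has_real_derivative d) (at t) \<and> d > 0"
          using cpos[of "?n - 2" t] by (auto simp: flow_diag)
      qed
    qed
    then show ?thesis using eq k by (simp add: strict_mono_eq)
  qed
  show inj: "inj (\<lambda>t. rp_point (\<gamma> t))"
  proof (rule injI)
    fix x y assume "rp_point (\<gamma> x) = rp_point (\<gamma> y)"
    moreover have "\<gamma> x \<in> span {\<gamma> x}" by (simp add: span_base)
    ultimately have "\<gamma> x \<in> span {\<gamma> y}" unfolding rp_point_def by simp
    then obtain k where "\<gamma> x = k *\<^sub>R \<gamma> y" by (auto simp: span_singleton)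
    then have "G *v ?\<gamma>0 x = G *v (k *\<^sub>R ?\<gamma>0 y)" by (simp add: \<gamma>_def matrix_vector_mult_scaleR)
    then show "x = y" using proport Ginj by blast
  qed
  have dim2: "dim {\<gamma> t, vder \<gamma> t} = 2" for t
  proof -
    have n2: "?n - 1 = Suc (?n - 2)" using n by simp
    have "vder ?\<gamma>0 t = c (?n - 2) t *\<^sub>R flow_col c (?n - 2) t"
      unfolding n2 by (rule vector_derivative_at[OF flow_col_deriv[OF cc]])
    then have vder: "vder \<gamma> t = G *v (c (?n - 2) t *\<^sub>R flow_col c (?n - 2) t)"
      using nth[of 1 t] by (simp add: nth_vder_Suc)
    have "vder \<gamma> t \<notin> span {\<gamma> t}"
    proof
      assume "vder \<gamma> t \<in> span {\<gamma> t}"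
      then obtain k where "vder \<gamma> t = k *\<^sub>R \<gamma> t" by (auto simp: span_singleton)
      then have "G *v (c (?n - 2) t *\<^sub>R flow_col c (?n - 2) t) = G *v (k *\<^sub>R ?\<gamma>0 t)"
        unfolding vder by (simp add: \<gamma>_def matrix_vector_mult_scaleR)
      then have e: "c (?n - 2) t *\<^sub>R flow_col c (?n - 2) t = k *\<^sub>R ?\<gamma>0 t" by (rule Ginj)
      have "k = 0" using arg_cong[OF e, of "\<lambda>v. v $ en (?n - 1)"] last n by (simp add: flow_col_nth flow_lower)
      then show False using arg_cong[OF e, of "\<lambda>v. v $ en (?n - 2)"] n cpos[of "?n - 2" t]
        by (simp add: flow_col_nth flow_diag)
    qed
    moreover have "\<gamma> t \<noteq> 0"
    proof
      assume "\<gamma> t = 0"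
      then have "?\<gamma>0 t = 0" using Ginj[of "?\<gamma>0 t" 0] by (simp add: \<gamma>_def)
      then show False using last[of t] by simp
    qed
    ultimately show ?thesis by (simp add: insert_commute[of "\<gamma> t"] dim_insert)
  qed
  show "smooth_curve \<gamma>"
    unfolding smooth_curve_def simple_arc_def smooth_iff_smooth_fun using s dim2 inj by blast
  show "convex_curve (curve_points \<gamma>)"
    unfolding convex_curve_def
  proof (intro allI impI)
    fix H :: "(real, 'n) vec set" assume H: "subspace H \<and> dim H = ?n - 1"
    have "dim (annihilator H) = 1" using dim_annihilator[of H] H n by simp
    then have "\<not> annihilator H \<subseteq> {0}" by (metis dim_eq_0 zero_neq_one)
    then obtain l where l: "l \<noteq> 0" "l \<in> annihilator H" by blast
    define l' where "l' = transpose G *v l"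
    have ip: "l \<bullet> \<gamma> t = l' \<bullet> ?\<gamma>0 t" for t
      by (simp add: \<gamma>_def l'_def dot_lmul_matrix[symmetric] transpose_matrix_vector)
    have l': "l' \<noteq> 0"
    proof
      assume "l' = 0"
      have "l \<bullet> (G *v x) = l' \<bullet> x" for x by (simp add: l'_def dot_lmul_matrix[symmetric] transpose_matrix_vector)
      moreover obtain x where "G *v x = l"
      proof -
        have "G ** G' = Finite_Cartesian_Product.mat 1" using G' by (simp add: matrix_left_right_inverse)
        then have "G *v (G' *v l) = l" by (simp add: matrix_vector_mul_assoc)
        then show ?thesis by (rule that)
      qed
      ultimately have "l \<bullet> l = 0" using \<open>l' = 0\<close> by (metis inner_zero_left)
      then show False using l(1) by simp
    qed
    have fin: "finite {t. l' \<bullet> ?\<gamma>0 t = 0}" "card {t. l' \<bullet> ?\<gamma>0 t = 0} \<le> ?n - 1"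
      using flow_col_zero_count[where c = c and l = l' and k = "?n - 1", OF cc cpos] flow_col_nontrivial[where c = c and l = l', OF cc cpos] l' by blast+
    have sub: "{p \<in> curve_points \<gamma>. p \<subseteq> H} \<subseteq> (\<lambda>t. rp_point (\<gamma> t)) ` {t. l' \<bullet> ?\<gamma>0 t = 0}"
    proof
      fix p assume "p \<in> {p \<in> curve_points \<gamma>. p \<subseteq> H}"
      then obtain t where t: "p = rp_point (\<gamma> t)" "p \<subseteq> H" by (auto simp: curve_points_def)
      then have "\<gamma> t \<in> H" by (auto simp: rp_point_def intro: span_base)
      then have "l \<bullet> \<gamma> t = 0" using l(2) by (simp add: annihilator_def)
      then show "p \<in> (\<lambda>t. rp_point (\<gamma> t)) ` {t. l' \<bullet> ?\<gamma>0 t = 0}" using t(1) ip by auto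
    qed
    have "card {p \<in> curve_points \<gamma>. p \<subseteq> H} \<le> card ((\<lambda>t. rp_point (\<gamma> t)) ` {t. l' \<bullet> ?\<gamma>0 t = 0})"
      by (rule card_mono[OF _ sub]) (use fin in simp)
    also have "\<dots> \<le> card {t. l' \<bullet> ?\<gamma>0 t = 0}" by (rule card_image_le[OF fin(1)])
    finally show "finite {p \<in> curve_points \<gamma>. p \<subseteq> H} \<and> card {p \<in> curve_points \<gamma>. p \<subseteq> H} \<le> ?n - 1"
      using fin finite_subset[OF sub] by auto
  qed
  show "osculating_flag \<gamma> t = flag_act G (flag_act (of_nat_mat (\<lambda>i j. flow c i j t)) flag_minus)"
  proof -
    let ?b = "\<lambda>j. flow_col c (?n - 1 - j) t :: (real, 'n) vec"
    have ex: "\<exists>k. k \<noteq> 0 \<and> nth_vector_derivative j ?\<gamma>0 t - k *\<^sub>R ?b j \<in> span (?b ` {..<j})" if j: "j < ?n - 1" for j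
    proof -
      have "j < ?n" using j by simp
      then obtain a where a: "\<forall>t. a j t > 0" "\<forall>t. nth_vector_derivative j ?\<gamma>0 t = (\<Sum>i\<le>j. a i t *\<^sub>R (flow_col c (?n - 1 - i) t :: (real, 'n) vec))"
        using flow_col_derivatives[where c = c and j = j, OF c cpos] by blast
      have "nth_vector_derivative j ?\<gamma>0 t - a j t *\<^sub>R ?b j = (\<Sum>i<j. a i t *\<^sub>R ?b i)"
        using a(2) by (simp add: lessThan_Suc_atMost[symmetric])
      also have "\<dots> \<in> span (?b ` {..<j})" by (intro span_sum span_scale span_base) auto
      finally show ?thesis using a(1) by (intro exI[of _ "a j t"]) (auto simp: less_imp_neq[symmetric])
    qed
    then obtain k where k: "\<And>j. j < ?n - 1 \<Longrightarrow> k j \<noteq> 0 \<and> nth_vector_derivative j ?\<gamma>0 t - k j *\<^sub>R ?b j \<in> span (?b ` {..<j})"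
      by metis
    have "osculating_flag \<gamma> t = flag_act G (flag_of (\<lambda>j. nth_vector_derivative j ?\<gamma>0 t))"
      unfolding osculating_flag_of flag_act_of nth ..
    also have "flag_of (\<lambda>j. nth_vector_derivative j ?\<gamma>0 t) = flag_of ?b"
      by (rule flag_of_triangular[where k = k]) (use k in auto)
    also have "flag_of ?b = flag_act (of_nat_mat (\<lambda>i j. flow c i j t)) flag_minus"
      unfolding flag_minus_of flag_act_of by (simp add: flow_col_matrix)
    finally show ?thesis .
  qed
qed

section \<open>Concatenation of words\<close>

lemma control_middle:
  assumes \<phi>: "\<And>t. t \<le> 0 \<or> t \<ge> 1 \<Longrightarrow> \<phi> t = 0" and s: "s \<in> {0..real (length B)}"
  shows "control \<phi> e (A @ B @ C) j (real (length A) + s) = control \<phi> e B j s"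
proof -
  let ?f = "\<lambda>k. if fst ((A @ B @ C) ! k) = j then snd ((A @ B @ C) ! k) * \<phi> (real (length A) + s - real k) else 0"
  have z: "?f k = 0" if "k \<notin> {length A..<length A + length B}" for k
  proof -
    have "real (length A) + s - real k \<le> 0 \<or> real (length A) + s - real k \<ge> 1"
      using that s by (cases "k < length A") auto
    then show ?thesis using \<phi> by simp
  qed
  have "(\<Sum>k<length (A @ B @ C). ?f k) = (\<Sum>k\<in>{length A..<length A + length B}. ?f k)"
    by (rule sum.mono_neutral_right) (use z in auto)
  also have "\<dots> = (\<Sum>k<length B. ?f (length A + k))"
    by (rule sum.reindex_bij_witness[of _ "\<lambda>k. length A + k" "\<lambda>k. k - length A"]) auto
  also have "\<dots> = (\<Sum>k<length B. if fst (B ! k) = j then snd (B ! k) * \<phi> (s - real k) else 0)"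
    by (rule sum.cong) (auto simp: nth_append)
  finally show ?thesis by (simp add: control_def)
qed

lemma matrix_prod_en:
  fixes A B :: "'n::{finite,wellorder} sqmat"
  shows "(A ** B) $ i $ j = (\<Sum>k<CARD('n). A $ i $ en k * B $ en k $ j)"
  by (simp add: matrix_matrix_mult_def sum_UNIV_en)

text \<open>A path with positive smooth controls through all partial products of a list.  The constant part \<open>e\<close> of the
  controls is taken small enough for all matrices in the list; as the profiles vanish at the ends of
  their intervals, the words can be put one after the other.\<close>

theorem totally_positive_path:
  fixes us :: "'n::{finite,wellorder} sqmat list"
  assumes n: "CARD('n) \<ge> 2" and us: "\<forall>u\<in>set us. totally_positive_unipotent u"
  obtains c T where "\<And>j. smooth_fun (c j)" "\<And>j t. c j t > 0"
    "\<And>i j. i < j \<Longrightarrow> j \<le> length us \<Longrightarrow> T i < T j"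
    "\<And>i. i \<le> length us \<Longrightarrow> of_nat_mat (\<lambda>r k. flow c r k (T i)) = matrix_prod_list (take i us)"
proof -
  let ?n = "CARD('n)"
  obtain \<phi> :: "real \<Rightarrow> real" where \<phi>: "smooth_fun \<phi>" "\<And>t. \<phi> t \<ge> 0" "\<And>t. t \<le> 0 \<or> t \<ge> 1 \<Longrightarrow> \<phi> t = 0" "integral {0..1} \<phi> = 1"
    by (rule bump_exists) blast
  define R where "R e u ws \<longleftrightarrow> (\<forall>(k, a)\<in>set ws. a \<ge> 0) \<and> ws \<noteq> [] \<and>
       (\<forall>i<?n. \<forall>j<?n. flow (control \<phi> e ws) i j (real (length ws)) = u $ en i $ en j)" for e ws and u :: "'n sqmat"
  have "\<exists>e0>0. \<forall>e. 0 < e \<and> e \<le> e0 \<longrightarrow> (\<exists>ws. R e u ws)" if u: "u \<in> set us" for u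
  proof -
    have tp: "totally_positive_unipotent u" using us u by blast
    have uu: "upper_unipotent u" "corner_positive u"
      using tp totally_positive_corner_positive[OF tp] by (auto simp: totally_positive_unipotent_def)
    show ?thesis
    proof (rule corner_positive_reachable[OF \<phi> uu])
      fix e0 :: real
      assume e0: "e0 > 0" "\<And>e. 0 < e \<Longrightarrow> e \<le> e0 \<Longrightarrow> \<exists>ws. (\<forall>(k, a)\<in>set ws. a \<ge> 0) \<and>
       (\<forall>i<?n. \<forall>j<?n. flow (control \<phi> e ws) i j (real (length ws)) = u $ en i $ en j)"
      have "\<exists>ws. R e u ws" if e: "0 < e" "e \<le> e0" for e
      proof -
        obtain ws where ws: "\<forall>(k, a)\<in>set ws. a \<ge> 0" "\<forall>i<?n. \<forall>j<?n. flow (control \<phi> e ws) i j (real (length ws)) = u $ en i $ en j"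
          using e0(2)[OF e] by blast
        have "ws \<noteq> []" using word_nonempty[OF n uu(2)] ws(2) by blast
        then show ?thesis using ws unfolding R_def by blast
      qed
      then show ?thesis using e0(1) by blast
    qed
  qed
  then obtain E where E: "\<And>u. u \<in> set us \<Longrightarrow> E u > 0 \<and> (\<forall>e. 0 < e \<and> e \<le> E u \<longrightarrow> (\<exists>ws. R e u ws))" by metis
  define e where "e = Min (insert 1 (E ` set us))"
  have e: "e > 0" unfolding e_def using E by (subst Min_gr_iff) auto
  have "\<exists>ws. R e u ws" if "u \<in> set us" for u
  proof -
    have "e \<le> E u" unfolding e_def using that by (intro Min_le) auto
    then show ?thesis using E[OF that] e by blast
  qed
  then obtain wd where wd: "\<And>u. u \<in> set us \<Longrightarrow> R e u (wd u)" by metis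
  define pre where "pre i = concat (map wd (take i us))" for i
  define c where "c = control \<phi> e (pre (length us))"
  define T where "T i = real (length (pre i))" for i
  have pre_Suc: "pre (Suc i) = pre i @ wd (us ! i)" if "i < length us" for i
    using that by (simp add: pre_def take_Suc_conv_app_nth)
  have pos: "c j t > 0" for j t
    unfolding c_def
  proof (rule control_pos[OF \<phi>(2) e])
    fix k a assume "(k, a) \<in> set (pre (length us))"
    then obtain u where "u \<in> set us" "(k, a) \<in> set (wd u)" by (auto simp: pre_def)
    then show "a \<ge> 0" using wd[of u] unfolding R_def by blast
  qed
  have smooth: "smooth_fun (c j)" for j unfolding c_def by (rule control_smooth_fun[OF \<phi>(1)])
  have T_Suc: "T i < T (Suc i)" if "i < length us" for i
    using wd[of "us ! i"] that unfolding R_def by (simp add: T_def pre_Suc)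
  have T: "T i < T j" if "i < j" "j \<le> length us" for i j
    using that
  proof (induction j)
    case (Suc j)
    then show ?case using T_Suc[of j] by (cases "i = j") (auto intro: less_trans)
  qed simp
  have mats: "of_nat_mat (\<lambda>r k. flow c r k (T i)) = matrix_prod_list (take i us)" if "i \<le> length us" for i
    using that
  proof (induction i)
    case 0
    show ?case
      by (rule sqmat_eq_en) (auto simp: of_nat_mat_en T_def pre_def flow_0 matrix_prod_list_def mat_def en_eq_iff)
  next
    case (Suc i)
    let ?u = "us ! i"
    have i: "i < length us" "?u \<in> set us" using Suc.prems by auto
    let ?d = "control \<phi> e (wd ?u)"
    have split: "pre (length us) = pre i @ wd ?u @ concat (map wd (drop (Suc i) us))"
      unfolding pre_def using i by (metis append_take_drop_id concat_append id_take_nth_drop list.simps(9) concat.simps(2) map_append take_all_iff order_refl)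
    show ?case
    proof (rule sqmat_eq_en)
      fix r k assume rk: "r < ?n" "k < ?n"
      have "flow c r k (T i + real (length (wd ?u))) = (\<Sum>l\<le>k. flow c r l (T i) * flow ?d l k (real (length (wd ?u))))"
      proof (rule flow_shift[where b = "real (length (wd ?u))"])
        show "continuous_on UNIV (c j)" "continuous_on UNIV (?d j)" for j
          by (intro smooth_fun_continuous smooth control_smooth_fun \<phi>(1))+
        show "?d j s = c j (T i + s)" if "s \<in> {0..real (length (wd ?u))}" for j s
          unfolding c_def T_def split by (rule control_middle[OF \<phi>(3) that, symmetric])
      qed simp
      also have "\<dots> = (\<Sum>l<?n. flow c r l (T i) * flow ?d l k (real (length (wd ?u))))"
        by (rule sum.mono_neutral_left) (use rk in \<open>auto simp: flow_lower\<close>)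
      also have "\<dots> = (\<Sum>l<?n. matrix_prod_list (take i us) $ en r $ en l * ?u $ en l $ en k)"
      proof (rule sum.cong[OF refl])
        fix l assume "l \<in> {..<?n}"
        moreover have "flow c r l (T i) = matrix_prod_list (take i us) $ en r $ en l" if "l < ?n"
          using Suc that rk by (metis Suc_leD of_nat_mat_en)
        ultimately show "flow c r l (T i) * flow ?d l k (real (length (wd ?u))) = matrix_prod_list (take i us) $ en r $ en l * ?u $ en l $ en k"
          using wd[OF i(2)] rk unfolding R_def by auto
      qed
      also have "\<dots> = matrix_prod_list (take (Suc i) us) $ en r $ en k"
        using i by (simp add: take_Suc_conv_app_nth matrix_prod_list_snoc matrix_prod_en)
      finally have e: "flow c r k (T (Suc i)) = matrix_prod_list (take (Suc i) us) $ en r $ en k"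
        using i by (simp add: T_def pre_Suc)
      show "(of_nat_mat (\<lambda>r k. flow c r k (T (Suc i))) :: 'n sqmat) $ en r $ en k = matrix_prod_list (take (Suc i) us) $ en r $ en k"
        unfolding of_nat_mat_en[OF rk] by (rule e)
    qed
  qed
  show ?thesis by (rule that[OF smooth pos T mats])
qed

section \<open>Configurations\<close>

lemma configuration_act:
  fixes Fs :: "'n::finite flag list"
  assumes "invertible g"
  shows "configuration (map (flag_act g) Fs) = configuration Fs"
proof -
  obtain g' where g': "g' ** g = Finite_Cartesian_Product.mat 1" "g ** g' = Finite_Cartesian_Product.mat 1"
    using assms unfolding invertible_def by blast
  have inv': "invertible g'" using g' unfolding invertible_def by blast
  have comp: "map (flag_act h) (map (flag_act k) Gs) = map (flag_act (h ** k)) Gs" for h k and Gs :: "'n flag list"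
    by (simp add: flag_act_mult)
  show ?thesis
  proof (intro equalityI subsetI)
    fix X assume "X \<in> configuration (map (flag_act g) Fs)"
    then obtain h where "invertible h" "X = map (flag_act h) (map (flag_act g) Fs)"
      unfolding configuration_def by blast
    then show "X \<in> configuration Fs" unfolding configuration_def comp
      using invertible_mult[OF _ assms] by blast
  next
    fix X assume "X \<in> configuration Fs"
    then obtain h where h: "invertible h" "X = map (flag_act h) Fs" unfolding configuration_def by blast
    have "X = map (flag_act (h ** g')) (map (flag_act g) Fs)"
      unfolding comp h(2) matrix_mul_assoc[symmetric] g' by simp
    then show "X \<in> configuration (map (flag_act g) Fs)"
      unfolding configuration_def using invertible_mult[OF h(1) inv'] by blast
  qed
qed

lemma configuration_self: "Fs \<in> configuration Fs" for Fs :: "'n::finite flag list"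
proof -
  have "map (flag_act (Finite_Cartesian_Product.mat 1)) Fs = Fs" by (rule map_idI) (rule flag_act_one)
  then show ?thesis unfolding configuration_def
    by (intro CollectI exI[of _ "Finite_Cartesian_Product.mat 1"]) (auto simp: invertible_def intro!: exI[of _ "Finite_Cartesian_Product.mat 1"])
qed

section \<open>Convex curves give positive configurations\<close>

lemma count_list_replicate: "count_list (replicate q x) y = (if x = y then q else 0)"
  by (induction q) auto

lemma confluent_list_block:
  assumes "x \<notin> set ps"
  shows "confluent_list g (ps @ replicate q x) = confluent_list g ps @ map (\<lambda>j. nth_vector_derivative j g x) [0..<q]"
proof (induction q)
  case (Suc q)
  have "ps @ replicate (Suc q) x = (ps @ replicate q x) @ [x]" by (simp add: replicate_append_same)
  moreover have "count_list (ps @ replicate q x) x = q" using assms by (simp add: count_notin count_list_replicate)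
  ultimately show ?case using Suc by (simp only: confluent_list_snoc) simp
qed simp

lemma curve_chebyshev:
  fixes \<gamma> :: "real \<Rightarrow> real^'n"
  assumes conv: "convex_curve (curve_points \<gamma>)" and inj: "inj_on (\<lambda>t. rp_point (\<gamma> t)) X"
  shows "chebyshev UNIV \<gamma> X CARD('n)"
  unfolding chebyshev_def
proof (intro conjI ballI impI)
  show "subspace (UNIV :: (real^'n) set)" by simp
  show "dim (UNIV :: (real^'n) set) = CARD('n)" by simp
  fix l :: "real^'n" assume l: "l \<noteq> 0"
  define H where "H = {x. l \<bullet> x = 0}"
  have H: "subspace H" "dim H = CARD('n) - 1"
    unfolding H_def using dim_hyperplane[OF l] subspace_hyperplane by auto
  let ?C = "{p \<in> curve_points \<gamma>. p \<subseteq> H}" and ?Z = "{x \<in> X. l \<bullet> \<gamma> x = 0}"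
  have fin: "finite ?C" "card ?C \<le> CARD('n) - 1" using conv H unfolding convex_curve_def by auto
  have sub: "(\<lambda>t. rp_point (\<gamma> t)) ` ?Z \<subseteq> ?C"
  proof -
    have "rp_point (\<gamma> x) \<subseteq> H" if "l \<bullet> \<gamma> x = 0" for x
      unfolding rp_point_def by (rule span_minimal) (use that H(1) in \<open>auto simp: H_def\<close>)
    then show ?thesis by (auto simp: curve_points_def)
  qed
  have inj': "inj_on (\<lambda>t. rp_point (\<gamma> t)) ?Z" by (rule inj_on_subset[OF inj]) auto
  show "finite ?Z" using finite_imageD[OF finite_subset[OF sub fin(1)] inj'] .
  have "card ?Z \<le> CARD('n) - 1"
    using card_mono[OF fin(1) sub] card_image[OF inj'] fin(2) by simp
  then show "card ?Z < CARD('n)" using zero_less_card_finite[where 'a = 'n] by linarith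
qed

text \<open>On a loop the marked parameters fit into an open interval of length 1 because they differ by less
  than 1; it is centred at the midpoint of the first and the last of them.\<close>

lemma oriented_interval:
  fixes \<gamma> :: "real \<Rightarrow> real^'n"
  assumes simple: "simple_arc \<gamma> \<or> simple_loop \<gamma>" and ts: "oriented_points \<gamma> ts" "ts \<noteq> []"
  obtains a b where "a < b" "set ts \<subseteq> {a<..<b}" "inj_on (\<lambda>t. rp_point (\<gamma> t)) {a<..<b}"
proof -
  have sorted: "sorted_wrt (<) ts" using ts by (simp add: oriented_points_def)
  have bounds: "hd ts \<le> t \<and> t \<le> last ts" if t: "t \<in> set ts" for t
  proof -
    obtain i where i: "i < length ts" "t = ts ! i" using t by (auto simp: in_set_conv_nth)
    have "ts ! 0 \<le> ts ! i" using sorted i by (cases "i = 0") (auto simp: sorted_wrt_iff_nth_less less_imp_le)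
    moreover have "ts ! i \<le> ts ! (length ts - 1)"
      using sorted i by (cases "i = length ts - 1") (auto simp: sorted_wrt_iff_nth_less less_imp_le)
    ultimately show ?thesis using ts(2) i by (simp add: hd_conv_nth last_conv_nth)
  qed
  show ?thesis
  proof (cases "simple_arc \<gamma>")
    case True
    then have "inj_on (\<lambda>t. rp_point (\<gamma> t)) {hd ts - 1<..<last ts + 1}"
      unfolding simple_arc_def by (rule inj_on_subset) simp
    moreover have "hd ts \<le> last ts" using bounds ts(2) by auto
    moreover have "set ts \<subseteq> {hd ts - 1<..<last ts + 1}"
    proof
      fix t assume "t \<in> set ts"
      then show "t \<in> {hd ts - 1<..<last ts + 1}" using bounds[of t] by simp
    qed
    ultimately show ?thesis by (intro that[of "hd ts - 1" "last ts + 1"]) auto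
  next
    case False
    then have loop: "simple_loop \<gamma>" using simple by blast
    define a where "a = (hd ts + last ts - 1) / 2"
    have "last ts < hd ts + 1" using ts loop unfolding oriented_points_def by auto
    moreover have "2 * a = hd ts + last ts - 1" by (simp add: a_def)
    ultimately have "a < hd ts" "last ts < a + 1" by simp_all
    then have sub: "set ts \<subseteq> {a<..<a + 1}"
    proof -
      have "t \<in> {a<..<a + 1}" if "t \<in> set ts" for t using bounds[OF that] \<open>a < hd ts\<close> \<open>last ts < a + 1\<close> by simp
      then show ?thesis by blast
    qed
    have per: "rp_point (\<gamma> (t + 1)) = rp_point (\<gamma> t)" for t using loop by (simp add: simple_loop_def)
    have per_nat: "rp_point (\<gamma> (t + real k)) = rp_point (\<gamma> t)" for t k
    proof (induction k)
      case (Suc k)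
      have e: "t + real (Suc k) = (t + real k) + 1" by simp
      show ?case unfolding e using per[of "t + real k"] Suc by (simp only:)
    qed simp
    have per_int: "rp_point (\<gamma> (t + of_int i)) = rp_point (\<gamma> t)" for t i
    proof (cases "i \<ge> 0")
      case True
      then show ?thesis using per_nat[of t "nat i"] by simp
    next
      case False
      then show ?thesis using per_nat[of "t + of_int i" "nat (- i)"] by simp
    qed
    have "inj_on (\<lambda>t. rp_point (\<gamma> t)) {a<..<a + 1}"
    proof (rule inj_onI)
      fix s t assume st: "s \<in> {a<..<a + 1}" "t \<in> {a<..<a + 1}" "rp_point (\<gamma> s) = rp_point (\<gamma> t)"
      have fr: "rp_point (\<gamma> (frac x)) = rp_point (\<gamma> x)" for x
        using per_int[of "frac x" "\<lfloor>x\<rfloor>"] by (simp add: frac_def)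
      have "frac s \<in> {0..<1}" "frac t \<in> {0..<1}" by (auto simp: frac_lt_1)
      moreover have "rp_point (\<gamma> (frac s)) = rp_point (\<gamma> (frac t))" using st(3) by (simp add: fr)
      ultimately have "frac s = frac t" using loop unfolding simple_loop_def inj_on_def by blast
      then have e: "s - t = of_int (\<lfloor>s\<rfloor> - \<lfloor>t\<rfloor>)" by (simp add: frac_def)
      have "\<bar>s - t\<bar> < 1" using st by (auto simp: abs_less_iff)
      then have "\<lfloor>s\<rfloor> - \<lfloor>t\<rfloor> = 0" unfolding e by linarith
      then show "s = t" using e by simp
    qed
    then show ?thesis by (intro that[of a "a + 1"]) (use sub in auto)
  qed
qed

text \<open>All confluent determinants of the osculating bases at the marked points have the same sign, whatever
  the multiplicities; the osculating flags bound the multiplicity at a single point by \<open>CARD('n) - 1\<close>.\<close>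

theorem convex_curve_imp_positive:
  fixes Fs :: "'n::{finite,wellorder} flag list"
  assumes n: "CARD('n) \<ge> 2" and k: "k \<ge> 2" "length Fs = k" and flags: "\<forall>F\<in>set Fs. is_flag F"
    and curve: "smooth_curve \<gamma>" "convex_curve (curve_points \<gamma>)"
    and ts: "length ts = k" "oriented_points \<gamma> ts" and osc: "\<forall>i<k. Fs ! i = osculating_flag \<gamma> (ts ! i)"
  shows "positive_configuration k (configuration Fs)"
proof -
  let ?n = "CARD('n)"
  have s: "smooth_fun \<gamma>" "simple_arc \<gamma> \<or> simple_loop \<gamma>"
    using curve by (auto simp: smooth_curve_def smooth_iff_smooth_fun)
  have "ts \<noteq> []" using ts k by auto
  then obtain a b where ab: "a < b" "set ts \<subseteq> {a<..<b}" "inj_on (\<lambda>t. rp_point (\<gamma> t)) {a<..<b}"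
    using oriented_interval[OF s(2) ts(2)] by blast
  have T: "chebyshev UNIV \<gamma> {a<..<b} ?n" by (rule curve_chebyshev[OF curve(2) ab(3)])
  obtain \<sigma> where \<sigma>: "\<sigma> = 1 \<or> \<sigma> = -1"
    "\<And>ps. sorted ps \<Longrightarrow> set ps \<subseteq> {a<..<b} \<Longrightarrow> length ps = ?n \<Longrightarrow>
       (\<And>x. x \<in> set ps \<Longrightarrow> dim (jets \<gamma> (replicate_mset (count_list ps x) x)) = count_list ps x) \<Longrightarrow>
       \<sigma> * det_list (confluent_list \<gamma> ps) > 0"
    using chebyshev_confluent_sign[OF s(1) T ab(1)] by metis
  have lt: "ts ! i < ts ! j" if "i < j" "j < k" for i j
    using ts that by (auto simp: oriented_points_def sorted_wrt_iff_nth_less)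
  have tin: "ts ! i \<in> {a<..<b}" if "i < k" for i using ab(2) ts(1) that by (metis nth_mem subsetD)
  have single: "dim (jets \<gamma> (replicate_mset q (ts ! i))) = q" if i: "i < k" and q: "q < ?n" for i q
  proof (cases q)
    case 0
    then show ?thesis by (simp add: jets_def)
  next
    case (Suc j)
    have "is_flag (osculating_flag \<gamma> (ts ! i))" using flags osc i k by (metis nth_mem)
    moreover have "j < length (osculating_flag \<gamma> (ts ! i))" using q Suc by (simp add: osculating_flag_def)
    ultimately have "dim (osculating_flag \<gamma> (ts ! i) ! j) = Suc j" unfolding is_flag_def by blast
    then have "dim ((\<lambda>j. nth_vector_derivative j \<gamma> (ts ! i)) ` {..j}) = Suc j"
      using q Suc by (simp add: osculating_flag_def)
    then show ?thesis unfolding Suc replicate_jets lessThan_Suc_atMost .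
  qed
  define D where "D i = (\<lambda>j. nth_vector_derivative j \<gamma> (ts ! i))" for i
  have pos: "\<sigma> * det_list (map (D 0) [0..<x] @ map (D i) [0..<q] @ map (D l) [0..<p]) > 0"
    if il: "0 < i" "i < k" "p = 0 \<or> (i < l \<and> l < k)" and sum: "x + q + p = ?n" "x < ?n" "q < ?n" "p < ?n" for i l x q p
  proof -
    let ?ps = "(replicate x (ts ! 0) @ replicate q (ts ! i)) @ replicate p (ts ! l)"
    have k0: "0 < k" using k by simp
    have t: "ts ! 0 < ts ! i" "p = 0 \<or> (ts ! i < ts ! l \<and> ts ! 0 < ts ! l)"
      using lt[of 0 i] lt[of i l] lt[of 0 l] il by auto
    have "confluent_list \<gamma> ([] @ replicate x (ts ! 0)) = confluent_list \<gamma> [] @ map (\<lambda>j. nth_vector_derivative j \<gamma> (ts ! 0)) [0..<x]"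
      by (rule confluent_list_block) simp
    moreover have "confluent_list \<gamma> (replicate x (ts ! 0) @ replicate q (ts ! i))
        = confluent_list \<gamma> (replicate x (ts ! 0)) @ map (\<lambda>j. nth_vector_derivative j \<gamma> (ts ! i)) [0..<q]"
      by (rule confluent_list_block) (use t in auto)
    moreover have "confluent_list \<gamma> ?ps = confluent_list \<gamma> (replicate x (ts ! 0) @ replicate q (ts ! i)) @ map (\<lambda>j. nth_vector_derivative j \<gamma> (ts ! l)) [0..<p]"
    proof (cases "p = 0")
      case False
      then show ?thesis by (intro confluent_list_block) (use t in auto)
    qed simp
    ultimately have e: "confluent_list \<gamma> ?ps = map (D 0) [0..<x] @ map (D i) [0..<q] @ map (D l) [0..<p]"
      by (simp add: D_def confluent_list_def)
    have "\<sigma> * det_list (confluent_list \<gamma> ?ps) > 0"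
    proof (rule \<sigma>(2))
      show "sorted ?ps" using t by (auto simp: sorted_append)
      show "set ?ps \<subseteq> {a<..<b}" using tin[OF k0] tin[of i] tin[of l] il by auto
      show "length ?ps = ?n" using sum by simp
      fix y assume "y \<in> set ?ps"
      then consider "y = ts ! 0" | "y = ts ! i" | "y = ts ! l" "p \<noteq> 0" by auto
      then obtain m where m: "m < k" "y = ts ! m" using k0 il by (metis (no_types))
      have "count_list ?ps y < ?n"
      proof -
        consider "y = ts ! 0" | "y = ts ! i" | "y = ts ! l" "p \<noteq> 0" using \<open>y \<in> set ?ps\<close> by auto
        then show ?thesis using t sum by cases (auto simp: count_list_replicate)
      qed
      then show "dim (jets \<gamma> (replicate_mset (count_list ?ps y) y)) = count_list ?ps y"
        using single[OF m(1)] m(2) by simp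
    qed
    then show ?thesis unfolding e .
  qed
  obtain g us where g: "invertible g" "length us + 1 = k - 1" "\<forall>u\<in>set us. totally_positive_unipotent u"
    "map (flag_act g) (flag_of (D 0) # map (\<lambda>i. flag_of (D (Suc i))) [0..<k - 1]) = standard_tuple us"
  proof (rule determinant_signs_imp_standard[OF n, of "k - 1" "\<lambda>a. \<sigma>" "D 0" "\<lambda>i. D (Suc i)"])
    show "\<sigma> * det_list (map (D 0) [0..<x] @ map (D (Suc i)) [0..<q]) > 0"
      if "i < k - 1" "x + q = ?n" "1 \<le> x" "1 \<le> q" for i x q
      using pos[of "Suc i" 0 0 x q] that n by simp
    show "\<sigma> * det_list (map (D 0) [0..<x] @ map (D (Suc i)) [0..<q] @ map (D (Suc (Suc i))) [0..<p]) > 0"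
      if "Suc i < k - 1" "x + q + p = ?n" "1 \<le> q" "1 \<le> p" for i x q p
      by (rule pos) (use that in linarith)+
  qed (use \<sigma>(1) k in auto)
  have "Fs = flag_of (D 0) # map (\<lambda>i. flag_of (D (Suc i))) [0..<k - 1]"
  proof (rule nth_equalityI)
    fix i assume "i < length Fs"
    then show "Fs ! i = (flag_of (D 0) # map (\<lambda>i. flag_of (D (Suc i))) [0..<k - 1]) ! i"
      using osc k by (cases i) (auto simp: osculating_flag_of D_def)
  qed (use k in simp)
  then have "configuration Fs = configuration (standard_tuple us)"
    using configuration_act[OF g(1), of Fs] g(4) by simp
  then show ?thesis unfolding positive_configuration_def using g k by (intro exI[of _ us]) auto
qed

section \<open>Positive configurations lie on convex curves\<close>

lemma triple_det:
  fixes v U :: "'n::{finite,wellorder} sqmat"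
  assumes v: "upper_unipotent v" and aqp: "a + q + p = CARD('n)"
  shows "det_list (map eb [0..<a] @ map (\<lambda>j. v *v be j) [0..<q] @ map (\<lambda>j. (v ** U) *v be j) [0..<p])
    = rev_sign (q + p) * mdet p (\<lambda>i j. U $ en (a + i) $ en (CARD('n) - p + j))"
proof -
  have "det_list (map eb [0..<a] @ map (\<lambda>j. v *v be j) [0..<q] @ map (\<lambda>j. (v ** U) *v be j) [0..<p])
      = det_list (map (\<lambda>k. v *v eb k) [0..<a] @ map (\<lambda>j. v *v be j) [0..<q] @ map (\<lambda>j. (v ** U) *v be j) [0..<p])"
    by (rule upper_unipotent_eb_column[OF v, symmetric]) (use aqp in simp)
  also have "\<dots> = det_list (map ((*v) v) (map eb [0..<a] @ map be [0..<q] @ map (\<lambda>j. U *v be j) [0..<p]))"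
    by (simp add: o_def matrix_vector_mul_assoc)
  also have "\<dots> = det_sqmat v * det_list (map eb [0..<a] @ map be [0..<q] @ map (\<lambda>j. U *v be j) [0..<p])"
    by (rule det_list_matrix) (use aqp in simp)
  finally show ?thesis using corner_det[OF aqp, of U] det_sqmat_upper[OF v] by simp
qed

text \<open>The lower triangular exponential with alternating signs.  Its minors have known signs because those of
  the flow with constant controls are positive.\<close>

definition alt_lower :: "real \<Rightarrow> 'n::{finite,wellorder} sqmat" where
  "alt_lower d = of_nat_mat (\<lambda>r c. (-1) ^ r * flow (\<lambda>j t. 1) c r d * (-1) ^ c)"

lemma alt_lower_en:
  "r < CARD('n) \<Longrightarrow> c < CARD('n) \<Longrightarrow> (alt_lower d :: 'n::{finite,wellorder} sqmat) $ en r $ en c = (-1) ^ r * flow (\<lambda>j t. 1) c r d * (-1) ^ c"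
  unfolding alt_lower_def by (rule of_nat_mat_en)

lemma alt_lower_tendsto: "((\<lambda>d. (alt_lower d :: 'n::{finite,wellorder} sqmat) *v x) \<longlongrightarrow> x) (at_right 0)"
proof (rule vec_tendstoI)
  fix k :: 'n
  obtain r where r: "r < CARD('n)" "k = en r" by (rule en_cases)
  have "((\<lambda>d. flow (\<lambda>j t. 1) c r d) \<longlongrightarrow> (if c = r then 1 else 0)) (at_right 0)" for c
  proof -
    have "continuous_on UNIV (flow (\<lambda>j t. 1) c r)" by (rule flow_continuous) simp
    then have "isCont (flow (\<lambda>j t. 1) c r) 0" by (simp add: continuous_on_eq_continuous_at)
    then show ?thesis by (simp add: isCont_def flow_0 filterlim_at_split)
  qed
  then have "((\<lambda>d. \<Sum>c<CARD('n). (-1) ^ r * flow (\<lambda>j t. 1) c r d * (-1) ^ c * x $ en c)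
      \<longlongrightarrow> (\<Sum>c<CARD('n). (-1) ^ r * (if c = r then 1 else 0) * (-1) ^ c * x $ en c)) (at_right 0)"
    by (intro tendsto_intros)
  moreover have "(\<Sum>c<CARD('n). (-1) ^ r * (if c = r then 1 else 0) * (-1) ^ c * x $ en c) = x $ en r"
  proof -
    have "(\<Sum>c<CARD('n). (-1) ^ r * (if c = r then 1 else 0) * (-1) ^ c * x $ en c)
        = (\<Sum>c<CARD('n). if c = r then x $ en c else 0)"
      by (rule sum.cong) (auto simp flip: power_add mult_2)
    then show ?thesis using r by simp
  qed
  moreover have "((alt_lower d :: 'n sqmat) *v x) $ k = (\<Sum>c<CARD('n). (-1) ^ r * flow (\<lambda>j t. 1) c r d * (-1) ^ c * x $ en c)" for d
    unfolding r(2) matrix_vector_nth_en using r(1) by (intro sum.cong) (auto simp: alt_lower_en)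
  ultimately show "((\<lambda>d. ((alt_lower d :: 'n sqmat) *v x) $ k) \<longlongrightarrow> x $ k) (at_right 0)"
    using r(2) by simp
qed

text \<open>Lower triangular matrices fix the lower flag.\<close>

lemma alt_lower_be:
  assumes j: "j < CARD('n)"
  shows "(alt_lower d :: 'n::{finite,wellorder} sqmat) *v be j - be j \<in> span (be ` {..<j})"
proof -
  let ?n = "CARD('n)" and ?x = "(alt_lower d :: 'n sqmat) *v be j - be j"
  have z: "?x $ en i = 0" if "i \<le> ?n - 1 - j" for i
  proof -
    have "i < ?n" "?n - 1 - j < ?n" using that j by auto
    then show ?thesis using that
      by (cases "i = ?n - 1 - j") (auto simp: matrix_vector_eb alt_lower_en eb_nth flow_diag flow_lower simp flip: power_add mult_2)
  qed
  have "?x = (\<Sum>i<?n. ?x $ en i *\<^sub>R eb i)" by (rule vec_eb_expansion)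
  also have "\<dots> \<in> span (be ` {..<j})"
  proof (rule span_sum)
    fix i assume i: "i \<in> {..<?n}"
    show "?x $ en i *\<^sub>R (eb i :: (real, 'n) vec) \<in> span (be ` {..<j})"
    proof (cases "i \<le> ?n - 1 - j")
      case True
      then show ?thesis using z[OF True] by (simp add: span_zero)
    next
      case False
      then have "(eb i :: (real, 'n) vec) = be (?n - 1 - i)" "?n - 1 - i < j" using i by auto
      then show ?thesis by (intro span_scale span_base) auto
    qed
  qed
  finally show ?thesis .
qed

lemma alt_lower_invertible: "invertible (alt_lower d :: 'n::{finite,wellorder} sqmat)"
proof -
  have "det_sqmat (alt_lower d :: 'n sqmat) = mdet CARD('n) (\<lambda>i j. (alt_lower d :: 'n sqmat) $ en j $ en i)"
    unfolding det_sqmat_def by (rule mdet_transpose[symmetric])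
  also have "\<dots> = (\<Prod>i<CARD('n). (alt_lower d :: 'n sqmat) $ en i $ en i)"
    by (rule mdet_upper_triangular) (auto simp: alt_lower_en flow_lower)
  also have "\<dots> = 1" by (simp add: alt_lower_en flow_diag flip: power_add mult_2)
  finally have "det_sqmat (alt_lower d :: 'n sqmat) \<noteq> 0" by simp
  then show ?thesis using det_sqmat_invertible unfolding invertible_def by metis
qed

lemma prod_neg_power: "(\<Prod>j<q. (-1 :: real) ^ (j + N)) = rev_sign q * (-1) ^ (N * q)"
  by (induction q) (simp_all add: rev_sign_Suc power_add mult_ac)

text \<open>The signs \<open>(-1) ^ (j + CARD('n) + 1)\<close> of the basis vectors make the relation to the upper flag and the
  lower flag that of a positive triple in which the moved upper flag stands between them.\<close>

lemma alt_lower_sign: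
  assumes d: "d > 0" and aqp: "a + q + p = CARD('n)"
  shows "rev_sign (q + p) * det_list (map (eb :: nat \<Rightarrow> real^'n::{finite,wellorder}) [0..<a] @
    map (\<lambda>j. (-1) ^ (j + CARD('n) + 1) *\<^sub>R (alt_lower d *v eb j)) [0..<q] @ map be [0..<p]) > 0"
proof -
  let ?n = "CARD('n)" and ?z = "alt_lower d :: 'n sqmat"
  let ?c = "map (\<lambda>j. ?z *v eb j) [0..<q]"
  have "det_list (map eb [0..<a] @ map (\<lambda>j. (-1) ^ (j + ?n + 1) *\<^sub>R (?z *v eb j)) [0..<q] @ map be [0..<p])
      = (\<Prod>j<q. (-1) ^ (j + ?n + 1)) * det_list (map eb [0..<a] @ ?c @ map be [0..<p])"
    by (rule det_list_triangular) (use aqp in \<open>auto simp: span_zero\<close>)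
  also have "(\<Prod>j<q. (-1) ^ (j + ?n + 1)) = rev_sign q * ((-1 :: real) ^ ((?n + 1) * q))"
    using prod_neg_power[where q = q and N = "?n + 1"] by (simp only: add.assoc)
  also have "det_list (map eb [0..<a] @ ?c @ map be [0..<p]) = rev_sign p * det_list (map eb [0..<a] @ ?c @ map eb [a + length ?c..<?n])"
  proof -
    have r: "map be [0..<p] = rev (map (eb :: nat \<Rightarrow> (real, 'n) vec) [a + q..<?n])"
      by (rule nth_equalityI) (use aqp in \<open>auto simp: rev_nth intro!: arg_cong[of _ _ eb]\<close>)
    have "det_list ((map eb [0..<a] @ ?c) @ rev (map eb [a + q..<?n]) @ [])
        = rev_sign (length (map (eb :: nat \<Rightarrow> (real, 'n) vec) [a + q..<?n])) * det_list ((map eb [0..<a] @ ?c) @ map eb [a + q..<?n] @ [])"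
      by (rule det_list_rev) (use aqp in simp)
    moreover have "length (map (eb :: nat \<Rightarrow> (real, 'n) vec) [a + q..<?n]) = p" using aqp by simp
    ultimately show ?thesis unfolding r by simp
  qed
  also have "det_list (map eb [0..<a] @ ?c @ map eb [a + length ?c..<?n]) = mdet (length ?c) (\<lambda>i j. ?c ! i $ en (a + j))"
    by (rule det_list_block[where q = p]) (use aqp in simp)
  also have "\<dots> = mdet q (\<lambda>i j. (-1) ^ i * flow (\<lambda>j t. 1) i (a + j) d * (-1) ^ (a + j))"
  proof -
    have "mdet q (\<lambda>i j. ?c ! i $ en (a + j)) = mdet q (\<lambda>i j. (-1) ^ i * flow (\<lambda>j t. 1) i (a + j) d * (-1) ^ (a + j))"
      by (rule mdet_cong) (use aqp in \<open>simp add: matrix_vector_eb alt_lower_en\<close>)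
    then show ?thesis by simp
  qed
  also have "\<dots> = (\<Prod>i<q. (-1) ^ i) * (\<Prod>j<q. (-1) ^ (a + j)) * mdet q (\<lambda>i j. flow (\<lambda>j t. 1) i (a + j) d)"
    by (rule mdet_scale)
  also have "(\<Prod>i<q. (-1 :: real) ^ i) * (\<Prod>j<q. (-1) ^ (a + j)) = (-1) ^ (a * q)"
  proof -
    have "(\<Prod>j<q. (-1 :: real) ^ (a + j)) = (-1) ^ (a * q) * rev_sign q"
      using prod_neg_power[where q = q and N = a] by (simp add: add.commute)
    then have "(\<Prod>i<q. (-1 :: real) ^ i) * (\<Prod>j<q. (-1) ^ (a + j)) = (rev_sign q * rev_sign q) * (-1) ^ (a * q)"
      by (simp add: rev_sign_def)
    then show ?thesis by simp
  qed
  finally have e: "det_list (map (eb :: nat \<Rightarrow> (real, 'n) vec) [0..<a] @ map (\<lambda>j. (-1) ^ (j + ?n + 1) *\<^sub>R (?z *v eb j)) [0..<q] @ map be [0..<p])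
      = (rev_sign q * (-1) ^ ((?n + 1) * q)) * (rev_sign p * ((-1) ^ (a * q) * mdet q (\<lambda>i j. flow (\<lambda>j t. 1) i (a + j) d)))"
    by simp
  have "mdet q (\<lambda>i j. flow (\<lambda>j t. 1) i (a + j) d) = mdet q (\<lambda>b a'. flow (\<lambda>j t. 1) a' (a + b) d)"
    by (rule mdet_transpose[symmetric])
  also have "\<dots> > 0" by (rule flow_minor_pos) (use d in auto)
  finally have m: "mdet q (\<lambda>i j. flow (\<lambda>j t. 1) i (a + j) d) > 0" .
  have "even (q * p + (?n + 1) * q + a * q)"
  proof -
    have e: "q * p + (?n + 1) * q + a * q = q * (2 * (p + a) + (q + 1))" unfolding aqp[symmetric] by (simp add: algebra_simps)
    show ?thesis unfolding e by (cases "even q") simp_all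
  qed
  then have sg: "(-1 :: real) ^ (q * p) * (-1) ^ ((?n + 1) * q) * (-1) ^ (a * q) = 1"
    unfolding power_add[symmetric] by simp
  have "rev_sign (q + p) * det_list (map (eb :: nat \<Rightarrow> (real, 'n) vec) [0..<a] @ map (\<lambda>j. (-1) ^ (j + ?n + 1) *\<^sub>R (?z *v eb j)) [0..<q] @ map be [0..<p])
      = (rev_sign q * rev_sign q) * (rev_sign p * rev_sign p) * ((-1) ^ (q * p) * (-1) ^ ((?n + 1) * q) * (-1) ^ (a * q)) * mdet q (\<lambda>i j. flow (\<lambda>j t. 1) i (a + j) d)"
    unfolding e rev_sign_add by (simp only: mult_ac)
  then show ?thesis using m unfolding sg by simp
qed

text \<open>Move the tuple by \<open>alt_lower d\<close> and put the upper flag in front.  For small \<open>d > 0\<close> the enlarged tuple satisfies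
  the sign conditions: among the moved flags they are strict for \<open>d = 0\<close>, and for the moved upper flag
  they hold for all \<open>d > 0\<close>.  So it is positive, and after a change of coordinates the given flags are
  images of the lower flag under partial products of totally positive matrices; a path through
  these gives the curve.\<close>

theorem positive_imp_curve:
  fixes Fs :: "'n::{finite,wellorder} flag list"
  assumes n: "CARD('n) \<ge> 2" and k: "length Fs = k" and pc: "positive_configuration k (configuration Fs)"
  shows "\<exists>\<gamma> ts. smooth_curve \<gamma> \<and> convex_curve (curve_points \<gamma>) \<and> length ts = k \<and>
    oriented_points \<gamma> ts \<and> (\<forall>i<k. Fs ! i = osculating_flag \<gamma> (ts ! i))"
proof -
  let ?n = "CARD('n)"
  obtain us where us: "length us + 2 = k" "\<forall>u\<in>set us. totally_positive_unipotent u"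
    "configuration Fs = configuration (standard_tuple us)"
    using pc unfolding positive_configuration_def by blast
  obtain h where h: "invertible h" "Fs = map (flag_act h) (standard_tuple us)"
    using configuration_self[of Fs] us(3) unfolding configuration_def by auto
  define v where "v i = matrix_prod_list (take i us)" for i
  have v0: "v 0 = Finite_Cartesian_Product.mat 1" by (simp add: v_def matrix_prod_list_def)
  have v_Suc: "v (Suc i) = v i ** us ! i" if "i < length us" for i
    using that by (simp add: v_def take_Suc_conv_app_nth matrix_prod_list_snoc)
  have v: "upper_unipotent (v i)" if "i \<le> length us" for i
    using that
  proof (induction i)
    case (Suc i)
    then show ?case using us(2) v_Suc[of i] by (auto simp: totally_positive_unipotent_def intro!: upper_unipotent_mult)
  qed (simp add: v0 upper_unipotent_one)
  \<comment> \<open>Bases of the moved flags; the lower flag is fixed, and keeps its standard basis.\<close>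
  define S where "S d i j = (if i = 0 then be j else alt_lower d *v (v i *v be j))" for d i and j :: nat
  define s where "s d i j = (case i of 0 \<Rightarrow> (-1) ^ (j + ?n + 1) *\<^sub>R (alt_lower d *v eb j) | Suc i \<Rightarrow> S d i j)" for d i and j :: nat
  have S_lim: "((\<lambda>d. S d i j) \<longlongrightarrow> v i *v be j) (at_right 0)" for i j
    using alt_lower_tendsto[of "v i *v be j"] by (cases "i = 0") (simp_all add: S_def v0)
  have lim2: "((\<lambda>d. rev_sign (q + p) * det_list (map eb [0..<a] @ map (S d i) [0..<q] @ map (S d l) [0..<p]))
      \<longlongrightarrow> rev_sign (q + p) * det_list (map eb [0..<a] @ map (\<lambda>j. v i *v be j) [0..<q] @ map (\<lambda>j. v l *v be j) [0..<p])) (at_right 0)"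
    if aqp: "a + q + p = ?n" for a q p i l
  proof (intro tendsto_mult tendsto_const det_list_tendsto)
    fix m assume m: "m < ?n"
    consider "m < a" | "a \<le> m" "m < a + q" | "a + q \<le> m" "m < a + q + p" using m aqp by linarith
    then show "((\<lambda>d. (map eb [0..<a] @ map (S d i) [0..<q] @ map (S d l) [0..<p]) ! m)
        \<longlongrightarrow> (map eb [0..<a] @ map (\<lambda>j. v i *v be j) [0..<q] @ map (\<lambda>j. v l *v be j) [0..<p]) ! m) (at_right 0)"
      by cases (use S_lim[of i "m - a"] S_lim[of l "m - a - q"] in \<open>auto simp: nth_append\<close>)
  qed
  let ?I = "{x. fst x < length us \<and> fst (snd x) + fst (snd (snd x)) + snd (snd (snd x)) = ?n} \<inter> ({..length us} \<times> {..?n} \<times> {..?n} \<times> {..?n})"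
  let ?J = "{x. fst (snd x) + snd (snd x) = ?n} \<inter> ({..length us} \<times> {..?n} \<times> {..?n})"
  have "\<forall>\<^sub>F d in at_right 0. \<forall>x\<in>?I. (case x of (i, a, q, p) \<Rightarrow>
      rev_sign (q + p) * det_list (map eb [0..<a] @ map (S d i) [0..<q] @ map (S d (Suc i)) [0..<p]) > 0)"
  proof (rule eventually_ball_finite)
    show "finite ?I" by (rule finite_Int) (auto intro!: finite_cartesian_product)
    show "\<forall>x\<in>?I. \<forall>\<^sub>F d in at_right 0. (case x of (i, a, q, p) \<Rightarrow>
      rev_sign (q + p) * det_list (map eb [0..<a] @ map (S d i) [0..<q] @ map (S d (Suc i)) [0..<p]) > 0)"
    proof (clarsimp)
      fix i a q p assume i: "i < length us" and aqp: "a + q + p = ?n"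
      have tp: "totally_positive_unipotent (us ! i)" using us(2) i by simp
      have "mdet p (\<lambda>r c. us ! i $ en (a + r) $ en (?n - p + c)) > 0"
        using totally_positive_corner_positive[OF tp] aqp unfolding corner_positive_def by simp
      then have "rev_sign (q + p) * det_list (map eb [0..<a] @ map (\<lambda>j. v i *v be j) [0..<q] @ map (\<lambda>j. v (Suc i) *v be j) [0..<p]) > 0"
        unfolding v_Suc[OF i] triple_det[OF v[OF less_imp_le[OF i]] aqp] by (simp flip: mult.assoc)
      from order_tendstoD(1)[OF lim2[OF aqp, of i "Suc i"] this]
      show "\<forall>\<^sub>F d in at_right 0. 0 < rev_sign (q + p) * det_list (map eb [0..<a] @ map (S d i) [0..<q] @ map (S d (Suc i)) [0..<p])" .
    qed
  qed
  moreover have "\<forall>\<^sub>F d in at_right 0. \<forall>x\<in>?J. (case x of (i, a, q) \<Rightarrow>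
      rev_sign q * det_list (map eb [0..<a] @ map (S d i) [0..<q]) > 0)"
  proof (rule eventually_ball_finite)
    show "finite ?J" by (rule finite_Int) (auto intro!: finite_cartesian_product)
    show "\<forall>x\<in>?J. \<forall>\<^sub>F d in at_right 0. (case x of (i, a, q) \<Rightarrow>
      rev_sign q * det_list (map eb [0..<a] @ map (S d i) [0..<q]) > 0)"
    proof (clarsimp)
      fix i a q assume i: "i \<le> length us" and aq: "a + q = ?n"
      have aqp: "a + q + 0 = ?n" using aq by simp
      have "rev_sign (q + 0) * det_list (map eb [0..<a] @ map (\<lambda>j. v i *v be j) [0..<q] @ map (\<lambda>j. v i *v be j) [0..<0]) > 0"
        using det_list_upper_columns[OF v[OF i] aq] by simp
      from order_tendstoD(1)[OF lim2[OF aqp, of i i] this]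
      show "\<forall>\<^sub>F d in at_right 0. 0 < rev_sign q * det_list (map eb [0..<a] @ map (S d i) [0..<q])" by simp
    qed
  qed
  moreover have "\<forall>\<^sub>F d in at_right (0 :: real). d > 0" by (rule eventually_at_right_less)
  ultimately have "\<forall>\<^sub>F d in at_right 0. d > 0 \<and> (\<forall>x\<in>?I. (case x of (i, a, q, p) \<Rightarrow>
      rev_sign (q + p) * det_list (map eb [0..<a] @ map (S d i) [0..<q] @ map (S d (Suc i)) [0..<p]) > 0)) \<and>
      (\<forall>x\<in>?J. (case x of (i, a, q) \<Rightarrow> rev_sign q * det_list (map eb [0..<a] @ map (S d i) [0..<q]) > 0))"
    by eventually_elim blast
  then obtain d where d: "d > 0" "\<forall>x\<in>?I. (case x of (i, a, q, p) \<Rightarrow>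
      rev_sign (q + p) * det_list (map eb [0..<a] @ map (S d i) [0..<q] @ map (S d (Suc i)) [0..<p]) > 0)"
      "\<forall>x\<in>?J. (case x of (i, a, q) \<Rightarrow> rev_sign q * det_list (map eb [0..<a] @ map (S d i) [0..<q]) > 0)"
    using eventually_happens[of _ "at_right (0::real)"] by (metis (no_types, lifting) trivial_limit_at_right_real)
  have dI: "rev_sign (q + p) * det_list (map eb [0..<a] @ map (S d i) [0..<q] @ map (S d (Suc i)) [0..<p]) > 0"
    if "i < length us" "a + q + p = ?n" for i a q p
    using d(2)[rule_format, of "(i, a, q, p)"] that by simp
  have dJ: "rev_sign q * det_list (map eb [0..<a] @ map (S d i) [0..<q]) > 0" if "i \<le> length us" "a + q = ?n" for i a q
    using d(3)[rule_format, of "(i, a, q)"] that by simp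
  obtain g ws where g: "invertible g" "length ws + 1 = k" "\<forall>w\<in>set ws. totally_positive_unipotent w"
    "map (flag_act g) (flag_of eb # map (\<lambda>i. flag_of (s d i)) [0..<k]) = standard_tuple ws"
  proof (rule determinant_signs_imp_standard[OF n, of k "\<lambda>a. rev_sign (?n - a)" eb "s d"])
    show "1 \<le> k" using us(1) by simp
    show "rev_sign (?n - a) = 1 \<or> rev_sign (?n - a) = -1" for a by (rule sgn_rev_sign)
    show "rev_sign (?n - a) * det_list (map eb [0..<a] @ map (s d i) [0..<q]) > 0"
      if "i < k" "a + q = ?n" "1 \<le> a" "1 \<le> q" for i a q
    proof (cases i)
      case 0
      have "?n - a = q" using that by simp
      then show ?thesis using alt_lower_sign[OF d(1), of a q 0, where 'n = 'n] that 0 by (simp add: s_def[abs_def])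
    next
      case (Suc i')
      have "?n - a = q" using that by simp
      then show ?thesis using dJ[of i' a q] that Suc us(1) by (simp add: s_def[abs_def])
    qed
    show "rev_sign (?n - a) * det_list (map eb [0..<a] @ map (s d i) [0..<q] @ map (s d (Suc i)) [0..<p]) > 0"
      if "Suc i < k" "a + q + p = ?n" "1 \<le> q" "1 \<le> p" for i a q p
    proof (cases i)
      case 0
      have "?n - a = q + p" using that by simp
      then show ?thesis using alt_lower_sign[OF d(1) that(2)] 0 by (simp add: s_def[abs_def] S_def)
    next
      case (Suc i')
      have "?n - a = q + p" using that by simp
      then show ?thesis using dI[of i' a q p] that Suc us(1) by (simp add: s_def[abs_def])
    qed
  qed
  let ?z = "alt_lower d :: 'n sqmat"
  have tuple: "flag_of (s d i) = flag_act ?z (standard_tuple us ! i)" if i: "i < k" for i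
  proof (cases i)
    case 0
    have "flag_of (s d 0) = flag_of (\<lambda>j. ?z *v eb j)"
      by (rule flag_of_triangular[where k = "\<lambda>j. (-1) ^ (j + ?n + 1)"]) (auto simp: s_def span_zero)
    then show ?thesis using 0 by (simp add: standard_tuple_def flag_plus_of flag_act_of)
  next
    case (Suc i')
    have i': "i' \<le> length us" using Suc i us(1) by simp
    have std: "standard_tuple us ! i = flag_act (v i') flag_minus"
      using Suc i' unfolding standard_tuple_def v_def by (simp del: upt_Suc)
    show ?thesis
    proof (cases "i' = 0")
      case True
      have "flag_of (\<lambda>j. ?z *v be j) = flag_of (be :: nat \<Rightarrow> (real, 'n) vec)"
      proof (rule flag_of_triangular[where k = "\<lambda>j. 1"])
        show "?z *v be j - 1 *\<^sub>R be j \<in> span (be ` {..<j})" if "j < ?n - 1" for j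
          using alt_lower_be[of j d, where 'n = 'n] that by simp
      qed simp
      moreover have "s d i = be" using Suc True by (intro ext) (simp add: s_def S_def)
      ultimately show ?thesis using True unfolding std by (simp add: v0 flag_act_one flag_minus_of flag_act_of)
    next
      case False
      have "s d i = (\<lambda>j. ?z *v (v i' *v be j))" using Suc False by (intro ext) (simp add: s_def S_def)
      then show ?thesis unfolding std by (simp add: flag_minus_of flag_act_of)
    qed
  qed
  have gs: "flag_act g (flag_of (s d i)) = flag_act (matrix_prod_list (take i ws)) flag_minus" if i: "i < k" for i
  proof -
    have "(map (flag_act g) (flag_of eb # map (\<lambda>i. flag_of (s d i)) [0..<k])) ! Suc i = standard_tuple ws ! Suc i"
      by (simp only: g(4))
    then show ?thesis using i g(2) unfolding standard_tuple_def by (simp del: upt_Suc)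
  qed
  have "invertible (g ** ?z)" by (rule invertible_mult[OF g(1) alt_lower_invertible])
  then obtain M where M: "M ** (g ** ?z) = Finite_Cartesian_Product.mat 1" "(g ** ?z) ** M = Finite_Cartesian_Product.mat 1"
    unfolding invertible_def by blast
  have "invertible M" using M unfolding invertible_def by blast
  then have G: "invertible (h ** M)" by (rule invertible_mult[OF h(1)])
  obtain c T where cT: "\<And>j. smooth_fun (c j)" "\<And>j t. c j t > 0"
    "\<And>i j. i < j \<Longrightarrow> j \<le> length ws \<Longrightarrow> T i < T j"
    "\<And>i. i \<le> length ws \<Longrightarrow> (of_nat_mat (\<lambda>r k. flow c r k (T i)) :: 'n sqmat) = matrix_prod_list (take i ws)"
    using totally_positive_path[OF n g(3)] by metis
  define \<gamma> where "\<gamma> t = (h ** M) *v flow_col c (?n - 1) t" for t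
  note fc = flow_curve[where c = c and G = "h ** M", OF n cT(1,2) G, folded \<gamma>_def]
  define ts where "ts = map T [0..<k]"
  have ori: "oriented_points \<gamma> ts"
    unfolding oriented_points_def
  proof (intro conjI impI)
    show "sorted_wrt (<) ts" using cT(3) g(2) by (auto simp: ts_def sorted_wrt_iff_nth_less)
    assume "simple_loop \<gamma>"
    then have "rp_point (\<gamma> (0 + 1)) = rp_point (\<gamma> 0)" unfolding simple_loop_def by blast
    then have "(0 + 1 :: real) = 0" by (rule injD[OF fc(3)])
    then show "\<forall>s\<in>set ts. \<forall>t\<in>set ts. t < s + 1" by simp
  qed
  have "Fs ! i = osculating_flag \<gamma> (ts ! i)" if i: "i < k" for i
  proof -
    have "i < length (standard_tuple us)" using i us(1) by (simp add: standard_tuple_def)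
    then have "Fs ! i = flag_act h (standard_tuple us ! i)" using h(2) by simp
    also have "standard_tuple us ! i = flag_act (M ** (g ** ?z)) (standard_tuple us ! i)" by (simp add: M flag_act_one)
    also have "\<dots> = flag_act M (flag_act g (flag_of (s d i)))" by (simp add: flag_act_mult tuple[OF i])
    also have "\<dots> = flag_act M (flag_act (matrix_prod_list (take i ws)) flag_minus)" by (simp add: gs[OF i])
    also have "flag_act h \<dots> = flag_act (h ** M) (flag_act (matrix_prod_list (take i ws)) flag_minus)" by (simp add: flag_act_mult)
    also have "\<dots> = osculating_flag \<gamma> (T i)" using cT(4)[of i] i g(2) by (simp add: fc(4))
    finally show ?thesis using i by (simp add: ts_def)
  qed
  then show ?thesis using fc(1,2) ori by (intro exI[of _ \<gamma>] exI[of _ ts]) (auto simp: ts_def)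
qed

theorem theorem1p3:
  fixes Fs :: "'n::{finite,wellorder} flag list" and m k :: nat
  assumes "CARD('n) = m + 1" and "m \<ge> 1"
    and "k \<ge> 2" and "length Fs = k" and "\<forall>F\<in>set Fs. is_flag F"
  shows "positive_configuration k (configuration Fs) \<longleftrightarrow>
    (\<exists>\<gamma> ts.
        smooth_curve \<gamma> \<and> convex_curve (curve_points \<gamma>) \<and>
        length ts = k \<and> oriented_points \<gamma> ts \<and>
        (\<forall>i<k. Fs ! i = osculating_flag \<gamma> (ts ! i)))"
proof
  have n: "CARD('n) \<ge> 2" using assms by simp
  show "\<exists>\<gamma> ts. smooth_curve \<gamma> \<and> convex_curve (curve_points \<gamma>) \<and> length ts = k \<and> oriented_points \<gamma> ts \<and>
      (\<forall>i<k. Fs ! i = osculating_flag \<gamma> (ts ! i))" if "positive_configuration k (configuration Fs)"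
    by (rule positive_imp_curve[OF n assms(4) that])
  show "positive_configuration k (configuration Fs)" if "\<exists>\<gamma> ts. smooth_curve \<gamma> \<and> convex_curve (curve_points \<gamma>) \<and>
      length ts = k \<and> oriented_points \<gamma> ts \<and> (\<forall>i<k. Fs ! i = osculating_flag \<gamma> (ts ! i))"
    using that convex_curve_imp_positive[OF n assms(3,4,5)] by blast
qed

end
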